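(* Let $X\subset\mathbb P^n$ be a curve whose restriction to the torus $T$ is the complete intersection of hypersurfaces $X_1,\dots,X_{n-1}\subset T$, $X_i=V(f_i)$. Assume that $X_1,\dots,X_{n-1}$ form a tropical complete intersection, that for every $i$ and every codimension one cell of $\operatorname{Trop}(X_i)$, $f_i$ has exactly three terms of minimal valuation at points tropicalizing to its relative interior, and that $X_1,\dots,X_{n-1}$ have very general valuations. Fix a tame vertex $\alpha$ of $\operatorname{Trop}(X)$. For a tropical tangent $\beta$ to $\alpha$, choose tropical Plücker coordinates $\beta_{ij}$ so that $\beta_{ij}\ge\alpha_i+\alpha_j$ for all $i\ne j$ with equality for at least one pair, and set $\delta_{ij}=\beta_{ij}-(\alpha_i+\alpha_j)$. Then the contribution of $\alpha$ to $\operatorname{Trop}(\tau(X))$ consists of the union over all tropical tangents $\beta$ to $\alpha$ of $$\alpha+\sum_{j\neq i}\delta_{ij}e_j+\Big(\max_{j\neq i}\delta_{ij}\Big)e_i+\mathbb R_{\ge0}e_i,\qquad i=0,\dots,n.$$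
   Context: $\mathbb K$ is an algebraically closed field of characteristic zero with a nontrivial non-Archimedean valuation $\operatorname{val}:\mathbb K\to\mathbb R\cup\{\infty\}$, $\operatorname{val}(0)=\infty$, with $\operatorname{val}(m)=0$ for nonzero integers $m$; $\Gamma=\operatorname{val}(\mathbb K^* )$. $T\subset\mathbb P^n$ is the torus where all coordinates are nonzero, $M=\{w\in\mathbb Z^{n+1}:\sum w_i=0\}$, $\mathbb T^n=\mathbb R^{n+1}/\mathbb R(1,\dots,1)$ with $e_0,\dots,e_n$ the images of the standard basis. $\operatorname{Trop}$ is coordinatewise valuation, $\operatorname{Trop}(Y)$ the closure of the image of the torus part of $Y$. $\overline J=\{0,\dots,n\}\setminus J$; $\langle J\rangle=\operatorname{span}\{e_i:i\in J\}$; for an affine space $\Lambda$, $\langle\Lambda\rangle$ is the linear span of differences of its elements. Cells of $\operatorname{Trop}(X_i)$ are determined by which terms of $f_i$ have minimal valuation. Tropical complete intersection: for all cells $E_i\subset\operatorname{Trop}(X_i)$, $\bigcap E_i$ is empty or of codimension $\sum\operatorname{codim}E_i$; then $\operatorname{Trop}(X)=\bigcap\operatorname{Trop}(X_i)$, with cells the intersections of cells. A vertex $\alpha$ is tame if the affine span $\Lambda$ of a small neighborhood of $\alpha$ in $\operatorname{Trop}(X)$ satisfies $\langle\Lambda\rangle\not\subseteq\langle\overline J\rangle$ for all $J$ with $|J|=2$. Very general valuations: for $\alpha'$ in the relative interior of a cell of $\operatorname{Trop}(X)$, write $f_i=\sum_{w\in\mathcal A_i}c_{iw}x^w$ ($\mathcal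 A_i\subset M$ finite, $c_{iw}\ne0$), multiplied by monomials so that the terms of minimal valuation at $\alpha'$ include $1$; let $c_{i\mathbf v_i}x^{\mathbf v_i}$ be another term of minimal valuation of $f_i$. A cancellative pair for $\alpha'$ is a pair of distinct $\mathbf r,\mathbf r'\in\prod_i(\mathcal A_i\setminus\{0\})$ with $\prod_ic_{i\mathbf r_i}x^{\mathbf r_i}$ and $\prod_ic_{i\mathbf r'_i}x^{\mathbf r'_i}$ of equal valuation at $\alpha'$. The critical locus is the set of $\alpha'\in\operatorname{Trop}(X)$ having a cancellative pair. The $X_i$ have very general valuations if the critical locus is finite and for every $\alpha'$ in it the family of real numbers $\operatorname{val}(c_{iw}x^w)$ at $\alpha'$, indexed by $i$ and $w\in\mathcal A_i\setminus\{0,\mathbf v_i\}$, has exactly one linear dependence over $\mathbb Q$ (up to scaling). $\tau(X)\subset\mathbb P^n$ is the closure of the union of the tangent lines $T_PX$ at smooth points $P$ of $X$. A tropical tangent to $\alpha$ is $\beta=(\operatorname{val}p_{ij}(T_PX))_{i<j}$ (Plücker coordinates, modulo common additive constants) for a smooth $P\in X$ with $\operatorname{Trop}(P)=\alpha$. The contribution of $\alpha$ to $\operatorname{Trop}(\tau(X))$ is the union over all tropical tangents $\beta$ to $\alpha$ of the corresponding tropical line, i.e. of the set of $x\in\mathbb T^n$ such that for all distinct $i,j,k$ the minimum of $\beta_{ij}+x_k,\ \beta_{ik}+x_j,\ \beta_{jk}+x_i$ is attained at least twice. (As tropical tangents are defined by lifting to $\mathbb K$-points, whose valuations lie in $\Gamma$,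 both unions are understood up to closure.) *)

theory Defs
  imports
    "HOL-Analysis.Analysis"
    "HOL-Library.Poly_Mapping"
    "HOL-Computational_Algebra.Polynomial"
begin

(* Conventions.  Projective space is coordinatised by a finite index type 'n with
   CARD('n) = n + 1.  Subsets of projective space over 'k are sets of (nonzero) vectors of
   homogeneous coordinates.  Points and subsets of the tropical torus R^(n+1) / R(1,...,1) are
   represented by representatives in real^'n and by subsets of real^'n invariant under
   translation by multiples of 1 = (1,...,1).  Passing to preimages under the (open, linear)
   quotient map preserves closures, codimensions and relative interiors. *)


section \<open>The valued field\<close>

definition valuation :: "('k::field \<Rightarrow> ereal) \<Rightarrow> bool" where
  "valuation val \<longleftrightarrow>
     (\<forall>x. val x \<noteq> -\<infinity>) \<and> (\<forall>x. val x = \<infinity> \<longleftrightarrow> x = 0) \<and>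
     (\<forall>x y. val (x * y) = val x + val y) \<and>
     (\<forall>x y. min (val x) (val y) \<le> val (x + y))"


section \<open>Projective algebraic sets and curves\<close>

type_synonym ('k, 'n) hpoly = "(nat ^ 'n) \<Rightarrow>\<^sub>0 'k"

definition homogeneous :: "('k::field, 'n::finite) hpoly \<Rightarrow> bool" where
  "homogeneous F \<longleftrightarrow> (\<exists>d. \<forall>w\<in>Poly_Mapping.keys F. (\<Sum>j\<in>UNIV. w $ j) = d)"

definition heval :: "('k::field, 'n::finite) hpoly \<Rightarrow> 'k ^ 'n \<Rightarrow> 'k" where
  "heval F x =
     (\<Sum>w\<in>Poly_Mapping.keys F. Poly_Mapping.lookup F w * (\<Prod>j\<in>UNIV. x $ j ^ (w $ j)))"

(* Truncated subtraction of exponents is harmless: the coefficient vanishes if w $ j = 0. *)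
definition partial_deriv :: "'n \<Rightarrow> ('k::field, 'n::finite) hpoly \<Rightarrow> ('k, 'n) hpoly" where
  "partial_deriv j F =
     (\<Sum>w\<in>Poly_Mapping.keys F.
        Poly_Mapping.single (w - axis j 1) (of_nat (w $ j) * Poly_Mapping.lookup F w))"

definition proj_closed :: "('k::field ^ 'n::finite) set \<Rightarrow> bool" where
  "proj_closed Z \<longleftrightarrow>
     (\<exists>S. (\<forall>F\<in>S. homogeneous F) \<and> Z = {x. x \<noteq> 0 \<and> (\<forall>F\<in>S. heval F x = 0)})"

definition proj_irreducible :: "('k::field ^ 'n::finite) set \<Rightarrow> bool" where
  "proj_irreducible Z \<longleftrightarrow> proj_closed Z \<and> Z \<noteq> {} \<and>
     (\<forall>A B. proj_closed A \<and> proj_closed B \<and> Z = A \<union> B \<longrightarrow> Z = A \<or> Z = B)"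

definition irreducible_component ::
    "('k::field ^ 'n::finite) set \<Rightarrow> ('k ^ 'n) set \<Rightarrow> bool" where
  "irreducible_component C X \<longleftrightarrow> proj_irreducible C \<and> C \<subseteq> X \<and>
     (\<forall>D. proj_irreducible D \<and> C \<subseteq> D \<and> D \<subseteq> X \<longrightarrow> D = C)"

definition irreducible_chain :: "('k::field ^ 'n::finite) set \<Rightarrow> nat \<Rightarrow> bool" where
  "irreducible_chain Y d \<longleftrightarrow>
     (\<exists>Z. (\<forall>i\<le>d. proj_irreducible (Z i) \<and> Z i \<subseteq> Y) \<and> (\<forall>i<d. Z i \<subset> Z (Suc i)))"

(* Krull dimension *)
definition has_dimension :: "('k::field ^ 'n::finite) set \<Rightarrow> nat \<Rightarrow> bool" where
  "has_dimension Y d \<longleftrightarrow> irreducible_chain Y d \<and> \<not> irreducible_chain Y (Suc d)"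

definition curve :: "('k::field ^ 'n::finite) set \<Rightarrow> bool" where
  "curve X \<longleftrightarrow> proj_closed X \<and> X \<noteq> {} \<and>
     (\<forall>C. irreducible_component C X \<longrightarrow> has_dimension C 1)"

(* The linear subspace of 'k^'n whose projectivisation is the embedded tangent space of X at P. *)
definition tangent_space ::
    "('k::field ^ 'n::finite) set \<Rightarrow> 'k ^ 'n \<Rightarrow> ('k ^ 'n) set" where
  "tangent_space X P =
     {y. \<forall>F. homogeneous F \<and> (\<forall>x\<in>X. heval F x = 0) \<longrightarrow>
             (\<Sum>j\<in>UNIV. heval (partial_deriv j F) P * y $ j) = 0}"

(* For a curve X, P is smooth iff its embedded tangent space is a line, i.e. a plane in 'k^'n. *)
definition smooth_point :: "('k::field ^ 'n::finite) set \<Rightarrow> 'k ^ 'n \<Rightarrow> bool" where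
  "smooth_point X P \<longleftrightarrow> P \<in> X \<and> vec.dim (tangent_space X P) = 2"

definition pluecker_coords ::
    "('k::field ^ 'n::finite) set \<Rightarrow> ('n \<Rightarrow> 'n \<Rightarrow> 'k) \<Rightarrow> bool" where
  "pluecker_coords L p \<longleftrightarrow>
     (\<exists>u v. u \<noteq> v \<and> vec.independent {u, v} \<and> vec.span {u, v} = L \<and>
            (\<forall>i j. p i j = u $ i * v $ j - u $ j * v $ i))"


section \<open>The torus, Laurent polynomials, complete intersections\<close>

definition torus :: "('k::field ^ 'n::finite) set" where
  "torus = {x. \<forall>j. x $ j \<noteq> 0}"

type_synonym ('k, 'n) laurent = "(int ^ 'n) \<Rightarrow>\<^sub>0 'k"

definition char_lattice :: "(int ^ 'n::finite) set" where
  "char_lattice = {w. (\<Sum>j\<in>UNIV. w $ j) = 0}"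

(* The coordinate ring of the torus: Laurent polynomials of degree 0. *)
definition torus_ring :: "('k::field, 'n::finite) laurent set" where
  "torus_ring = {f. Poly_Mapping.keys f \<subseteq> char_lattice}"

definition leval :: "('k::field, 'n::finite) laurent \<Rightarrow> 'k ^ 'n \<Rightarrow> 'k" where
  "leval f x =
     (\<Sum>w\<in>Poly_Mapping.keys f. Poly_Mapping.lookup f w * (\<Prod>j\<in>UNIV. x $ j powi (w $ j)))"

definition hypersurface :: "('k::field, 'n::finite) laurent \<Rightarrow> ('k ^ 'n) set" where
  "hypersurface f = {x \<in> torus. leval f x = 0}"

(* The restriction of X to the torus is cut out by f 1, ..., f (n - 1), both as a set and
   ideal-theoretically. *)
definition torus_complete_intersection ::
    "nat \<Rightarrow> (nat \<Rightarrow> ('k::field, 'n::finite) laurent) \<Rightarrow> ('k ^ 'n) set \<Rightarrow> bool" where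
  "torus_complete_intersection n f X \<longleftrightarrow>
     X \<inter> torus = {x \<in> torus. \<forall>i\<in>{1..<n}. x \<in> hypersurface (f i)} \<and>
     (\<forall>g\<in>torus_ring. (\<forall>x\<in>X \<inter> torus. leval g x = 0) \<longleftrightarrow>
        (\<exists>h. (\<forall>i\<in>{1..<n}. h i \<in> torus_ring) \<and> g = (\<Sum>i\<in>{1..<n}. h i * f i)))"


section \<open>Tropicalisation\<close>

definition trop_point :: "('k::field \<Rightarrow> ereal) \<Rightarrow> 'k ^ 'n::finite \<Rightarrow> real ^ 'n" where
  "trop_point val x = (\<chi> j. real_of_ereal (val (x $ j)))"

(* Equality of points of the tropical torus. *)
definition trop_eq :: "real ^ 'n::finite \<Rightarrow> real ^ 'n \<Rightarrow> bool" where
  "trop_eq u v \<longleftrightarrow> (\<exists>c::real. u = v + c *\<^sub>R 1)"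

definition trop :: "('k::field \<Rightarrow> ereal) \<Rightarrow> ('k ^ 'n::finite) set \<Rightarrow> (real ^ 'n) set" where
  "trop val Y = closure {u. \<exists>x\<in>Y \<inter> torus. trop_eq u (trop_point val x)}"

(* The valuation of the term of f with exponent w at any point tropicalising to u. *)
definition term_val ::
    "('k::field \<Rightarrow> ereal) \<Rightarrow> ('k, 'n::finite) laurent \<Rightarrow> real ^ 'n \<Rightarrow> int ^ 'n \<Rightarrow> real" where
  "term_val val f u w =
     real_of_ereal (val (Poly_Mapping.lookup f w)) + (\<Sum>j\<in>UNIV. of_int (w $ j) * u $ j)"

definition min_terms ::
    "('k::field \<Rightarrow> ereal) \<Rightarrow> ('k, 'n::finite) laurent \<Rightarrow> real ^ 'n \<Rightarrow> (int ^ 'n) set" where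
  "min_terms val f u =
     {w \<in> Poly_Mapping.keys f.
        \<forall>w'\<in>Poly_Mapping.keys f. term_val val f u w \<le> term_val val f u w'}"

(* The (closed) cells of Trop(V(f)); the one containing u in its relative interior. *)
definition cells ::
    "('k::field \<Rightarrow> ereal) \<Rightarrow> ('k, 'n::finite) laurent \<Rightarrow> (real ^ 'n) set set" where
  "cells val f =
     {{v \<in> trop val (hypersurface f). min_terms val f u \<subseteq> min_terms val f v} |u.
        u \<in> trop val (hypersurface f)}"

(* Codimension in the tropical torus. *)
definition codim :: "(real ^ 'n::finite) set \<Rightarrow> int" where
  "codim E = int CARD('n) - aff_dim E"

definition tropical_complete_intersection ::
    "('k::field \<Rightarrow> ereal) \<Rightarrow> nat \<Rightarrow> (nat \<Rightarrow> ('k, 'n::finite) laurent) \<Rightarrow> bool" where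
  "tropical_complete_intersection val n f \<longleftrightarrow>
     (\<forall>E. (\<forall>i\<in>{1..<n}. E i \<in> cells val (f i)) \<longrightarrow>
        (\<Inter>i\<in>{1..<n}. E i) = {} \<or>
        codim (\<Inter>i\<in>{1..<n}. E i) = (\<Sum>i\<in>{1..<n}. codim (E i)))"

(* Cells of codimension one are taken relative to Trop(V(f)), which itself has codimension one
   in the tropical torus. *)
definition three_terms_in_codim_one ::
    "('k::field \<Rightarrow> ereal) \<Rightarrow> ('k, 'n::finite) laurent \<Rightarrow> bool" where
  "three_terms_in_codim_one val f \<longleftrightarrow>
     (\<forall>E\<in>cells val f. codim E = 2 \<longrightarrow>
        (\<forall>u\<in>rel_interior E. card (min_terms val f u) = 3))"

(* The cells of Trop(X) for X cut out by a tropical complete intersection. *)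
definition ci_cells ::
    "('k::field \<Rightarrow> ereal) \<Rightarrow> nat \<Rightarrow> (nat \<Rightarrow> ('k, 'n::finite) laurent) \<Rightarrow> (real ^ 'n) set set"
  where
  "ci_cells val n f =
     {(\<Inter>i\<in>{1..<n}. E i) |E. \<forall>i\<in>{1..<n}. E i \<in> cells val (f i)} - {{}}"

definition vertex ::
    "('k::field \<Rightarrow> ereal) \<Rightarrow> nat \<Rightarrow> (nat \<Rightarrow> ('k, 'n::finite) laurent) \<Rightarrow> real ^ 'n \<Rightarrow> bool"
  where
  "vertex val n f \<alpha> \<longleftrightarrow> {u. trop_eq u \<alpha>} \<in> ci_cells val n f"

(* The preimage in real^'n of the span of the images of the e_i, i in J. *)
definition coord_span :: "'n::finite set \<Rightarrow> (real ^ 'n) set" where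
  "coord_span J = span (insert 1 {axis i 1 |i. i \<in> J})"

definition tame ::
    "('k::field \<Rightarrow> ereal) \<Rightarrow> ('k ^ 'n::finite) set \<Rightarrow> real ^ 'n \<Rightarrow> bool" where
  "tame val X \<alpha> \<longleftrightarrow>
     (\<forall>\<^sub>F \<epsilon> in at_right 0.
        let \<Lambda> = affine hull (trop val X \<inter> ball \<alpha> \<epsilon>)
        in \<forall>J. card J = 2 \<longrightarrow> \<not> span {x - y |x y. x \<in> \<Lambda> \<and> y \<in> \<Lambda>} \<subseteq> coord_span (- J))"


section \<open>Very general valuations\<close>

(* g is the product of f with a monomial, such that 1 is a term of g of minimal valuation at u. *)
definition normalised_at ::
    "('k::field \<Rightarrow> ereal) \<Rightarrow> real ^ 'n::finite \<Rightarrow> ('k, 'n) laurent \<Rightarrow> ('k, 'n) laurent \<Rightarrow> bool"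
  where
  "normalised_at val u f g \<longleftrightarrow>
     (\<exists>w\<in>char_lattice. \<exists>c. c \<noteq> 0 \<and> g = Poly_Mapping.single w c * f) \<and>
     Poly_Mapping.lookup g 0 = 1 \<and> 0 \<in> min_terms val g u"

definition cancellative_pair ::
    "('k::field \<Rightarrow> ereal) \<Rightarrow> nat \<Rightarrow> (nat \<Rightarrow> ('k, 'n::finite) laurent) \<Rightarrow> real ^ 'n \<Rightarrow>
     (nat \<Rightarrow> int ^ 'n) \<Rightarrow> (nat \<Rightarrow> int ^ 'n) \<Rightarrow> bool" where
  "cancellative_pair val n g u r r' \<longleftrightarrow>
     r \<in> (\<Pi>\<^sub>E i\<in>{1..<n}. Poly_Mapping.keys (g i) - {0}) \<and>
     r' \<in> (\<Pi>\<^sub>E i\<in>{1..<n}. Poly_Mapping.keys (g i) - {0}) \<and>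
     r \<noteq> r' \<and>
     (\<Sum>i\<in>{1..<n}. term_val val (g i) u (r i)) = (\<Sum>i\<in>{1..<n}. term_val val (g i) u (r' i))"

(* The normalisations g are unique up to the choice of a term of minimal valuation of each f i,
   on which the existence of a cancellative pair does not depend. *)
definition critical_locus ::
    "('k::field \<Rightarrow> ereal) \<Rightarrow> nat \<Rightarrow> (nat \<Rightarrow> ('k, 'n::finite) laurent) \<Rightarrow> ('k ^ 'n) set \<Rightarrow>
     (real ^ 'n) set" where
  "critical_locus val n f X =
     {u \<in> trop val X. \<exists>g r r'. (\<forall>i\<in>{1..<n}. normalised_at val u (f i) (g i)) \<and>
                              cancellative_pair val n g u r r'}"

(* The Q-vector space of linear relations between the numbers a i, i in I, has dimension one. *)
definition one_rational_dependence :: "'i set \<Rightarrow> ('i \<Rightarrow> real) \<Rightarrow> bool" where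
  "one_rational_dependence I a \<longleftrightarrow>
     (\<exists>q::'i \<Rightarrow> rat. (\<exists>i\<in>I. q i \<noteq> 0) \<and> (\<Sum>i\<in>I. of_rat (q i) * a i) = 0 \<and>
        (\<forall>q'::'i \<Rightarrow> rat. (\<Sum>i\<in>I. of_rat (q' i) * a i) = 0 \<longrightarrow>
           (\<exists>t. \<forall>i\<in>I. q' i = t * q i)))"

(* Finiteness of the critical locus is finiteness modulo multiples of 1. *)
definition very_general_valuations ::
    "('k::field \<Rightarrow> ereal) \<Rightarrow> nat \<Rightarrow> (nat \<Rightarrow> ('k, 'n::finite) laurent) \<Rightarrow> ('k ^ 'n) set \<Rightarrow> bool"
  where
  "very_general_valuations val n f X \<longleftrightarrow>
     finite ((\<lambda>u. {v. trop_eq v u}) ` critical_locus val n f X) \<and>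
     (\<forall>u\<in>critical_locus val n f X. \<forall>g v.
        (\<forall>i\<in>{1..<n}. normalised_at val u (f i) (g i) \<and> v i \<in> min_terms val (g i) u - {0}) \<longrightarrow>
        one_rational_dependence (SIGMA i:{1..<n}. Poly_Mapping.keys (g i) - {0, v i})
          (\<lambda>(i, w). term_val val (g i) u w))"


section \<open>Tropical tangents and their contribution\<close>

(* All representatives modulo common additive constants are included; the entries on the
   diagonal are irrelevant.  Vanishing Pluecker coordinates give infinite entries. *)
definition tropical_tangents ::
    "('k::field \<Rightarrow> ereal) \<Rightarrow> ('k ^ 'n::finite) set \<Rightarrow> real ^ 'n \<Rightarrow> ('n \<Rightarrow> 'n \<Rightarrow> ereal) set" where
  "tropical_tangents val X \<alpha> =
     {\<beta>. \<exists>P p c. smooth_point X P \<and> P \<in> torus \<and> trop_eq (trop_point val P) \<alpha> \<and>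
           pluecker_coords (tangent_space X P) p \<and>
           (\<forall>i j. i \<noteq> j \<longrightarrow> \<beta> i j = val (p i j) + ereal c)}"

definition min_attained_twice :: "ereal \<Rightarrow> ereal \<Rightarrow> ereal \<Rightarrow> bool" where
  "min_attained_twice a b c \<longleftrightarrow> a = b \<and> a \<le> c \<or> a = c \<and> a \<le> b \<or> b = c \<and> b \<le> a"

definition tropical_line :: "('n \<Rightarrow> 'n \<Rightarrow> ereal) \<Rightarrow> (real ^ 'n::finite) set" where
  "tropical_line \<beta> =
     {x. \<forall>i j k. i \<noteq> j \<and> i \<noteq> k \<and> j \<noteq> k \<longrightarrow>
        min_attained_twice
          (\<beta> i j + ereal (x $ k)) (\<beta> i k + ereal (x $ j)) (\<beta> j k + ereal (x $ i))}"

(* The contribution of \<alpha> to the tropicalised tangent variety of X. *)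
definition contribution ::
    "('k::field \<Rightarrow> ereal) \<Rightarrow> ('k ^ 'n::finite) set \<Rightarrow> real ^ 'n \<Rightarrow> (real ^ 'n) set" where
  "contribution val X \<alpha> = closure (\<Union>\<beta>\<in>tropical_tangents val X \<alpha>. tropical_line \<beta>)"

definition normalised_pluecker ::
    "real ^ 'n::finite \<Rightarrow> ('n \<Rightarrow> 'n \<Rightarrow> ereal) \<Rightarrow> bool" where
  "normalised_pluecker \<alpha> \<beta> \<longleftrightarrow>
     (\<forall>i j. i \<noteq> j \<longrightarrow> ereal (\<alpha> $ i + \<alpha> $ j) \<le> \<beta> i j) \<and>
     (\<exists>i j. i \<noteq> j \<and> \<beta> i j = ereal (\<alpha> $ i + \<alpha> $ j))"

definition excess ::
    "real ^ 'n::finite \<Rightarrow> ('n \<Rightarrow> 'n \<Rightarrow> ereal) \<Rightarrow> 'n \<Rightarrow> 'n \<Rightarrow> ereal" where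
  "excess \<alpha> \<beta> i j = \<beta> i j - ereal (\<alpha> $ i + \<alpha> $ j)"

(* d is the row of \<delta> at i.  If that row has an infinite entry, the ray lies at infinity
   and has no points in the tropical torus. *)
definition tangent_ray ::
    "real ^ 'n::finite \<Rightarrow> ('n \<Rightarrow> 'n \<Rightarrow> ereal) \<Rightarrow> 'n \<Rightarrow> (real ^ 'n) set" where
  "tangent_ray \<alpha> \<delta> i =
     {x. \<exists>d::'n \<Rightarrow> real. (\<forall>j. j \<noteq> i \<longrightarrow> \<delta> i j = ereal (d j)) \<and>
        (\<exists>t\<ge>0. trop_eq x
           (\<alpha> + (\<Sum>j\<in>- {i}. d j *\<^sub>R axis j 1) + Max (d ` (- {i})) *\<^sub>R axis i 1 + t *\<^sub>R axis i 1))}"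

end

theory Submission
  imports Defs
begin

text \<open>The tangent line of \<open>X\<close> at a torus point \<open>P\<close> over \<open>\<alpha>\<close> is spanned by \<open>P\<close> and \<open>P * a\<close> for some
  direction \<open>a\<close>, so that \<open>\<delta> i j = val (a i - a j)\<close>. This is an ultrametric, and its tropical line
  is a tree with root \<open>\<alpha>\<close>: its points are \<open>x j = \<alpha> j + min (\<delta> i j) s\<close>, \<open>x i = \<alpha> i + s\<close> for a
  leaf \<open>i\<close> and a height \<open>s \<ge> 0\<close>. The points with \<open>s \<ge> \<delta> i j\<close> for all \<open>j\<close> form the ray at \<open>i\<close>. The
  other ones are, up to closure, on the rays of another tangent line, for which \<open>\<delta>\<close> is replaced by
  \<open>min \<delta> s\<close>: move \<open>P\<close> along \<open>a\<close> by some \<open>t\<close> with \<open>val t = s\<close>. To first order \<open>a\<close> becomes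
  \<open>a + t b\<close>, and tameness forces \<open>b i - b j\<close> to be a unit whenever \<open>a i - a j\<close> is not. The deformed
  point comes from Newton's iteration, whose limit is replaced by an exact solution since the field
  is algebraically closed. The remaining hypotheses imply that one \<open>f i\<close> has three terms of minimal
  valuation at \<open>\<alpha>\<close>, and each other one has two.\<close>

text \<open>Over the residue field the equations with \<open>i \<noteq> i0\<close> become binomials;
  they cut out a translated two-dimensional subgroup of the torus, with a constant plane of
  logarithmic directions. The bending of the curve inside it comes from the trinomial at
  \<open>i0\<close>. If the residues of its three terms are \<open>g0\<close>, \<open>g1\<close>,
  \<open>g2\<close>, then \<open>g0 + g1 + g2 = 0\<close>, and a direction that did not vary at
  first order would force \<open>g1 + g2 = 0\<close>, against \<open>g0\<close> being a unit.
  Tameness makes every coordinate difference see this variation.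

  Two precautions shape the deformation. Point and tangent direction are solved for together, with
  an error of valuation above \<open>s\<close>, since the information sits in the term of valuation
  \<open>s\<close>. And where \<open>a k - a l\<close> has valuation at least \<open>s\<close>
  itself, it could cancel against that term; since nonzero integers are units, some multiple
  \<open>of_nat c * t0\<close> avoids this for all pairs at once.

  Heights outside the value group are reached only by density, hence the closures on both
  sides.\<close>

locale valued_field =
  fixes val :: "'k::field \<Rightarrow> ereal"
  assumes valuation: "valuation val"
begin

text \<open>The bounds are real numbers, so that exponents are added and compared in
  \<open>real\<close>; \<open>0\<close> satisfies every bound.\<close>

definition vge :: "real \<Rightarrow> 'k \<Rightarrow> bool" where
  "vge r x \<longleftrightarrow> ereal r \<le> val x"

lemma val_mult: "val (x * y) = val x + val y"
  using valuation unfolding valuation_def by blast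

lemma val_0_iff: "val x = \<infinity> \<longleftrightarrow> x = 0"
  using valuation unfolding valuation_def by blast

lemma val_0 [simp]: "val 0 = \<infinity>"
  using val_0_iff by simp

lemma val_add: "min (val x) (val y) \<le> val (x + y)"
  using valuation unfolding valuation_def by blast

lemma val_not_minfty: "val x \<noteq> -\<infinity>"
  using valuation unfolding valuation_def by blast

lemma val_real: "x \<noteq> 0 \<Longrightarrow> val x = ereal (real_of_ereal (val x))"
  using val_not_minfty[of x] val_0_iff[of x] by (cases "val x") auto

lemma val_finite: assumes "x \<noteq> 0" obtains r where "val x = ereal r"
  using val_real[OF assms] by blast

lemma val_1 [simp]: "val 1 = 0"
proof -
  obtain r where r: "val 1 = ereal r" using val_real[of 1] by auto
  have "val (1 * 1) = val 1 + val 1" by (rule val_mult)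
  then show ?thesis using r by simp
qed

lemma val_minus [simp]: "val (- x) = val x"
proof -
  obtain r where r: "val (-1) = ereal r" using val_real[of "-1"] by auto
  have "val ((-1) * (-1)) = val (-1) + val (-1)" by (rule val_mult)
  then have "val (-1) = 0" using r by (simp add: zero_ereal_def)
  then show ?thesis using val_mult[of "-1" x] by simp
qed

lemma val_diff_commute: "val (x - y) = val (y - x)"
  using val_minus[of "x - y"] by simp

lemma val_inverse: assumes "x \<noteq> 0" shows "val (inverse x) = - val x"
proof -
  obtain r s where "val x = ereal r" "val (inverse x) = ereal s"
    using assms by (metis val_real nonzero_imp_inverse_nonzero)
  moreover have "val (x * inverse x) = 0" using assms by simp
  ultimately show ?thesis using val_mult[of x "inverse x"] by (simp add: zero_ereal_def)
qed

lemma val_divide: assumes "y \<noteq> 0" shows "val (x / y) = val x - val y"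
  using val_inverse[OF assms] val_mult[of x "inverse y"] by (simp add: field_simps minus_ereal_def)

lemma val_power: "val (x ^ n) = ereal (real n) * val x"
proof (induction n)
  case (Suc n)
  then show ?case
    using val_not_minfty[of x] by (cases "val x") (auto simp: val_mult algebra_simps zero_ereal_def)
qed (auto simp: zero_ereal_def[symmetric])

lemma vge_0 [simp, intro]: "vge r 0" by (simp add: vge_def)

lemma vge_add: "vge r x \<Longrightarrow> vge r y \<Longrightarrow> vge r (x + y)"
  unfolding vge_def using val_add[of x y] by (meson order_trans min.boundedI)

lemma vge_minus_iff [simp]: "vge r (- x) \<longleftrightarrow> vge r x"
  by (simp add: vge_def)

lemma vge_diff: "vge r x \<Longrightarrow> vge r y \<Longrightarrow> vge r (x - y)"
  using vge_add[of r x "- y"] by simp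

lemma vge_commute: "vge r (x - y) \<longleftrightarrow> vge r (y - x)"
  by (simp add: vge_def val_diff_commute[of x y])

lemma vge_trans: "vge r (x - y) \<Longrightarrow> vge r (y - z) \<Longrightarrow> vge r (x - z)"
  using vge_add[of r "x - y" "y - z"] by simp

lemma vge_mult: "vge r x \<Longrightarrow> vge s y \<Longrightarrow> vge (r + s) (x * y)"
  unfolding vge_def val_mult by (metis add_mono plus_ereal.simps(1))

lemma vge_mult_left: "vge 0 x \<Longrightarrow> vge s y \<Longrightarrow> vge s (x * y)"
  using vge_mult[of 0 x s y] by simp

lemma vge_mult_right: "vge s x \<Longrightarrow> vge 0 y \<Longrightarrow> vge s (x * y)"
  using vge_mult[of s x 0 y] by simp

lemma vge_mono: "vge r x \<Longrightarrow> s \<le> r \<Longrightarrow> vge s x"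
  unfolding vge_def by (meson ereal_less_eq(3) order_trans)

lemma vge_max_iff [simp]: "vge (max r s) x \<longleftrightarrow> vge r x \<and> vge s x"
  by (simp add: vge_def max_def) (meson ereal_less_eq(3) le_cases order_trans)

lemma vge_min1: "vge r x \<Longrightarrow> vge (min r s) x"
  by (erule vge_mono) simp

lemma vge_min2: "vge s x \<Longrightarrow> vge (min r s) x"
  by (erule vge_mono) simp

lemma vge_sum: "(\<And>i. i \<in> A \<Longrightarrow> vge r (f i)) \<Longrightarrow> vge r (sum f A)"
  by (induction A rule: infinite_finite_induct) (auto intro: vge_add)

lemma vge_1 [simp]: "vge 0 1" by (simp add: vge_def zero_ereal_def)

lemma vge_of_nat: "vge 0 (of_nat n)"
  by (induction n) (auto intro: vge_add)

lemma vge_of_int: "vge 0 (of_int n)"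
  by (cases n rule: int_cases2) (auto intro: vge_of_nat)

lemma vge_exists: "\<exists>r. vge r x"
  using val_real[of x] by (cases "x = 0") (auto simp: vge_def intro: exI[of _ "real_of_ereal (val x)"])

lemma val_add_eq: assumes "val x < val y" shows "val (x + y) = val x"
proof (rule antisym)
  show "val x \<le> val (x + y)" using val_add[of x y] assms by (simp add: min_def split: if_splits)
  show "val (x + y) \<le> val x"
  proof (rule ccontr)
    assume "\<not> val (x + y) \<le> val x"
    then have "val x < min (val (x + y)) (val (- y))" using assms by simp
    also have "\<dots> \<le> val (x + y + - y)" by (rule val_add)
    finally show False by simp
  qed
qed

lemma val_add_eq': "val x < val (y - x) \<Longrightarrow> val y = val x"
  using val_add_eq[of x "y - x"] by simp

lemma val_eq_0_close: assumes "val x = 0" "vge r (y - x)" "r > 0" shows "val y = 0"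
proof -
  have "0 < ereal r" using assms(3) by simp
  also have "\<dots> \<le> val (y - x)" using assms(2) by (simp add: vge_def)
  finally have "val x < val (y - x)" using assms(1) by simp
  from val_add_eq'[OF this] show ?thesis using assms(1) by simp
qed

lemma vge_0_close: assumes "vge 0 x" "vge r (y - x)" "r \<ge> 0" shows "vge 0 y"
  using vge_add[OF assms(1) vge_mono[OF assms(2,3)]] by simp

text \<open>A member may be \<open>0\<close> and have infinite valuation, so the bound is found by
  density and not as a minimum. It provides the gain of Newton's iteration.\<close>

lemma val_pos_uniform:
  assumes "finite A" "\<And>x. x \<in> A \<Longrightarrow> val x > 0"
  shows "\<exists>\<mu>>0. \<forall>x\<in>A. vge \<mu> x"
  using assms
proof (induction A)
  case empty
  show ?case using zero_less_one by blast
next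
  case (insert x A)
  then obtain \<mu> where m: "\<mu> > 0" "\<forall>x\<in>A. vge \<mu> x" by auto
  have "val x > 0" using insert by auto
  then obtain r where "r > 0" "vge r x"
    unfolding vge_def by (metis ereal_dense2 ereal_less(2) less_imp_le)
  then show ?case using m vge_mono[of r _ "min \<mu> r"] vge_mono[of \<mu> _ "min \<mu> r"]
    by (intro exI[of _ "min \<mu> r"]) auto
qed

end

section \<open>Polynomial functions along Cauchy sequences\<close>

text \<open>Functions instead of formal polynomials: continuity along a Cauchy sequence is an
  induction over these rules, and a variable is eliminated by shrinking \<open>S\<close>, the set of
  variables that may occur.\<close>

inductive_set polyfun :: "'v set \<Rightarrow> (('v \<Rightarrow> 'k::field) \<Rightarrow> 'k) set" for S where
  const: "(\<lambda>x. c) \<in> polyfun S"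
| coord: "v \<in> S \<Longrightarrow> (\<lambda>x. x v) \<in> polyfun S"
| add: "p \<in> polyfun S \<Longrightarrow> q \<in> polyfun S \<Longrightarrow> (\<lambda>x. p x + q x) \<in> polyfun S"
| mult: "p \<in> polyfun S \<Longrightarrow> q \<in> polyfun S \<Longrightarrow> (\<lambda>x. p x * q x) \<in> polyfun S"

lemma polyfun_sum: "(\<And>i. i \<in> A \<Longrightarrow> f i \<in> polyfun S) \<Longrightarrow> (\<lambda>x. \<Sum>i\<in>A. f i x) \<in> polyfun S"
  by (induction A rule: infinite_finite_induct) (auto intro: polyfun.intros)

lemma polyfun_prod: "(\<And>i. i \<in> A \<Longrightarrow> f i \<in> polyfun S) \<Longrightarrow> (\<lambda>x. \<Prod>i\<in>A. f i x) \<in> polyfun S"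
  by (induction A rule: infinite_finite_induct) (auto intro: polyfun.intros)

lemma polyfun_power: "f \<in> polyfun S \<Longrightarrow> (\<lambda>x. f x ^ n) \<in> polyfun S"
  by (induction n) (auto intro: polyfun.intros)

lemma polyfun_diff: assumes "f \<in> polyfun S" "g \<in> polyfun S" shows "(\<lambda>x. f x - g x) \<in> polyfun S"
  using polyfun.add[OF assms(1) polyfun.mult[OF polyfun.const[of "-1"] assms(2)]] by simp

lemma polyfun_mono: assumes "p \<in> polyfun S" "S \<subseteq> T" shows "p \<in> polyfun T"
  using assms by (induction p) (auto intro: polyfun.intros)

lemma polyfun_cong: assumes "p \<in> polyfun S" "\<And>v. v \<in> S \<Longrightarrow> x v = y v" shows "p x = p y"
  using assms by induction auto

text \<open>A polynomial function of one further variable is represented by the family of its univariate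
  specialisations at the points \<open>x\<close>.\<close>

definition polyfam :: "'v set \<Rightarrow> nat \<Rightarrow> (('v \<Rightarrow> 'k::field) \<Rightarrow> 'k poly) set" where
  "polyfam S d = {P. (\<forall>i. (\<lambda>x. coeff (P x) i) \<in> polyfun S) \<and> (\<forall>x. degree (P x) \<le> d)}"

lemma polyfamI: "(\<And>i. (\<lambda>x. coeff (P x) i) \<in> polyfun S) \<Longrightarrow> (\<And>x. degree (P x) \<le> d) \<Longrightarrow> P \<in> polyfam S d"
  by (auto simp: polyfam_def)

lemma polyfam_coeff: "P \<in> polyfam S d \<Longrightarrow> (\<lambda>x. coeff (P x) i) \<in> polyfun S"
  and polyfam_degree: "P \<in> polyfam S d \<Longrightarrow> degree (P x) \<le> d"
  by (auto simp: polyfam_def)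

lemma polyfam_mono: "P \<in> polyfam S d \<Longrightarrow> d \<le> e \<Longrightarrow> P \<in> polyfam S e"
  by (auto simp: polyfam_def intro: order_trans)

lemma polyfam_add: "P \<in> polyfam S d \<Longrightarrow> Q \<in> polyfam S d \<Longrightarrow> (\<lambda>x. P x + Q x) \<in> polyfam S d"
  by (auto simp: polyfam_def degree_add_le intro: polyfun.add)

lemma polyfam_diff: "P \<in> polyfam S d \<Longrightarrow> Q \<in> polyfam S d \<Longrightarrow> (\<lambda>x. P x - Q x) \<in> polyfam S d"
  by (auto simp: polyfam_def degree_diff_le intro: polyfun_diff)

lemma polyfam_mult: assumes "P \<in> polyfam S d" "Q \<in> polyfam S e"
  shows "(\<lambda>x. P x * Q x) \<in> polyfam S (d + e)"
proof (rule polyfamI)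
  show "(\<lambda>x. coeff (P x * Q x) i) \<in> polyfun S" for i
    unfolding coeff_mult using assms by (intro polyfun_sum polyfun.mult polyfam_coeff)
  show "degree (P x * Q x) \<le> d + e" for x
    using degree_mult_le[of "P x" "Q x"] polyfam_degree[OF assms(1), of x] polyfam_degree[OF assms(2), of x]
    by linarith
qed

lemma polyfam_monom: "c \<in> polyfun S \<Longrightarrow> (\<lambda>x. monom (c x) i) \<in> polyfam S i"
proof (rule polyfamI)
  show "(\<lambda>x. coeff (monom (c x) i) j) \<in> polyfun S" if "c \<in> polyfun S" for j
    using that by (cases "i = j") (auto intro: polyfun.const)
qed (simp add: degree_monom_le)

lemma polyfam_smult: "c \<in> polyfun S \<Longrightarrow> P \<in> polyfam S d \<Longrightarrow> (\<lambda>x. smult (c x) (P x)) \<in> polyfam S d"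
  unfolding polyfam_def using degree_smult_le order_trans by (fastforce intro: polyfun.mult)

lemma polyfun_insert_rep:
  assumes "p \<in> polyfun (insert v S)"
  shows "\<exists>P d. P \<in> polyfam S d \<and> (\<forall>x. p x = poly (P x) (x v))"
  using assms
proof induction
  case (const c)
  show ?case
    by (rule exI[of _ "\<lambda>x. monom c 0"], rule exI[of _ 0])
       (auto simp: poly_monom intro: polyfam_monom polyfun.const)
next
  case (coord w)
  show ?case
  proof (cases "w = v")
    case True
    then show ?thesis
      by (intro exI[of _ "\<lambda>x. monom 1 1"] exI[of _ 1])
         (auto simp: poly_monom intro: polyfam_monom polyfun.const)
  next
    case False
    with coord show ?thesis
      by (intro exI[of _ "\<lambda>x. monom (x w) 0"] exI[of _ 0])
         (auto simp: poly_monom intro: polyfam_monom polyfun.coord)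
  qed
next
  case (add p q)
  then obtain P d Q e where "P \<in> polyfam S d" "\<forall>x. p x = poly (P x) (x v)"
    "Q \<in> polyfam S e" "\<forall>x. q x = poly (Q x) (x v)" by blast
  then show ?case
    by (intro exI[of _ "\<lambda>x. P x + Q x"] exI[of _ "max d e"])
       (simp add: polyfam_add polyfam_mono[of P S d] polyfam_mono[of Q S e])
next
  case (mult p q)
  then obtain P d Q e where "P \<in> polyfam S d" "\<forall>x. p x = poly (P x) (x v)"
    "Q \<in> polyfam S e" "\<forall>x. q x = poly (Q x) (x v)" by blast
  then show ?case
    by (intro exI[of _ "\<lambda>x. P x * Q x"] exI[of _ "d + e"]) (simp add: polyfam_mult)
qed

lemma polyfam_eval:
  assumes "P \<in> polyfam S d" shows "(\<lambda>x. poly (P x) (x v)) \<in> polyfun (insert v S)"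
proof -
  have "(\<lambda>x. \<Sum>i\<le>d. coeff (P x) i * x v ^ i) \<in> polyfun (insert v S)"
    by (intro polyfun_sum polyfun.mult polyfun_power polyfun.coord polyfun_mono[OF polyfam_coeff[OF assms]]) auto
  moreover have "poly (P x) (x v) = (\<Sum>i\<le>d. coeff (P x) i * x v ^ i)" for x
    unfolding poly_altdef using polyfam_degree[OF assms, of x]
    by (intro sum.mono_neutral_left) (auto simp: coeff_eq_0)
  ultimately show ?thesis by simp
qed

text \<open>The top coefficient \<open>coeff (G x) d\<close> depends on \<open>x\<close> and may
  vanish, so it is multiplied through instead of inverted. The induction is on the formal degree
  \<open>e\<close>, each step cancelling the coefficient at \<open>e\<close>.\<close>

lemma polyfam_pseudo_divide:
  assumes G: "G \<in> polyfam S d" and "d > 0" and P: "P \<in> polyfam S e"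
  shows "\<exists>m Q R e'. Q \<in> polyfam S e' \<and> R \<in> polyfam S (d - 1) \<and>
           (\<forall>x. smult (coeff (G x) d ^ m) (P x) = Q x * G x + R x)"
  using P
proof (induction e arbitrary: P rule: less_induct)
  case (less e)
  show ?case
  proof (cases "e < d")
    case True
    have "(\<lambda>x. 0) \<in> polyfam S 0" by (auto intro: polyfamI polyfun.const)
    moreover have "P \<in> polyfam S (d - 1)" using polyfam_mono[OF less.prems] True by simp
    ultimately show ?thesis
      by (intro exI[of _ 0] exI[of _ "\<lambda>x. 0"] exI[of _ P] exI[of _ 0]) auto
  next
    case False
    define T where "T x = monom (coeff (P x) e) (e - d)" for x
    define P' where "P' x = smult (coeff (G x) d) (P x) - T x * G x" for x
    have T: "T \<in> polyfam S (e - d)"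
      unfolding T_def using polyfam_coeff[OF less.prems] by (rule polyfam_monom)
    have P'e: "P' \<in> polyfam S e"
      unfolding P'_def using polyfam_mult[OF T G] False
      by (intro polyfam_diff polyfam_smult polyfam_coeff[OF G] less.prems) auto
    have c: "coeff (P' x) e = 0" for x
      using False coeff_mult_degree_sum
      by (simp add: P'_def T_def coeff_monom_mult)
    have "P' \<in> polyfam S (e - 1)"
    proof (rule polyfamI)
      show "(\<lambda>x. coeff (P' x) i) \<in> polyfun S" for i using P'e by (rule polyfam_coeff)
      show "degree (P' x) \<le> e - 1" for x
      proof (rule degree_le, intro allI impI)
        fix i assume "i > e - 1"
        then consider "i = e" | "i > e" by linarith
        then show "coeff (P' x) i = 0"
          using c polyfam_degree[OF P'e, of x] by cases (auto intro: coeff_eq_0)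
      qed
    qed
    moreover have "e - 1 < e" using False assms(2) by simp
    ultimately obtain m Q R e' where IH: "Q \<in> polyfam S e'" "R \<in> polyfam S (d - 1)"
      "\<forall>x. smult (coeff (G x) d ^ m) (P' x) = Q x * G x + R x"
      using less.IH by blast
    define Q' where "Q' x = Q x + smult (coeff (G x) d ^ m) (T x)" for x
    have "Q' \<in> polyfam S (max e' (e - d))" unfolding Q'_def
      by (intro polyfam_add polyfam_smult polyfun_power polyfam_coeff[OF G]
          polyfam_mono[OF IH(1)] polyfam_mono[OF T]) auto
    moreover have "smult (coeff (G x) d ^ Suc m) (P x) = Q' x * G x + R x" for x
    proof -
      have "smult (coeff (G x) d ^ Suc m) (P x) = smult (coeff (G x) d ^ m) (P' x + T x * G x)"
        by (simp add: P'_def mult.commute)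
      also have "\<dots> = Q' x * G x + R x"
        unfolding smult_add_right IH(3)[rule_format] by (simp add: Q'_def algebra_simps)
      finally show ?thesis .
    qed
    ultimately show ?thesis using IH(2) by blast
  qed
qed

context valued_field
begin

text \<open>A larger \<open>e\<close> means closer.\<close>

definition vclose :: "'v set \<Rightarrow> real \<Rightarrow> ('v \<Rightarrow> 'k) \<Rightarrow> ('v \<Rightarrow> 'k) \<Rightarrow> bool" where
  "vclose S e x y \<longleftrightarrow> (\<forall>v\<in>S. vge e (x v - y v))"

definition vcauchy :: "'v set \<Rightarrow> (nat \<Rightarrow> 'v \<Rightarrow> 'k) \<Rightarrow> bool" where
  "vcauchy S \<xi> \<longleftrightarrow> (\<forall>e. \<exists>N. \<forall>k\<ge>N. \<forall>l\<ge>N. vclose S e (\<xi> k) (\<xi> l))"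

definition vnull :: "(nat \<Rightarrow> 'k) \<Rightarrow> bool" where
  "vnull X \<longleftrightarrow> (\<forall>e. \<exists>N. \<forall>k\<ge>N. vge e (X k))"

lemma vnullD: "vnull X \<Longrightarrow> \<exists>N. \<forall>k\<ge>N. vge e (X k)"
  by (simp add: vnull_def)

lemma vclose_mono: "vclose S e x y \<Longrightarrow> e' \<le> e \<Longrightarrow> vclose S e' x y"
  by (auto simp: vclose_def intro: vge_mono)

lemma vclose_max_iff [simp]: "vclose S (max d e) x y \<longleftrightarrow> vclose S d x y \<and> vclose S e x y"
  by (auto simp: vclose_def)

lemma vcauchy_mono: "vcauchy S \<xi> \<Longrightarrow> T \<subseteq> S \<Longrightarrow> vcauchy T \<xi>"
  unfolding vcauchy_def vclose_def by (meson subsetD)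

text \<open>The modulus \<open>d\<close> does not depend on \<open>k\<close>, because a Cauchy
  sequence is eventually bounded. The bound \<open>r\<close> is carried along in the induction since
  products need it.\<close>

lemma polyfun_continuous:
  assumes "vcauchy S \<xi>" "p \<in> polyfun S"
  shows "\<exists>d N r. (\<forall>k\<ge>N. vge r (p (\<xi> k))) \<and>
           (\<forall>k\<ge>N. \<forall>z. vclose S d z (\<xi> k) \<longrightarrow> vge e (p z - p (\<xi> k)))"
  using assms(2)
proof (induction arbitrary: e)
  case (const c)
  then show ?case using vge_exists[of c] by auto
next
  case (coord v)
  obtain N where N: "\<And>k l. k \<ge> N \<Longrightarrow> l \<ge> N \<Longrightarrow> vclose S 0 (\<xi> k) (\<xi> l)"
    using assms(1) unfolding vcauchy_def by meson
  obtain r where r: "vge r (\<xi> N v)" using vge_exists by blast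
  have "vge (min r 0) (\<xi> k v)" if "k \<ge> N" for k
  proof -
    have "vge 0 (\<xi> k v - \<xi> N v)" using N[OF that, of N] coord by (simp add: vclose_def)
    then have "vge (min r 0) (\<xi> k v - \<xi> N v + \<xi> N v)"
      using r by (metis vge_add vge_min1 vge_min2)
    then show ?thesis by simp
  qed
  then show ?case using coord by (intro exI[of _ e] exI[of _ N] exI[of _ "min r 0"]) (auto simp: vclose_def)
next
  case (add p q)
  obtain d N r where 1: "\<And>k. k \<ge> N \<Longrightarrow> vge r (p (\<xi> k))"
     "\<And>k z. k \<ge> N \<Longrightarrow> vclose S d z (\<xi> k) \<Longrightarrow> vge e (p z - p (\<xi> k))"
    using add.IH(1)[of e] by blast
  obtain d' N' r' where 2: "\<And>k. k \<ge> N' \<Longrightarrow> vge r' (q (\<xi> k))"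
     "\<And>k z. k \<ge> N' \<Longrightarrow> vclose S d' z (\<xi> k) \<Longrightarrow> vge e (q z - q (\<xi> k))"
    using add.IH(2)[of e] by blast
  show ?case
  proof (intro exI conjI allI impI)
    fix k assume k: "k \<ge> max N N'"
    show "vge (min r r') (p (\<xi> k) + q (\<xi> k))"
      using 1(1)[of k] 2(1)[of k] k by (intro vge_add vge_min1 vge_min2) auto
    fix z assume "vclose S (max d d') z (\<xi> k)"
    then have "vge e (p z - p (\<xi> k))" "vge e (q z - q (\<xi> k))"
      using 1(2)[of k z] 2(2)[of k z] k by auto
    then have "vge e ((p z - p (\<xi> k)) + (q z - q (\<xi> k)))" by (rule vge_add)
    then show "vge e (p z + q z - (p (\<xi> k) + q (\<xi> k)))" by (simp add: algebra_simps)
  qed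
next
  case (mult p q)
  obtain d0 N0 r where bp: "\<And>k. k \<ge> N0 \<Longrightarrow> vge r (p (\<xi> k))"
    using mult.IH(1)[of 0] by blast
  obtain d0' N0' r' where bq: "\<And>k. k \<ge> N0' \<Longrightarrow> vge r' (q (\<xi> k))"
    using mult.IH(2)[of 0] by blast
  \<comment> \<open>Accuracy for which each of the three terms in the expansion of
    \<open>p z * q z - p (\<xi> k) * q (\<xi> k)\<close> below has valuation at least
    \<open>e\<close>.\<close>
  define E where "E = max (max (e - r) (e - r')) (max e 0)"
  have E: "E \<ge> 0" "E \<ge> e" "E \<ge> e - r" "E \<ge> e - r'" by (auto simp: E_def)
  obtain d N r1 where 1: "\<And>k z. k \<ge> N \<Longrightarrow> vclose S d z (\<xi> k) \<Longrightarrow> vge E (p z - p (\<xi> k))"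
    using mult.IH(1)[of E] by blast
  obtain d' N' r1' where 2: "\<And>k z. k \<ge> N' \<Longrightarrow> vclose S d' z (\<xi> k) \<Longrightarrow> vge E (q z - q (\<xi> k))"
    using mult.IH(2)[of E] by blast
  show ?case
  proof (intro exI conjI allI impI)
    fix k assume k: "k \<ge> max (max N N') (max N0 N0')"
    have pq: "vge r (p (\<xi> k))" "vge r' (q (\<xi> k))" using bp[of k] bq[of k] k by auto
    then show "vge (r + r') (p (\<xi> k) * q (\<xi> k))" by (rule vge_mult)
    fix z assume "vclose S (max d d') z (\<xi> k)"
    then have d: "vge E (p z - p (\<xi> k))" "vge E (q z - q (\<xi> k))"
      using 1[of k z] 2[of k z] k by auto
    have "vge e ((p z - p (\<xi> k)) * (q z - q (\<xi> k)))"
      using vge_mult[OF d] by (rule vge_mono) (use E in linarith)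
    moreover have "vge e ((p z - p (\<xi> k)) * q (\<xi> k))"
      using vge_mult[OF d(1) pq(2)] by (rule vge_mono) (use E in linarith)
    moreover have "vge e (p (\<xi> k) * (q z - q (\<xi> k)))"
      using vge_mult[OF pq(1) d(2)] by (rule vge_mono) (use E in linarith)
    ultimately have "vge e ((p z - p (\<xi> k)) * (q z - q (\<xi> k)) + (p z - p (\<xi> k)) * q (\<xi> k)
        + p (\<xi> k) * (q z - q (\<xi> k)))"
      by (intro vge_add)
    then show "vge e (p z * q z - p (\<xi> k) * q (\<xi> k))" by (simp add: algebra_simps)
  qed
qed

lemma polyfun_bounded:
  assumes "vcauchy S \<xi>" "p \<in> polyfun S" obtains N r where "\<And>k. k \<ge> N \<Longrightarrow> vge r (p (\<xi> k))"
  using polyfun_continuous[OF assms, of 0] by blast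

lemma vnull_add: assumes "vnull X" "vnull Y" shows "vnull (\<lambda>k. X k + Y k)"
  unfolding vnull_def
proof
  fix e
  obtain N M where "\<forall>k\<ge>N. vge e (X k)" "\<forall>k\<ge>M. vge e (Y k)"
    using assms unfolding vnull_def by meson
  then show "\<exists>N. \<forall>k\<ge>N. vge e (X k + Y k)"
    by (intro exI[of _ "max N M"]) (auto intro: vge_add)
qed

lemma vnull_mult: assumes "vnull X" "\<And>k. k \<ge> M \<Longrightarrow> vge r (Y k)" shows "vnull (\<lambda>k. Y k * X k)"
  unfolding vnull_def
proof
  fix e
  obtain N where "\<forall>k\<ge>N. vge (e - r) (X k)"
    using assms(1) unfolding vnull_def by meson
  then show "\<exists>N. \<forall>k\<ge>N. vge e (Y k * X k)"
    using vge_mult[OF assms(2)] by (intro exI[of _ "max N M"]) (metis add.commute diff_add_cancel max.boundedE)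
qed

lemma vnull_uminus: "vnull X \<Longrightarrow> vnull (\<lambda>k. - X k)"
  by (simp add: vnull_def)

lemma vnull_diff: "vnull X \<Longrightarrow> vnull Y \<Longrightarrow> vnull (\<lambda>k. X k - Y k)"
  using vnull_add[OF _ vnull_uminus, of X Y] by simp

lemma polyfun_vnull_mult:
  assumes "vcauchy S \<xi>" "p \<in> polyfun S" "vnull X" shows "vnull (\<lambda>k. p (\<xi> k) * X k)"
  using polyfun_bounded[OF assms(1,2)] vnull_mult[OF assms(3)] by metis

text \<open>By the ultrametric inequality a value of valuation below \<open>e\<close> keeps its
  valuation under changes of valuation at least \<open>e\<close>; since the sequence is Cauchy, one
  such value decides for a whole tail. Nearby points \<open>z\<close> are included so that the
  result applies to an exact zero found later.\<close>

lemma not_vnull_constant: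
  assumes \<xi>: "vcauchy S \<xi>" and p: "p \<in> polyfun S" and nn: "\<not> vnull (\<lambda>k. p (\<xi> k))"
  shows "\<exists>r d N. \<forall>k\<ge>N. \<forall>z. vclose S d z (\<xi> k) \<longrightarrow> val (p z) = ereal r"
proof -
  obtain e where e: "\<And>N. \<exists>k\<ge>N. \<not> vge e (p (\<xi> k))" using nn unfolding vnull_def by blast
  obtain d N where dN: "\<And>k z. k \<ge> N \<Longrightarrow> vclose S d z (\<xi> k) \<Longrightarrow> vge e (p z - p (\<xi> k))"
    using polyfun_continuous[OF \<xi> p, of e] by blast
  obtain M where M: "\<And>k l. k \<ge> M \<Longrightarrow> l \<ge> M \<Longrightarrow> vclose S d (\<xi> k) (\<xi> l)"
    using \<xi> unfolding vcauchy_def by meson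
  obtain k0 where k0: "k0 \<ge> max N M" "\<not> vge e (p (\<xi> k0))" using e by blast
  then have "p (\<xi> k0) \<noteq> 0" by auto
  then obtain r where r: "val (p (\<xi> k0)) = ereal r" by (rule val_finite)
  have re: "ereal r < ereal e" using k0(2) r by (simp add: vge_def)
  have "val (p z) = ereal r" if k: "k \<ge> max N M" and z: "vclose S d z (\<xi> k)" for k z
  proof -
    have "vclose S d z (\<xi> k0)"
      using z M[of k k0] k k0(1) unfolding vclose_def by (auto intro: vge_trans)
    then have "vge e (p z - p (\<xi> k0))" using dN k0(1) by simp
    then have "val (p (\<xi> k0)) < val (p z - p (\<xi> k0))"
      unfolding r vge_def by (rule order_less_le_trans[OF re])
    from val_add_eq'[OF this] show ?thesis using r by simp
  qed
  then show ?thesis by blast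
qed

text \<open>If the top coefficient is null along the sequence, so is the top term, and removing it
  leaves a family of lower formal degree with null values. The assumption \<open>min\<close>
  supplies the null top coefficient at every stage.\<close>

lemma polyfam_coeffs_vnull:
  assumes \<xi>: "vcauchy (insert v S) \<xi>"
    and min: "\<And>G d'. G \<in> polyfam S d' \<Longrightarrow> d' \<le> d \<Longrightarrow> vnull (\<lambda>k. poly (G (\<xi> k)) (\<xi> k v)) \<Longrightarrow>
                vnull (\<lambda>k. coeff (G (\<xi> k)) d')"
    and P: "P \<in> polyfam S d" "vnull (\<lambda>k. poly (P (\<xi> k)) (\<xi> k v))"
  shows "vnull (\<lambda>k. coeff (P (\<xi> k)) i)"
  using P min
proof (induction d arbitrary: P)
  case 0
  show ?case
  proof (cases "i = 0")
    case True
    then show ?thesis using "0.prems"(3)[OF "0.prems"(1) _ "0.prems"(2)] by simp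
  next
    case False
    then have "coeff (P x) i = 0" for x
      using polyfam_degree[OF "0.prems"(1), of x] by (intro coeff_eq_0) simp
    then show ?thesis by (simp add: vnull_def)
  qed
next
  case (Suc d)
  have top: "vnull (\<lambda>k. coeff (P (\<xi> k)) (Suc d))" using Suc.prems by blast
  define T where "T x = monom (coeff (P x) (Suc d)) (Suc d)" for x
  define P' where "P' x = P x - T x" for x
  have T: "T \<in> polyfam S (Suc d)"
    unfolding T_def using polyfam_coeff[OF Suc.prems(1)] by (rule polyfam_monom)
  have P': "P' \<in> polyfam S (Suc d)" unfolding P'_def using Suc.prems(1) T by (rule polyfam_diff)
  have "P' \<in> polyfam S d"
  proof (rule polyfamI)
    show "(\<lambda>x. coeff (P' x) i) \<in> polyfun S" for i using P' by (rule polyfam_coeff)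
    show "degree (P' x) \<le> d" for x
    proof (rule degree_le, intro allI impI)
      fix i assume "i > d"
      then consider "i = Suc d" | "i > Suc d" by linarith
      then show "coeff (P' x) i = 0"
      proof cases
        case 2
        then show ?thesis using polyfam_degree[OF P', of x] by (intro coeff_eq_0) simp
      qed (simp add: P'_def T_def)
    qed
  qed
  moreover have "vnull (\<lambda>k. poly (P' (\<xi> k)) (\<xi> k v))"
  proof -
    have "(\<lambda>x. x v ^ Suc d) \<in> polyfun (insert v S)" by (intro polyfun_power polyfun.coord) auto
    from polyfun_vnull_mult[OF \<xi> this top]
    have "vnull (\<lambda>k. poly (T (\<xi> k)) (\<xi> k v))" by (simp add: T_def poly_monom mult_ac)
    from vnull_diff[OF Suc.prems(2) this] show ?thesis by (simp add: P'_def)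
  qed
  ultimately have IH: "vnull (\<lambda>k. coeff (P' (\<xi> k)) i)"
    using Suc.prems(3) by (intro Suc.IH) auto
  show ?case
  proof (cases "i = Suc d")
    case False
    then have "coeff (P' x) i = coeff (P x) i" for x by (simp add: P'_def T_def)
    then show ?thesis using IH by simp
  qed (use top in simp)
qed

end

section \<open>Exact zeros near approximate zeros\<close>

locale alg_closed_valued_field = valued_field val for val :: "'k::alg_closed_field \<Rightarrow> ereal"
begin

text \<open>Up to the leading coefficient, \<open>poly q y\<close> is the product of the
  \<open>d\<close> differences between \<open>y\<close> and the roots. If all of them had valuation
  below \<open>e\<close>, the product would have valuation below \<open>d * e\<close>.\<close>

lemma root_near:
  assumes "degree q = d" "q \<noteq> 0" "ereal (real d * e) + val (lead_coeff q) \<le> val (poly q y)" "d > 0"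
  shows "\<exists>r. poly q r = 0 \<and> vge e (r - y)"
proof -
  obtain A where A: "size A = degree q" "q = smult (lead_coeff q) (\<Prod>x\<in>#A. [:-x, 1:])"
    using alg_closed_imp_factorization[OF assms(2)] by blast
  show ?thesis
  proof (rule ccontr)
    assume no: "\<not> ?thesis"
    have root: "poly q r = 0" if "r \<in># A" for r
      by (subst A(2)) (use that in \<open>auto simp: poly_prod_mset image_mset.compositionality o_def prod_mset_zero_iff\<close>)
    have far: "\<exists>s<e. val (y - r) = ereal s" if "r \<in># A" for r
    proof -
      have "\<not> vge e (r - y)" using no root that by blast
      then have "\<not> ereal e \<le> val (y - r)" by (simp add: vge_def val_diff_commute[of y r])
      moreover from this have "y - r \<noteq> 0" by auto
      then obtain s where "val (y - r) = ereal s" by (rule val_finite)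
      ultimately show ?thesis by auto
    qed
    have "\<exists>s. val (\<Prod>x\<in>#B. y - x) = ereal s \<and> s \<le> real (size B) * e \<and> (B \<noteq> {#} \<longrightarrow> s < real (size B) * e)"
      if "B \<subseteq># A" for B
      using that
    proof (induction B)
      case (add x B)
      then obtain s where s: "val (\<Prod>x\<in>#B. y - x) = ereal s" "s \<le> real (size B) * e"
        by (meson mset_subset_eq_insertD subset_mset.less_imp_le)
      obtain s' where s': "s' < e" "val (y - x) = ereal s'"
        using far add.prems by (meson insert_subset_eq_iff mset_subset_eqD union_single_eq_member)
      have "val (\<Prod>z\<in>#add_mset x B. y - z) = ereal (s' + s)" using s s' by (simp add: val_mult)
      moreover have "s' + s < real (size (add_mset x B)) * e" using s s' by (simp add: algebra_simps)
      ultimately show ?case by (intro exI[of _ "s' + s"]) auto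
    qed (auto simp: zero_ereal_def)
    from this[of A] obtain s where s: "val (\<Prod>x\<in>#A. y - x) = ereal s" "s < real d * e"
      using A(1) assms by auto
    have "poly q y = lead_coeff q * (\<Prod>x\<in>#A. y - x)"
      by (subst A(2)) (simp add: poly_prod_mset image_mset.compositionality o_def)
    then have "val (poly q y) = val (lead_coeff q) + ereal s" by (simp add: val_mult s)
    moreover obtain c where "val (lead_coeff q) = ereal c" using val_finite[of "lead_coeff q"] assms(2) by auto
    ultimately show False using assms(3) s(2) by simp
  qed
qed

text \<open>Replaces the passage to a completion: a Cauchy sequence of approximate zeros is a generic
  point of its vanishing ideal, which is eliminated one variable at a time by means of a
  polynomial of minimal degree whose leading coefficient does not vanish on it.\<close>

theorem exact_zeros_near:
  assumes "finite S" "finite \<Phi>" "\<Phi> \<subseteq> polyfun S" "vcauchy S \<xi>" "\<And>p. p \<in> \<Phi> \<Longrightarrow> vnull (\<lambda>k. p (\<xi> k))"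
  shows "\<exists>z N. (\<forall>p\<in>\<Phi>. p z = 0) \<and> (\<forall>k\<ge>N. vclose S e z (\<xi> k))"
  using assms
proof (induction S arbitrary: \<Phi> e rule: finite_induct)
  case empty
  have "p (\<xi> 0) = 0" if "p \<in> \<Phi>" for p
  proof -
    have p: "p (\<xi> k) = p (\<xi> 0)" for k
      using empty.prems(2) that by (intro polyfun_cong[of p "{}"]) auto
    have "vge e (p (\<xi> 0))" for e
      using vnullD[OF empty.prems(4)[OF that], of e] p by (metis order_refl)
    then have "val (p (\<xi> 0)) = \<infinity>" by (metis ereal_top vge_def)
    then show ?thesis by (simp add: val_0_iff)
  qed
  then show ?case by (auto simp: vclose_def)
next
  case (insert v S)
  note \<xi> = insert.prems(3)
  have \<xi>S: "vcauchy S \<xi>" using \<xi> by (rule vcauchy_mono) auto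
  define good where "good d G \<longleftrightarrow> G \<in> polyfam S d \<and> vnull (\<lambda>k. poly (G (\<xi> k)) (\<xi> k v)) \<and>
      \<not> vnull (\<lambda>k. coeff (G (\<xi> k)) d)" for d G
  have "\<forall>p\<in>\<Phi>. \<exists>PD. fst PD \<in> polyfam S (snd PD) \<and> (\<forall>x. p x = poly (fst PD x) (x v))"
    using insert.prems(2) polyfun_insert_rep[of _ v S] by fastforce
  from bchoice[OF this] obtain PD' where PD': "\<forall>p\<in>\<Phi>. fst (PD' p) \<in> polyfam S (snd (PD' p)) \<and>
      (\<forall>x. p x = poly (fst (PD' p) x) (x v))" by blast
  define P where "P p = fst (PD' p)" for p
  define D where "D p = snd (PD' p)" for p
  have PD1: "P p \<in> polyfam S (D p)" if "p \<in> \<Phi>" for p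
    using bspec[OF PD' that, THEN conjunct1] unfolding P_def D_def .
  have PD2: "p x = poly (P p x) (x v)" if "p \<in> \<Phi>" for p x
    using bspec[OF PD' that, THEN conjunct2, THEN spec, of x] unfolding P_def .
  show ?case
  proof (cases "\<exists>d G. good d G")
    \<comment> \<open>The last coordinate behaves like a transcendental over the others: every
      coefficient of every \<open>P p\<close> is null, so the coefficients are made to vanish
      exactly, and the last coordinate may be any late \<open>\<xi> M v\<close>.\<close>
    case False
    have null: "vnull (\<lambda>k. coeff (P p (\<xi> k)) i)" if "p \<in> \<Phi>" for p i
    proof (rule polyfam_coeffs_vnull[OF \<xi> _ PD1[OF that]])
      show "vnull (\<lambda>k. poly (P p (\<xi> k)) (\<xi> k v))"
        using insert.prems(4)[OF that] by (subst PD2[OF that, symmetric])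
      show "vnull (\<lambda>k. coeff (G (\<xi> k)) d')"
        if "G \<in> polyfam S d'" "vnull (\<lambda>k. poly (G (\<xi> k)) (\<xi> k v))" for G d'
      proof -
        have "\<not> good d' G" using False by blast
        then show ?thesis using that by (simp add: good_def)
      qed
    qed
    define \<Phi>' where "\<Phi>' = (\<Union>p\<in>\<Phi>. (\<lambda>i x. coeff (P p x) i) ` {..D p})"
    have "finite \<Phi>'" using insert.prems(1) by (auto simp: \<Phi>'_def)
    moreover have "\<Phi>' \<subseteq> polyfun S" using PD1 by (auto simp: \<Phi>'_def intro: polyfam_coeff)
    moreover have "\<And>p. p \<in> \<Phi>' \<Longrightarrow> vnull (\<lambda>k. p (\<xi> k))" using null by (auto simp: \<Phi>'_def)
    ultimately obtain z N where z: "\<And>p. p \<in> \<Phi>' \<Longrightarrow> p z = 0" "\<And>k. k \<ge> N \<Longrightarrow> vclose S e z (\<xi> k)"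
      using insert.IH[of \<Phi>' e] \<xi>S by blast
    obtain M where M: "\<And>k l. k \<ge> M \<Longrightarrow> l \<ge> M \<Longrightarrow> vclose (insert v S) e (\<xi> k) (\<xi> l)"
      using \<xi> unfolding vcauchy_def by meson
    define z' where "z' = z(v := \<xi> M v)"
    have "p z' = 0" if p: "p \<in> \<Phi>" for p
    proof -
      have "P p z' = 0"
      proof (rule poly_eqI)
        fix i
        have "coeff (P p z') i = coeff (P p z) i"
          using insert.hyps by (intro polyfun_cong[OF polyfam_coeff[OF PD1[OF p]]]) (auto simp: z'_def)
        also have "\<dots> = 0"
        proof (cases "i \<le> D p")
          case True
          then show ?thesis using z(1)[of "\<lambda>x. coeff (P p x) i"] p by (auto simp: \<Phi>'_def)
        next
          case False
          then show ?thesis using polyfam_degree[OF PD1[OF p], of z] by (intro coeff_eq_0) auto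
        qed
        finally show "coeff (P p z') i = coeff 0 i" by simp
      qed
      then show ?thesis using PD2[OF p] by simp
    qed
    moreover have "vclose (insert v S) e z' (\<xi> k)" if "k \<ge> max M N" for k
      using z(2)[of k] M[of M k] that insert.hyps by (auto simp: vclose_def z'_def)
    ultimately show ?thesis by blast
  next
    case True
    \<comment> \<open>By minimality of \<open>d\<close> a pseudo-remainder by \<open>G\<close>, of
      degree below \<open>d\<close>, has only null coefficients. These are made to vanish exactly in
      the variables \<open>S\<close>. Then \<open>v\<close> is given a root of \<open>G z\<close> as
      its value, and \<open>g z' ^ m p * p z' = 0\<close> yields \<open>p z' = 0\<close> because
      \<open>g z'\<close> is nonzero.\<close>
    define d where "d = (LEAST d. \<exists>G. good d G)"
    obtain G where "good d G" using LeastI_ex[OF True] unfolding d_def by blast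
    then have G: "G \<in> polyfam S d" and Gnull: "vnull (\<lambda>k. poly (G (\<xi> k)) (\<xi> k v))"
      and lead: "\<not> vnull (\<lambda>k. coeff (G (\<xi> k)) d)" by (auto simp: good_def)
    have small: "\<not> good d' G'" if "d' < d" for d' G'
      using not_less_Least[of d' "\<lambda>d. \<exists>G. good d G"] that unfolding d_def by blast
    have "d > 0"
    proof (rule ccontr)
      assume "\<not> d > 0"
      then have "d = 0" by simp
      then have "degree (G x) = 0" for x using polyfam_degree[OF G, of x] by simp
      then have "poly (G x) y = coeff (G x) 0" for x y
        by (simp add: poly_altdef)
      then show False using Gnull lead \<open>d = 0\<close> by simp
    qed
    define g where "g x = coeff (G x) d" for x
    have gS: "g \<in> polyfun S" unfolding g_def using G by (rule polyfam_coeff)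
    have "\<forall>p\<in>\<Phi>. \<exists>q. fst (snd q) \<in> polyfam S (snd (snd (snd q))) \<and>
        fst (snd (snd q)) \<in> polyfam S (d - 1) \<and>
        (\<forall>x. smult (g x ^ fst q) (P p x) = fst (snd q) x * G x + fst (snd (snd q)) x)"
    proof
      fix p assume "p \<in> \<Phi>"
      from polyfam_pseudo_divide[OF G \<open>d > 0\<close> PD1[OF this]] obtain m Q R e' where
        "Q \<in> polyfam S e'" "R \<in> polyfam S (d - 1)"
        "\<forall>x. smult (g x ^ m) (P p x) = Q x * G x + R x" unfolding g_def by blast
      then show "\<exists>q. fst (snd q) \<in> polyfam S (snd (snd (snd q))) \<and>
        fst (snd (snd q)) \<in> polyfam S (d - 1) \<and>
        (\<forall>x. smult (g x ^ fst q) (P p x) = fst (snd q) x * G x + fst (snd (snd q)) x)"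
        by (intro exI[of _ "(m, Q, R, e')"]) simp
    qed
    from bchoice[OF this] obtain q where q: "\<forall>p\<in>\<Phi>. fst (snd (q p)) \<in> polyfam S (snd (snd (snd (q p)))) \<and>
        fst (snd (snd (q p))) \<in> polyfam S (d - 1) \<and>
        (\<forall>x. smult (g x ^ fst (q p)) (P p x) = fst (snd (q p)) x * G x + fst (snd (snd (q p))) x)" by blast
    define m Q R e' where "m p = fst (q p)" and "Q p = fst (snd (q p))" and
      "R p = fst (snd (snd (q p)))" and "e' p = snd (snd (snd (q p)))" for p
    have dv1: "Q p \<in> polyfam S (e' p)" and dv2: "R p \<in> polyfam S (d - 1)"
      and dv3: "smult (g x ^ m p) (P p x) = Q p x * G x + R p x" if "p \<in> \<Phi>" for p x
      using bspec[OF q that] unfolding m_def Q_def R_def e'_def by simp_all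
    have ev: "g x ^ m p * p x = poly (Q p x) (x v) * poly (G x) (x v) + poly (R p x) (x v)"
      if "p \<in> \<Phi>" for p x
      using arg_cong[OF dv3[OF that, of x], of "\<lambda>q. poly q (x v)"] PD2[OF that] by simp
    have null: "vnull (\<lambda>k. coeff (R p (\<xi> k)) i)" if p: "p \<in> \<Phi>" for p i
    proof -
      have 1: "vnull (\<lambda>k. g (\<xi> k) ^ m p * p (\<xi> k))"
        using polyfun_vnull_mult[OF \<xi> _ insert.prems(4)[OF p], of "\<lambda>x. g x ^ m p"]
          polyfun_power[OF polyfun_mono[OF gS]] by blast
      have 2: "vnull (\<lambda>k. poly (Q p (\<xi> k)) (\<xi> k v) * poly (G (\<xi> k)) (\<xi> k v))"
        using polyfun_vnull_mult[OF \<xi> polyfam_eval[OF dv1[OF p]] Gnull] .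
      have "vnull (\<lambda>k. poly (R p (\<xi> k)) (\<xi> k v))"
        using vnull_diff[OF 1 2] unfolding ev[OF p] by simp
      then show ?thesis
      proof (rule polyfam_coeffs_vnull[OF \<xi> _ dv2[OF p], rotated])
        show "vnull (\<lambda>k. coeff (G' (\<xi> k)) d')"
          if "G' \<in> polyfam S d'" "d' \<le> d - 1" "vnull (\<lambda>k. poly (G' (\<xi> k)) (\<xi> k v))" for G' d'
          using small[of d' G'] \<open>d > 0\<close> that unfolding good_def by simp
      qed
    qed
    obtain r d1 N1 where r: "\<And>k z. k \<ge> N1 \<Longrightarrow> vclose S d1 z (\<xi> k) \<Longrightarrow> val (g z) = ereal r"
      using not_vnull_constant[OF \<xi>S gS] lead unfolding g_def by blast
    \<comment> \<open>The bound that \<open>root_near\<close> asks of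
      \<open>poly (G z) (\<xi> M v)\<close> when the leading coefficient of \<open>G z\<close> has
      valuation \<open>r\<close>.\<close>
    define E where "E = real d * e + r"
    obtain d2 N2 where 2: "\<And>k z. k \<ge> N2 \<Longrightarrow> vclose (insert v S) d2 z (\<xi> k) \<Longrightarrow>
        vge E (poly (G z) (z v) - poly (G (\<xi> k)) (\<xi> k v))"
      using polyfun_continuous[OF \<xi> polyfam_eval[OF G], of E] by blast
    obtain N3 where 3: "\<And>k. k \<ge> N3 \<Longrightarrow> vge E (poly (G (\<xi> k)) (\<xi> k v))"
      using vnullD[OF Gnull, of E] by blast
    define \<Phi>' where "\<Phi>' = (\<Union>p\<in>\<Phi>. (\<lambda>i x. coeff (R p x) i) ` {..d})"
    have "finite \<Phi>'" using insert.prems(1) by (auto simp: \<Phi>'_def)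
    moreover have "\<Phi>' \<subseteq> polyfun S" using dv2 by (auto simp: \<Phi>'_def intro: polyfam_coeff)
    moreover have "\<And>p. p \<in> \<Phi>' \<Longrightarrow> vnull (\<lambda>k. p (\<xi> k))" using null by (auto simp: \<Phi>'_def)
    ultimately obtain z N where z: "\<And>p. p \<in> \<Phi>' \<Longrightarrow> p z = 0"
        "\<And>k. k \<ge> N \<Longrightarrow> vclose S (max e (max d1 d2)) z (\<xi> k)"
      using insert.IH[of \<Phi>' "max e (max d1 d2)"] \<xi>S by blast
    obtain N4 where N4: "\<And>k l. k \<ge> N4 \<Longrightarrow> l \<ge> N4 \<Longrightarrow> vclose (insert v S) e (\<xi> k) (\<xi> l)"
      using \<xi> unfolding vcauchy_def by meson
    define M where "M = N + N1 + N2 + N3 + N4"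
    have MN: "M \<ge> N" "M \<ge> N1" "M \<ge> N2" "M \<ge> N3" "M \<ge> N4" by (auto simp: M_def)
    have gz: "val (g z) = ereal r" using r[of M z] z(2)[of M] MN by simp
    have eqG: "G (z(v := y)) = G z" for y
    proof (rule poly_eqI)
      show "coeff (G (z(v := y))) i = coeff (G z) i" for i
        using insert.hyps by (intro polyfun_cong[OF polyfam_coeff[OF G]]) auto
    qed
    have g0: "g z \<noteq> 0" using gz by auto
    then have dG: "degree (G z) = d"
      using polyfam_degree[OF G, of z] le_degree[of "G z" d] by (auto simp: g_def)
    have "vge E (poly (G z) (\<xi> M v))"
    proof -
      have "vge E (poly (G (z(v := \<xi> M v))) (\<xi> M v) - poly (G (\<xi> M)) (\<xi> M v))"
        using 2[of M "z(v := \<xi> M v)"] z(2)[of M] MN insert.hyps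
        by (auto simp: vclose_def)
      from vge_add[OF this 3[of M]] show ?thesis using MN eqG by simp
    qed
    then have "ereal (real d * e) + val (lead_coeff (G z)) \<le> val (poly (G z) (\<xi> M v))"
      using gz dG by (simp add: vge_def E_def g_def)
    then obtain y where y: "poly (G z) y = 0" "vge e (y - \<xi> M v)"
      using root_near[OF dG] g0 \<open>d > 0\<close> by (metis coeff_0 g_def)
    define z' where "z' = z(v := y)"
    have gz': "g z' = g z" by (simp add: g_def z'_def eqG)
    have "p z' = 0" if p: "p \<in> \<Phi>" for p
    proof -
      have "R p z' = 0"
      proof (rule poly_eqI)
        fix i
        have "coeff (R p z') i = coeff (R p z) i"
          using insert.hyps by (intro polyfun_cong[OF polyfam_coeff[OF dv2[OF p]]]) (auto simp: z'_def)
        also have "\<dots> = 0"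
        proof (cases "i \<le> d")
          case True
          then show ?thesis using z(1)[of "\<lambda>x. coeff (R p x) i"] p by (auto simp: \<Phi>'_def)
        next
          case False
          then show ?thesis using polyfam_degree[OF dv2[OF p], of z] by (intro coeff_eq_0) auto
        qed
        finally show "coeff (R p z') i = coeff 0 i" by simp
      qed
      then have "g z' ^ m p * p z' = 0" using ev[OF p, of z'] y(1) by (simp add: z'_def eqG)
      then show ?thesis using g0 gz' by simp
    qed
    moreover have "vclose (insert v S) e z' (\<xi> k)" if "k \<ge> M" for k
      unfolding vclose_def
    proof
      fix w assume w: "w \<in> insert v S"
      show "vge e (z' w - \<xi> k w)"
      proof (cases "w = v")
        case True
        have "vge e (\<xi> M v - \<xi> k v)" using N4[of M k] MN that by (auto simp: vclose_def)
        then show ?thesis using vge_trans[OF y(2)] True by (simp add: z'_def)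
      next
        case False
        then show ?thesis using z(2)[of k] w that MN by (auto simp: z'_def vclose_def)
      qed
    qed
    ultimately show ?thesis by blast
  qed
qed

text \<open>A fixed gain \<open>\<mu>\<close> per step makes the iterates Cauchy and the values
  null, and \<open>exact_zeros_near\<close> replaces the limit. A step has to be possible only
  within \<open>r0\<close> of \<open>x0\<close>, a ball that the iteration never leaves by the
  ultrametric inequality.\<close>

theorem newton_exact:
  fixes F :: "'i \<Rightarrow> ('v::finite \<Rightarrow> 'k) \<Rightarrow> 'k"
  assumes "finite I" "\<And>i. i \<in> I \<Longrightarrow> F i \<in> polyfun UNIV" "\<mu> > 0"
    and start: "\<And>i. i \<in> I \<Longrightarrow> vge r0 (F i x0)"
    and step: "\<And>x r. r \<ge> r0 \<Longrightarrow> vclose UNIV r0 x x0 \<Longrightarrow> (\<And>i. i \<in> I \<Longrightarrow> vge r (F i x)) \<Longrightarrow>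
        \<exists>x'. vclose UNIV r x' x \<and> (\<forall>i\<in>I. vge (r + \<mu>) (F i x'))"
  shows "\<exists>z. vclose UNIV r0 z x0 \<and> (\<forall>i\<in>I. F i z = 0)"
proof -
  define P where "P n x \<longleftrightarrow> vclose UNIV r0 x x0 \<and> (\<forall>i\<in>I. vge (r0 + real n * \<mu>) (F i x))" for n and x :: "'v \<Rightarrow> 'k"
  define Q where "Q n x x' \<longleftrightarrow> vclose UNIV (r0 + real n * \<mu>) x' x" for n and x x' :: "'v \<Rightarrow> 'k"
  have "\<exists>\<xi>. \<forall>n. P n (\<xi> n) \<and> Q n (\<xi> n) (\<xi> (Suc n))"
  proof (rule dependent_nat_choice)
    show "\<exists>x. P 0 x" using start by (auto simp: P_def vclose_def intro!: exI[of _ x0])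
  next
    fix x n assume p: "P n x"
    have "r0 + real n * \<mu> \<ge> r0" using assms(3) by simp
    from step[OF this, of x] p obtain x' where x': "vclose UNIV (r0 + real n * \<mu>) x' x"
        "\<forall>i\<in>I. vge (r0 + real n * \<mu> + \<mu>) (F i x')"
      unfolding P_def by blast
    have "vclose UNIV r0 x' x0"
      using vclose_mono[OF x'(1), of r0] p assms(3) unfolding P_def vclose_def by (auto intro: vge_trans)
    then show "\<exists>x'. P (Suc n) x' \<and> Q n x x'"
      using x' unfolding P_def Q_def by (intro exI[of _ x']) (auto simp: algebra_simps)
  qed
  then obtain \<xi> where P: "\<And>n. P n (\<xi> n)" and Q: "\<And>n. Q n (\<xi> n) (\<xi> (Suc n))" by blast
  have Q': "vclose UNIV (r0 + real n * \<mu>) (\<xi> (n + m)) (\<xi> n)" for n m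
  proof (induction m)
    case (Suc m)
    have "vclose UNIV (r0 + real n * \<mu>) (\<xi> (Suc (n + m))) (\<xi> (n + m))"
      using Q[of "n + m"] unfolding Q_def
      by (rule vclose_mono) (use assms(3) in \<open>simp add: algebra_simps\<close>)
    then show ?case using Suc unfolding vclose_def by (auto intro: vge_trans)
  qed (simp add: vclose_def)
  have large: "\<exists>n. e \<le> r0 + real n * \<mu>" for e
    using reals_Archimedean3[OF assms(3), rule_format, of "e - r0"] by (metis add.commute diff_le_eq less_imp_le)
  have "vcauchy UNIV \<xi>"
    unfolding vcauchy_def
  proof
    fix e
    obtain n where n: "e \<le> r0 + real n * \<mu>" using large by blast
    have *: "vclose UNIV e (\<xi> k) (\<xi> n)" if "k \<ge> n" for k
      using vclose_mono[OF Q'[of n "k - n"] n] that by simp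
    have "vclose UNIV e (\<xi> k) (\<xi> l)" if "k \<ge> n" "l \<ge> n" for k l
      using *[OF that(1)] *[OF that(2)] unfolding vclose_def by (metis vge_commute vge_trans)
    then show "\<exists>N. \<forall>k\<ge>N. \<forall>l\<ge>N. vclose UNIV e (\<xi> k) (\<xi> l)" by blast
  qed
  moreover have "vnull (\<lambda>k. F i (\<xi> k))" if "i \<in> I" for i
    unfolding vnull_def
  proof
    fix e
    obtain n where n: "e \<le> r0 + real n * \<mu>" using large by blast
    have "vge e (F i (\<xi> k))" if "k \<ge> n" for k
    proof -
      have "vge (r0 + real k * \<mu>) (F i (\<xi> k))" using P[of k] \<open>i \<in> I\<close> by (simp add: P_def)
      moreover have "e \<le> r0 + real k * \<mu>"
        using n that assms(3) by (smt (verit) mult_right_mono of_nat_mono)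
      ultimately show ?thesis by (rule vge_mono)
    qed
    then show "\<exists>N. \<forall>k\<ge>N. vge e (F i (\<xi> k))" by blast
  qed
  ultimately obtain z N where z: "\<forall>p\<in>F ` I. p z = 0" "\<forall>k\<ge>N. vclose UNIV r0 z (\<xi> k)"
    using exact_zeros_near[of UNIV "F ` I" \<xi> r0] assms(1,2) by auto
  have "vclose UNIV r0 z (\<xi> N)" "vclose UNIV r0 (\<xi> N) x0" using z(2) P[of N] by (auto simp: P_def)
  then have "vclose UNIV r0 z x0" unfolding vclose_def by (auto intro: vge_trans)
  then show ?thesis using z(1) by auto
qed

end

section \<open>Monomials and logarithmic derivatives\<close>

definition lmono :: "'k::field ^ 'n::finite \<Rightarrow> int ^ 'n \<Rightarrow> 'k" where
  "lmono x w = (\<Prod>j\<in>UNIV. x $ j powi (w $ j))"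

text \<open>The logarithmic derivative of the monomial with exponent \<open>w\<close>: its
  derivative in the direction \<open>x * a\<close>, divided by the monomial.\<close>

definition ip :: "int ^ 'n::finite \<Rightarrow> 'k::field ^ 'n \<Rightarrow> 'k" where
  "ip w a = (\<Sum>j\<in>UNIV. of_int (w $ j) * a $ j)"

lemma ip_add: "ip w (a + b) = ip w a + ip w b"
  by (simp add: ip_def algebra_simps sum.distrib)

lemma ip_diff: "ip w (a - b) = ip w a - ip w b"
  by (simp add: ip_def algebra_simps sum_subtractf)

lemma ip_scale: "ip w (c *s a) = c * ip w a"
  by (simp add: ip_def sum_distrib_left algebra_simps)

lemma ip_zero [simp]: "ip w 0 = 0" "ip 0 a = 0"
  by (simp_all add: ip_def)

lemma ip_add_left: "ip (v + w) a = ip v a + ip w a"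
  by (simp add: ip_def algebra_simps sum.distrib)

lemma ip_sum: "ip w (sum f A) = (\<Sum>i\<in>A. ip w (f i))"
  by (induction A rule: infinite_finite_induct) (auto simp: ip_add)

lemma lmono_one [simp]: "lmono 1 w = 1"
  by (simp add: lmono_def)

lemma lmono_add: "x \<in> torus \<Longrightarrow> lmono x (v + w) = lmono x v * lmono x w"
  by (simp add: lmono_def torus_def power_int_add prod.distrib)

lemma lmono_mult: "lmono (x * y) w = lmono x w * lmono y w"
  by (simp add: lmono_def power_int_mult_distrib prod.distrib)

lemma lmono_nz: "x \<in> torus \<Longrightarrow> lmono x w \<noteq> 0"
  by (simp add: lmono_def torus_def)

context valued_field
begin

lemma vge_mult_same: "vge r x \<Longrightarrow> vge r y \<Longrightarrow> vge (2 * r) (x * y)"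
  unfolding mult_2 by (rule vge_mult)

text \<open>Says that \<open>u\<close> equals \<open>1 + p\<close> to first order. The relation
  turns products into sums, so the expansion of a Laurent monomial reduces to that of its
  coordinates.\<close>

definition vlin :: "real \<Rightarrow> 'k \<Rightarrow> 'k \<Rightarrow> bool" where
  "vlin r u p \<longleftrightarrow> vge r p \<and> vge (2 * r) (u - 1 - p)"

lemma vlin_mult:
  assumes "r > 0" "vlin r u p" "vlin r v q" shows "vlin r (u * v) (p + q)"
proof -
  define d e where "d = u - 1 - p" and "e = v - 1 - q"
  have d: "vge (2 * r) d" "vge (2 * r) e" "vge r p" "vge r q"
    using assms by (auto simp: vlin_def d_def e_def)
  have o: "vge 0 p" "vge 0 q" "vge 0 e"
    using vge_mono[OF d(3)] vge_mono[OF d(4)] vge_mono[OF d(2)] assms(1) by auto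
  have "vge (2 * r) (p * q)" using vge_mult_same[OF d(3,4)] .
  moreover have "vge (2 * r) (e * (1 + p))" "vge (2 * r) (d * (1 + q + e))"
    by (intro vge_mult_right vge_add vge_1 d o)+
  ultimately have "vge (2 * r) (p * q + e * (1 + p) + d * (1 + q + e))"
    by (intro vge_add)
  moreover have "p * q + e * (1 + p) + d * (1 + q + e) = u * v - 1 - (p + q)"
    by (simp add: d_def e_def algebra_simps)
  ultimately show ?thesis using d by (auto simp: vlin_def intro: vge_add)
qed

lemma vlin_unit: assumes "r > 0" "vlin r u p" shows "val u = 0" "vge r (u - 1)"
proof -
  have "vge r (u - 1 - p)" "vge r p"
    using assms vge_mono[of "2 * r" "u - 1 - p" r] by (auto simp: vlin_def)
  from vge_add[OF this] show *: "vge r (u - 1)" by simp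
  show "val u = 0" by (rule val_eq_0_close[OF val_1 * assms(1)])
qed

lemma vlin_inverse:
  assumes "r > 0" "vlin r u p" shows "vlin r (inverse u) (- p)"
proof -
  have u: "val u = 0" "vge r (u - 1)" using vlin_unit[OF assms] by auto
  then have nz: "u \<noteq> 0" by auto
  have "val (inverse u) = 0" using val_inverse[OF nz] u by simp
  then have iu: "vge 0 (inverse u)" by (simp add: vge_def zero_ereal_def)
  have "vge (2 * r) (p * (u - 1) - (u - 1 - p))"
    using assms(2) unfolding vlin_def by (intro vge_diff[of _ "p * (u - 1)"] vge_mult_same u(2)) simp_all
  then have "vge (2 * r) (inverse u * (p * (u - 1) - (u - 1 - p)))"
    by (rule vge_mult_left[OF iu])
  moreover have "inverse u * (p * (u - 1) - (u - 1 - p)) = inverse u - 1 - (- p)"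
    using nz by (simp add: field_simps)
  ultimately show ?thesis using assms(2) by (auto simp: vlin_def)
qed

lemma vlin_power: assumes "r > 0" "vlin r u p" shows "vlin r (u ^ n) (of_nat n * p)"
proof (induction n)
  case (Suc n)
  then show ?case using vlin_mult[OF assms(1,2) Suc] by (simp add: algebra_simps)
qed (simp add: vlin_def)

lemma vlin_powi: assumes "r > 0" "vlin r u p" shows "vlin r (u powi m) (of_int m * p)"
proof (cases "m \<ge> 0")
  case True
  then show ?thesis using vlin_power[OF assms, of "nat m"] by (simp add: power_int_def)
next
  case False
  then show ?thesis using vlin_inverse[OF assms(1) vlin_power[OF assms, of "nat (- m)"]]
    by (simp add: power_int_def power_inverse)
qed

lemma vlin_prod:
  assumes "r > 0" "\<And>i. i \<in> A \<Longrightarrow> vlin r (u i) (p i)" shows "vlin r (prod u A) (sum p A)"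
  using assms(2)
proof (induction A rule: infinite_finite_induct)
  case (insert x A)
  then show ?case using vlin_mult[OF assms(1)] by simp
qed (auto simp: vlin_def)

lemma lmono_vlin:
  assumes "r > 0" "\<And>j. vge r (e $ j)" shows "vlin r (lmono (1 + e) w) (ip w e)"
  unfolding lmono_def ip_def
proof (rule vlin_prod[OF assms(1)])
  show "vlin r ((1 + e) $ j powi w $ j) (of_int (w $ j) * e $ j)" for j
    by (rule vlin_powi[OF assms(1)]) (use assms(2) in \<open>simp add: vlin_def\<close>)
qed

lemma ip_vge: "(\<And>j. vge r (e $ j)) \<Longrightarrow> vge r (ip w e)"
  unfolding ip_def by (intro vge_sum vge_mult_left vge_of_int)

lemma lmono_near_1:
  assumes "r > 0" "\<And>j. vge r (x $ j - 1)" shows "val (lmono x w) = 0" "vge r (lmono x w - 1)"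
proof -
  have "vlin r (lmono (1 + (x - 1)) w) (ip w (x - 1))" using assms by (intro lmono_vlin) auto
  then show "val (lmono x w) = 0" "vge r (lmono x w - 1)" using vlin_unit[OF assms(1)] by auto
qed

lemma near_1_torus: assumes "r > 0" "\<And>j. vge r (x $ j - 1)" shows "x \<in> torus"
proof -
  have "val (x $ j) = 0" for j using val_eq_0_close[OF val_1 assms(2,1)] .
  then have "x $ j \<noteq> 0" for j using val_0 by (metis PInfty_neq_ereal(2) zero_ereal_def)
  then show ?thesis by (simp add: torus_def)
qed

end

section \<open>Deforming a point of a curve together with its tangent line\<close>

text \<open>In coordinates relative to a point, \<open>H i\<close> are the equations of the curve and \<open>A i x\<close> is the
  differential of \<open>H i\<close> at \<open>x\<close> with respect to logarithmic coordinates. The vectors \<open>d i\<close> invert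
  the differential at the point \<open>1\<close> modulo the maximal ideal.\<close>

locale local_equations = alg_closed_valued_field val
  for val :: "'k::alg_closed_field \<Rightarrow> ereal" +
  fixes I :: "'i set" and T :: "'i \<Rightarrow> (int ^ 'n::finite) set" and \<gamma> :: "'i \<Rightarrow> int ^ 'n \<Rightarrow> 'k"
    and d :: "'i \<Rightarrow> 'k ^ 'n" and \<mu> :: real
  assumes finI: "finite I" and finT: "\<And>i. i \<in> I \<Longrightarrow> finite (T i)"
    and \<gamma>: "\<And>i w. i \<in> I \<Longrightarrow> w \<in> T i \<Longrightarrow> vge 0 (\<gamma> i w)"
    and \<mu>: "\<mu> > 0"
    and d: "\<And>i j. i \<in> I \<Longrightarrow> vge 0 (d i $ j)"
    and dual: "\<And>i k. i \<in> I \<Longrightarrow> k \<in> I \<Longrightarrow>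
        vge \<mu> ((\<Sum>w\<in>T i. \<gamma> i w * ip w (d k)) - (if i = k then 1 else 0))"
begin

definition H :: "'i \<Rightarrow> 'k ^ 'n \<Rightarrow> 'k" where
  "H i x = (\<Sum>w\<in>T i. \<gamma> i w * lmono x w)"

definition A :: "'i \<Rightarrow> 'k ^ 'n \<Rightarrow> 'k ^ 'n \<Rightarrow> 'k" where
  "A i x b = (\<Sum>w\<in>T i. \<gamma> i w * lmono x w * ip w b)"

text \<open>The derivative of \<open>A i x b\<close> when the point moves in the direction
  \<open>x * e\<close>, that is, the second logarithmic derivative of \<open>H i\<close>.\<close>

definition B :: "'i \<Rightarrow> 'k ^ 'n \<Rightarrow> 'k ^ 'n \<Rightarrow> 'k ^ 'n \<Rightarrow> 'k" where
  "B i x e b = (\<Sum>w\<in>T i. \<gamma> i w * lmono x w * ip w e * ip w b)"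

lemma A_diff: "A i x (b - c) = A i x b - A i x c"
  by (simp add: A_def ip_diff algebra_simps sum_subtractf)

lemma A_scale: "A i x (c *s b) = c * A i x b"
  by (simp add: A_def ip_scale algebra_simps sum_distrib_left)

lemma A_sum: "A i x (sum f S) = (\<Sum>k\<in>S. A i x (f k))"
  unfolding A_def ip_sum by (subst sum.swap) (simp add: sum_distrib_left)

lemma B_scale: "B i x (c *s e) b = c * B i x e b"
  by (simp add: B_def ip_scale algebra_simps sum_distrib_left)

lemma B_vge: "i \<in> I \<Longrightarrow> (\<And>j. vge r (e $ j)) \<Longrightarrow> (\<And>j. vge 0 (b $ j)) \<Longrightarrow> vge r (B i 1 e b)"
  unfolding B_def lmono_one mult_1_right
  by (intro vge_sum vge_mult_right[of r _ "ip _ b"] vge_mult_left[OF \<gamma>] ip_vge)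

text \<open>The vectors \<open>d k\<close> are dual to the differentials up to \<open>\<mu>\<close>,
  so this \<open>b\<close> solves the linearised system with right-hand side \<open>- c\<close> with
  a gain of \<open>\<mu>\<close>.\<close>

lemma A_dual: assumes "i \<in> I" "\<And>k. k \<in> I \<Longrightarrow> vge r (c k)" "b = - (\<Sum>k\<in>I. c k *s d k)"
  shows "vge (r + \<mu>) (A i 1 b + c i)" "vge r (b $ j)"
proof -
  have "A i 1 b = - (\<Sum>k\<in>I. c k * A i 1 (d k))"
    using A_diff[of i 1 0 "\<Sum>k\<in>I. c k *s d k"] unfolding assms(3) A_sum A_scale by (simp add: A_def)
  moreover have "c i = (\<Sum>k\<in>I. c k * (if i = k then 1 else 0))"
    using assms(1) finI by (simp add: if_distrib[of "\<lambda>z. _ * z"] cong: if_cong)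
  ultimately have "A i 1 b + c i = - (\<Sum>k\<in>I. c k * (A i 1 (d k) - (if i = k then 1 else 0)))"
    by (simp add: algebra_simps sum_subtractf)
  moreover have "vge (r + \<mu>) (\<Sum>k\<in>I. c k * (A i 1 (d k) - (if i = k then 1 else 0)))"
    using dual[OF assms(1)] assms(2) by (intro vge_sum vge_mult) (simp_all add: A_def)
  ultimately show "vge (r + \<mu>) (A i 1 b + c i)" by simp
  show "vge r (b $ j)" unfolding assms(3)
    using assms(2) d by (auto intro!: vge_sum vge_mult_right)
qed

text \<open>The point is changed by the factor \<open>1 + e\<close>: monomials are multiplicative,
  so \<open>lmono_vlin\<close> applies to each term and the remainder is quadratic.\<close>

lemma H_step:
  assumes i: "i \<in> I" and x: "\<And>j. vge \<mu> (x $ j - 1)" and e: "r > 0" "\<And>j. vge r (e $ j)"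
  shows "vge (2 * r) (H i (x * (1 + e)) - H i x - A i x e)"
proof -
  have "H i (x * (1 + e)) - H i x - A i x e
      = (\<Sum>w\<in>T i. \<gamma> i w * lmono x w * (lmono (1 + e) w - 1 - ip w e))"
    unfolding H_def A_def lmono_mult by (simp add: algebra_simps sum_subtractf sum.distrib)
  moreover have "vge (2 * r) (\<gamma> i w * lmono x w * (lmono (1 + e) w - 1 - ip w e))" if "w \<in> T i" for w
  proof -
    have "val (lmono x w) = 0" by (rule lmono_near_1[OF \<mu> x])
    then have "vge 0 (lmono x w)" by (simp add: vge_def zero_ereal_def)
    then show ?thesis using lmono_vlin[OF e, of w] \<gamma>[OF i that]
      by (intro vge_mult_left) (auto simp: vlin_def)
  qed
  ultimately show ?thesis by (simp add: vge_sum)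
qed

text \<open>Linearisation in point and direction at once. The mixed contribution of \<open>e\<close>
  and \<open>c\<close> is quadratic and joins the error.\<close>

lemma A_step:
  assumes i: "i \<in> I" and x: "\<And>j. vge \<mu> (x $ j - 1)" and e: "r > 0" "\<And>j. vge r (e $ j)"
    and b: "\<And>j. vge 0 (b $ j)" and c: "\<And>j. vge r (c $ j)"
  shows "vge (2 * r) (A i (x * (1 + e)) (b + c) - A i x b - B i x e b - A i x c)"
proof -
  have "A i (x * (1 + e)) (b + c) - A i x b - B i x e b - A i x c
      = (\<Sum>w\<in>T i. \<gamma> i w * lmono x w * ((lmono (1 + e) w - 1 - ip w e) * ip w b + (lmono (1 + e) w - 1) * ip w c))"
    unfolding A_def B_def lmono_mult ip_add by (simp add: algebra_simps sum_subtractf sum.distrib)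
  moreover have "vge (2 * r) (\<gamma> i w * lmono x w *
      ((lmono (1 + e) w - 1 - ip w e) * ip w b + (lmono (1 + e) w - 1) * ip w c))" if "w \<in> T i" for w
  proof -
    have "val (lmono x w) = 0" by (rule lmono_near_1[OF \<mu> x])
    then have m: "vge 0 (lmono x w)" by (simp add: vge_def zero_ereal_def)
    have l: "vlin r (lmono (1 + e) w) (ip w e)" by (rule lmono_vlin[OF e])
    have 1: "vge (2 * r) ((lmono (1 + e) w - 1 - ip w e) * ip w b)"
      using l by (intro vge_mult_right ip_vge b) (auto simp: vlin_def)
    have 2: "vge (2 * r) ((lmono (1 + e) w - 1) * ip w c)"
      using vge_mult_same[OF vlin_unit(2)[OF e(1) l] ip_vge[OF c]] .
    show ?thesis by (rule vge_mult_left[OF vge_mult_left[OF \<gamma>[OF i that] m] vge_add[OF 1 2]])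
  qed
  ultimately show ?thesis by (simp add: vge_sum)
qed

text \<open>Since \<open>x\<close> is \<open>1\<close> up to \<open>\<mu>\<close>, the approximate
  inverse \<open>d\<close> of the differential at \<open>1\<close> serves at every iterate.\<close>

lemma A_near_1:
  assumes i: "i \<in> I" and x: "\<And>j. vge \<mu> (x $ j - 1)" and e: "\<And>j. vge r (e $ j)"
  shows "vge (r + \<mu>) (A i x e - A i 1 e)"
proof -
  have "A i x e - A i 1 e = (\<Sum>w\<in>T i. \<gamma> i w * (ip w e * (lmono x w - 1)))"
    by (simp add: A_def algebra_simps sum_subtractf)
  moreover have "vge (r + \<mu>) (\<gamma> i w * (ip w e * (lmono x w - 1)))" if "w \<in> T i" for w
    by (rule vge_mult_left[OF \<gamma>[OF i that] vge_mult[OF ip_vge[OF e] lmono_near_1(2)[OF \<mu> x]]])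
  ultimately show ?thesis by (simp add: vge_sum)
qed

lemma B_near_1:
  assumes i: "i \<in> I" and x: "\<And>j. vge \<mu> (x $ j - 1)" and e: "\<And>j. vge r (e $ j)"
    and b: "\<And>j. vge 0 (b $ j)"
  shows "vge (r + \<mu>) (B i x e b - B i 1 e b)"
proof -
  have "B i x e b - B i 1 e b = (\<Sum>w\<in>T i. \<gamma> i w * (ip w e * (lmono x w - 1) * ip w b))"
    by (simp add: B_def algebra_simps sum_subtractf)
  moreover have "vge (r + \<mu>) (\<gamma> i w * (ip w e * (lmono x w - 1) * ip w b))" if "w \<in> T i" for w
    by (rule vge_mult_left[OF \<gamma>[OF i that]
          vge_mult_right[OF vge_mult[OF ip_vge[OF e] lmono_near_1(2)[OF \<mu> x]] ip_vge[OF b]]])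
  ultimately show ?thesis by (simp add: vge_sum)
qed

text \<open>The system is triangular: \<open>e\<close> corrects \<open>H\<close> without regard to
  the direction, and \<open>c\<close> then corrects \<open>A\<close> together with the term
  \<open>B i 1 e b\<close> caused by \<open>e\<close>. Quadratic errors are absorbed because
  \<open>2 * r \<ge> r + \<mu>\<close>.\<close>

lemma newton_step:
  assumes x: "\<And>j. vge \<mu> (x $ j - 1)" and b: "\<And>j. vge 0 (b $ j)" and r: "r \<ge> \<mu>"
    and h: "\<And>i. i \<in> I \<Longrightarrow> vge r (H i x)" and q: "\<And>i. i \<in> I \<Longrightarrow> vge r (A i x b)"
  shows "\<exists>x' b'. (\<forall>j. vge r (x' $ j - x $ j) \<and> vge r (b' $ j - b $ j)) \<and>
           (\<forall>i\<in>I. vge (r + \<mu>) (H i x') \<and> vge (r + \<mu>) (A i x' b'))"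
proof -
  have r0: "r > 0" using r \<mu> by simp
  define e where "e = - (\<Sum>k\<in>I. H k x *s d k)"
  have e: "vge r (e $ j)" "i \<in> I \<Longrightarrow> vge (r + \<mu>) (A i 1 e + H i x)" for i j
  proof -
    show "vge (r + \<mu>) (A i 1 e + H i x)" if "i \<in> I" by (rule A_dual(1)[OF that h e_def])
    show "vge r (e $ j)"
    proof (cases "I = {}")
      case False
      then show ?thesis using A_dual(2)[OF _ h e_def] by blast
    qed (simp add: e_def)
  qed
  have Be: "vge r (A k x b + B k 1 e b)" if "k \<in> I" for k
    using q[OF that] B_vge[OF that e(1) b] by (rule vge_add)
  define c where "c = - (\<Sum>k\<in>I. (A k x b + B k 1 e b) *s d k)"
  have c: "vge r (c $ j)" "i \<in> I \<Longrightarrow> vge (r + \<mu>) (A i 1 c + (A i x b + B i 1 e b))" for i j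
  proof -
    show "vge (r + \<mu>) (A i 1 c + (A i x b + B i 1 e b))" if "i \<in> I"
      by (rule A_dual(1)[OF that Be c_def])
    show "vge r (c $ j)"
    proof (cases "I = {}")
      case False
      then show ?thesis using A_dual(2)[OF _ Be c_def] by blast
    qed (simp add: c_def)
  qed
  have rr: "vge (r + \<mu>) z" if "vge (2 * r) z" for z
    using that by (rule vge_mono) (use r in simp)
  show ?thesis
  proof (rule exI[of _ "x * (1 + e)"], rule exI[of _ "b + c"], intro conjI allI ballI)
    fix j
    have "val (x $ j) = 0" by (rule val_eq_0_close[OF val_1 x \<mu>])
    then have "vge 0 (x $ j)" by (simp add: vge_def zero_ereal_def)
    from vge_mult_left[OF this e(1)[of j]] show "vge r ((x * (1 + e)) $ j - x $ j)"
      by (simp add: distrib_left)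
    show "vge r ((b + c) $ j - b $ j)" using c(1) by simp
  next
    fix i assume i: "i \<in> I"
    have "vge (r + \<mu>) ((H i (x * (1 + e)) - H i x - A i x e) + (A i x e - A i 1 e) + (A i 1 e + H i x))"
      by (intro vge_add rr[OF H_step] A_near_1 e i x r0)
    then show "vge (r + \<mu>) (H i (x * (1 + e)))" by simp
    have "vge (r + \<mu>) ((A i (x * (1 + e)) (b + c) - A i x b - B i x e b - A i x c)
       + (A i x c - A i 1 c) + (B i x e b - B i 1 e b) + (A i 1 c + (A i x b + B i 1 e b)))"
      by (intro vge_add rr[OF A_step] A_near_1 B_near_1 e c i x b r0)
    then show "vge (r + \<mu>) (A i (x * (1 + e)) (b + c))" by (simp add: algebra_simps)
  qed
qed

text \<open>The equations are multiplied by a monomial with exponents \<open>N\<close> in order to make them polynomial.\<close>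

lemma exact_solution:
  assumes x0: "\<And>j. vge \<mu> (x0 $ j - 1)" and b0: "\<And>j. vge 0 (b0 $ j)" and r0: "r0 \<ge> \<mu>"
    and h: "\<And>i. i \<in> I \<Longrightarrow> vge r0 (H i x0)" and q: "\<And>i. i \<in> I \<Longrightarrow> vge r0 (A i x0 b0)"
  shows "\<exists>x b. (\<forall>j. vge r0 (x $ j - x0 $ j) \<and> vge r0 (b $ j - b0 $ j)) \<and>
           (\<forall>i\<in>I. H i x = 0 \<and> A i x b = 0)"
proof -
  \<comment> \<open>Bounds the absolute value of every exponent that occurs.\<close>
  define N where "N = (\<Sum>i\<in>I. \<Sum>w\<in>T i. \<Sum>j\<in>UNIV. \<bar>w $ j\<bar>)"
  have N: "w $ j + N \<ge> 0" if "i \<in> I" "w \<in> T i" for i w j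
  proof -
    have "\<bar>w $ j\<bar> \<le> (\<Sum>j\<in>UNIV. \<bar>w $ j\<bar>)" by (rule member_le_sum) auto
    also have "\<dots> \<le> (\<Sum>w\<in>T i. \<Sum>j\<in>UNIV. \<bar>w $ j\<bar>)"
      using that finT by (intro member_le_sum[of w]) (auto intro: sum_nonneg)
    also have "\<dots> \<le> N" unfolding N_def
      using that finI by (intro member_le_sum[of i]) (auto intro: sum_nonneg)
    finally show ?thesis by linarith
  qed
  \<comment> \<open>The \<open>Inl\<close> variables are the point and the \<open>Inr\<close>
    variables the direction. In \<open>F p\<close> the flag \<open>snd p\<close> selects the
    equation \<open>A\<close> (\<open>True\<close>) or \<open>H\<close>
    (\<open>False\<close>).\<close>
  define X where "X y = (\<chi> j. y (Inl j))" for y :: "'n + 'n \<Rightarrow> 'k"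
  define Y where "Y y = (\<chi> j. y (Inr j))" for y :: "'n + 'n \<Rightarrow> 'k"
  define F where "F p y = (\<Sum>w\<in>T (fst p). \<gamma> (fst p) w * (\<Prod>j\<in>UNIV. y (Inl j) ^ nat (w $ j + N)) *
      (if snd p then ip w (Y y) else 1))" for p and y :: "'n + 'n \<Rightarrow> 'k"
  define m where "m y = (\<Prod>j\<in>UNIV. y (Inl j) powi N)" for y :: "'n + 'n \<Rightarrow> 'k"
  have FH: "F p y = m y * (if snd p then A (fst p) (X y) (Y y) else H (fst p) (X y))"
    if "fst p \<in> I" "X y \<in> torus" for p y
  proof -
    have "(\<Prod>j\<in>UNIV. y (Inl j) ^ nat (w $ j + N)) = m y * lmono (X y) w" if w: "w \<in> T (fst p)" for w
      unfolding m_def lmono_def prod.distrib[symmetric]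
    proof (rule prod.cong[OF refl])
      fix j
      have "y (Inl j) \<noteq> 0" using \<open>X y \<in> torus\<close> by (auto simp: torus_def X_def)
      then show "y (Inl j) ^ nat (w $ j + N) = y (Inl j) powi N * X y $ j powi w $ j"
        using N[OF \<open>fst p \<in> I\<close> w, of j]
        by (simp add: X_def power_int_def[of _ "w $ j + N", symmetric] power_int_add[symmetric] add.commute
            flip: power_int_of_nat)
    qed
    then show ?thesis
      by (simp add: F_def A_def H_def sum_distrib_left mult_ac cong: sum.cong)
  qed
  have m: "val (m y) = 0" if "\<And>j. vge \<mu> (X y $ j - 1)" for y
    using lmono_near_1(1)[OF \<mu> that, of "\<chi> j. N"] by (simp add: m_def lmono_def X_def)
  define y0 where "y0 v = (case v of Inl j \<Rightarrow> x0 $ j | Inr j \<Rightarrow> b0 $ j)" for v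
  have X0: "X y0 = x0" "Y y0 = b0" by (auto simp: X_def Y_def y0_def vec_eq_iff)
  have near: "vge \<mu> (X y $ j - 1)" "vge 0 (Y y $ j)" if "vclose UNIV r0 y y0" for y j
  proof -
    have "vge r0 (X y $ j - x0 $ j)" "vge r0 (Y y $ j - b0 $ j)"
      using that by (auto simp: vclose_def X_def Y_def y0_def dest: spec[of _ "Inl j"] spec[of _ "Inr j"])
    then have *: "vge \<mu> (X y $ j - x0 $ j)" "vge 0 (Y y $ j - b0 $ j)"
      using r0 \<mu> by (auto elim!: vge_mono)
    show "vge \<mu> (X y $ j - 1)" using vge_trans[OF *(1) x0] .
    show "vge 0 (Y y $ j)" using vge_0_close[OF b0 *(2)] by simp
  qed
  have val_F: "val (F p y) = val (if snd p then A (fst p) (X y) (Y y) else H (fst p) (X y))"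
    if "fst p \<in> I" "vclose UNIV r0 y y0" for p y
    using FH[OF that(1) near_1_torus[OF \<mu> near(1)[OF that(2)]]] m[OF near(1)[OF that(2)]]
    by (simp add: val_mult)
  have self: "vclose UNIV r0 y0 y0" by (simp add: vclose_def)
  have "\<exists>z. vclose UNIV r0 z y0 \<and> (\<forall>p\<in>I \<times> UNIV. F p z = 0)"
  proof (rule newton_exact[OF _ _ \<mu>])
    show "finite (I \<times> (UNIV :: bool set))" using finI by simp
    show "F p \<in> polyfun UNIV" for p
    proof -
      have "(\<lambda>y. ip w (Y y)) \<in> polyfun UNIV" for w
        unfolding ip_def Y_def by (simp, intro polyfun_sum polyfun.mult polyfun.const polyfun.coord UNIV_I)
      then have "(\<lambda>y. if snd p then ip w (Y y) else 1) \<in> polyfun UNIV" for w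
        by (cases "snd p") (auto intro: polyfun.const)
      then show ?thesis
        unfolding F_def
        by (intro polyfun_sum polyfun.mult polyfun.const polyfun_prod polyfun_power polyfun.coord UNIV_I)
    qed
    show "vge r0 (F p y0)" if "p \<in> I \<times> UNIV" for p
      using val_F[OF _ self, of p] that h[of "fst p"] q[of "fst p"] by (auto simp: vge_def X0)
  next
    fix y r assume r: "r \<ge> r0" and y: "vclose UNIV r0 y y0"
      and F: "\<And>p. p \<in> I \<times> UNIV \<Longrightarrow> vge r (F p y)"
    have "vge r (H i (X y))" "vge r (A i (X y) (Y y))" if "i \<in> I" for i
      using F[of "(i, False)"] F[of "(i, True)"] val_F[OF _ y, of "(i, False)"]
        val_F[OF _ y, of "(i, True)"] that by (auto simp: vge_def)
    then have "\<exists>x' b'. (\<forall>j. vge r (x' $ j - X y $ j) \<and> vge r (b' $ j - Y y $ j)) \<and>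
           (\<forall>i\<in>I. vge (r + \<mu>) (H i x') \<and> vge (r + \<mu>) (A i x' b'))"
      using r r0 by (intro newton_step near[OF y]) auto
    then obtain x' b' where *: "\<And>j. vge r (x' $ j - X y $ j)" "\<And>j. vge r (b' $ j - Y y $ j)"
        "\<And>i. i \<in> I \<Longrightarrow> vge (r + \<mu>) (H i x')" "\<And>i. i \<in> I \<Longrightarrow> vge (r + \<mu>) (A i x' b')"
      by blast
    define y' where "y' v = (case v of Inl j \<Rightarrow> x' $ j | Inr j \<Rightarrow> b' $ j)" for v
    have X': "X y' = x'" "Y y' = b'" by (auto simp: X_def Y_def y'_def vec_eq_iff)
    have y'y: "vclose UNIV r y' y"
      unfolding vclose_def
    proof
      show "vge r (y' v - y v)" for v
        using *(1,2) by (cases v) (auto simp: y'_def X_def Y_def)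
    qed
    have "vclose UNIV r0 y' y0"
      using vclose_mono[OF y'y r] y unfolding vclose_def by (metis vge_trans)
    then have "vge (r + \<mu>) (F p y')" if "p \<in> I \<times> UNIV" for p
      using val_F[of p y'] that *(3,4)[of "fst p"] by (auto simp: vge_def X')
    then show "\<exists>y'. vclose UNIV r y' y \<and> (\<forall>p\<in>I \<times> UNIV. vge (r + \<mu>) (F p y'))"
      using y'y by blast
  qed
  then obtain z where z: "vclose UNIV r0 z y0" "\<And>p. p \<in> I \<times> UNIV \<Longrightarrow> F p z = 0" by blast
  have "H i (X z) = 0" "A i (X z) (Y z) = 0" if "i \<in> I" for i
    using val_F[OF _ z(1), of "(i, False)"] val_F[OF _ z(1), of "(i, True)"]
      z(2)[of "(i, False)"] z(2)[of "(i, True)"] that by (auto simp: val_0_iff[symmetric])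
  moreover have "vge r0 (X z $ j - x0 $ j)" "vge r0 (Y z $ j - b0 $ j)" for j
    using z(1) by (auto simp: vclose_def X_def Y_def y0_def dest: spec[of _ "Inl j"] spec[of _ "Inr j"])
  ultimately show ?thesis by blast
qed

text \<open>Moving along the tangent direction \<open>a\<close>, the tangent direction itself changes at first order
  by \<open>second_order a\<close>.\<close>

definition second_order :: "'k ^ 'n \<Rightarrow> 'k ^ 'n" where
  "second_order a = - (\<Sum>k\<in>I. B k 1 a a *s d k)"

text \<open>If \<open>A i 1 a = 0\<close>, then for a point moving along \<open>1 + t a\<close> and
  a direction \<open>a + t b\<close> the tangency condition at first order in \<open>t\<close> is
  \<open>A i 1 b + B i 1 a a = 0\<close>. Duality solves it up to \<open>\<mu>\<close>.\<close>

lemma second_order: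
  assumes "\<And>j. vge 0 (a $ j)"
  shows "vge 0 (second_order a $ j)" "i \<in> I \<Longrightarrow> vge \<mu> (A i 1 (second_order a) + B i 1 a a)"
proof -
  have B: "vge 0 (B k 1 a a)" if "k \<in> I" for k using B_vge[OF that assms assms] .
  show "vge \<mu> (A i 1 (second_order a) + B i 1 a a)" if "i \<in> I"
    using A_dual(1)[OF that B second_order_def] by simp
  show "vge 0 (second_order a $ j)"
  proof (cases "I = {}")
    case False
    then show ?thesis using A_dual(2)[OF _ B second_order_def] by blast
  qed (unfold second_order_def, simp)
qed

text \<open>The guess \<open>1 + t a\<close>, \<open>a + t b\<close> solves both systems up to
  \<open>s + \<mu>\<close>: the linear terms cancel up to that order, and the quadratic ones have
  valuation at least \<open>2 * s\<close>. The exact solution differs from the guess only beyond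
  \<open>s\<close>, so the term \<open>t b\<close> can still be read off from
  \<open>a'\<close>.\<close>

lemma tangent_deformation:
  assumes H1: "\<And>i. i \<in> I \<Longrightarrow> H i 1 = 0" and a: "\<And>j. vge 0 (a $ j)" "\<And>i. i \<in> I \<Longrightarrow> A i 1 a = 0"
    and t: "val t = ereal s" "0 < s" "\<mu> \<le> s"
  shows "\<exists>x a'. (\<forall>j. vge s (x $ j - 1)) \<and> (\<forall>i\<in>I. H i x = 0 \<and> A i x a' = 0) \<and>
           (\<forall>j. vge (s + \<mu>) (a' $ j - (a $ j + t * second_order a $ j)))"
proof -
  let ?b = "second_order a"
  have ts: "vge s t" using t by (simp add: vge_def)
  define x0 where "x0 = 1 + t *s a"
  define b0 where "b0 = a + t *s ?b"
  note b = second_order[OF a(1)]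
  have e: "vge s ((t *s a) $ j)" "vge s ((t *s ?b) $ j)" for j
    using vge_mult_right[OF ts a(1)] vge_mult_right[OF ts b(1)] by simp_all
  have "vge 0 ((t *s ?b) $ j)" for j using e(2)[of j] by (rule vge_mono) (use t in simp)
  then have b0: "vge 0 (b0 $ j)" for j unfolding b0_def vector_add_component by (intro vge_add a)
  have x0: "vge s (x0 $ j - 1)" for j using e(1)[of j] by (simp add: x0_def)
  then have x0': "vge \<mu> (x0 $ j - 1)" for j by (rule vge_mono) (use t in simp)
  have one: "vge \<mu> ((1 :: 'k ^ 'n) $ j - 1)" for j by simp
  have ss: "vge (s + \<mu>) z" if "vge (2 * s) z" for z
    using that by (rule vge_mono) (use t in simp)
  have "vge (s + \<mu>) (H i x0)" if i: "i \<in> I" for i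
    using ss[OF H_step[OF i one t(2) e(1)]] H1[OF i] a(2)[OF i] by (simp add: x0_def A_scale)
  moreover have "vge (s + \<mu>) (A i x0 b0)" if i: "i \<in> I" for i
  proof -
    have "vge (s + \<mu>) (A i x0 b0 - A i 1 a - B i 1 (t *s a) a - A i 1 (t *s ?b))"
      using ss[OF A_step[OF i one t(2) e(1) a(1) e(2)]] by (simp add: x0_def b0_def)
    moreover have "vge (s + \<mu>) (t * (A i 1 ?b + B i 1 a a))" by (intro vge_mult ts b i)
    ultimately have "vge (s + \<mu>) (A i x0 b0 - A i 1 a - B i 1 (t *s a) a - A i 1 (t *s ?b)
       + t * (A i 1 ?b + B i 1 a a))" by (rule vge_add)
    then show ?thesis using a(2)[OF i] by (simp add: A_scale B_scale algebra_simps)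
  qed
  moreover have "s + \<mu> \<ge> \<mu>" using t by simp
  ultimately have "\<exists>x b. (\<forall>j. vge (s + \<mu>) (x $ j - x0 $ j) \<and> vge (s + \<mu>) (b $ j - b0 $ j)) \<and>
           (\<forall>i\<in>I. H i x = 0 \<and> A i x b = 0)"
    using x0' b0 by (intro exact_solution)
  then obtain x a' where *: "\<And>j. vge (s + \<mu>) (x $ j - x0 $ j)" "\<And>j. vge (s + \<mu>) (a' $ j - b0 $ j)"
      "\<forall>i\<in>I. H i x = 0 \<and> A i x a' = 0" by blast
  have "vge s (x $ j - 1)" for j
  proof -
    have "vge s (x $ j - x0 $ j)" using *(1) by (rule vge_mono) (use \<mu> in simp)
    then show ?thesis using x0 by (rule vge_trans)
  qed
  then show ?thesis using * by (auto simp: b0_def)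
qed

end

section \<open>Tangent spaces of complete intersections\<close>

text \<open>The linear extension of a function \<open>\<phi>\<close> of exponents. Evaluation,
  logarithmic derivatives and coefficient extraction all have this form, so one product formula
  serves for all of them.\<close>

definition evf :: "('m \<Rightarrow> 'k) \<Rightarrow> ('m \<Rightarrow>\<^sub>0 'k::field) \<Rightarrow> 'k" where
  "evf \<phi> f = (\<Sum>w\<in>Poly_Mapping.keys f. Poly_Mapping.lookup f w * \<phi> w)"

lemma evf_superset:
  assumes "finite S" "Poly_Mapping.keys f \<subseteq> S"
  shows "evf \<phi> f = (\<Sum>w\<in>S. Poly_Mapping.lookup f w * \<phi> w)"
  unfolding evf_def using assms by (intro sum.mono_neutral_left) (auto simp: in_keys_iff)

lemma evf_add: "evf \<phi> (f + g) = evf \<phi> f + evf \<phi> g"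
proof -
  let ?S = "Poly_Mapping.keys f \<union> Poly_Mapping.keys g"
  have "Poly_Mapping.keys (f + g) \<subseteq> ?S" by (rule keys_add)
  then show ?thesis
    using evf_superset[of ?S f \<phi>] evf_superset[of ?S g \<phi>] evf_superset[of ?S "f + g" \<phi>]
    by (simp add: lookup_add algebra_simps sum.distrib)
qed

lemma evf_0 [simp]: "evf \<phi> 0 = 0"
  by (simp add: evf_def)

lemma evf_sum: "evf \<phi> (sum F A) = (\<Sum>i\<in>A. evf \<phi> (F i))"
  by (induction A rule: infinite_finite_induct) (auto simp: evf_add)

lemma evf_single [simp]: "evf \<phi> (Poly_Mapping.single w c) = c * \<phi> w"
  by (cases "c = 0") (auto simp: evf_def)

lemma sum_singles: "(\<Sum>w\<in>Poly_Mapping.keys f. Poly_Mapping.single w (Poly_Mapping.lookup f w)) = f"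
proof (rule poly_mapping_eqI)
  fix v
  have "(\<Sum>w\<in>Poly_Mapping.keys f. Poly_Mapping.lookup (Poly_Mapping.single w (Poly_Mapping.lookup f w)) v)
      = (\<Sum>w\<in>Poly_Mapping.keys f. if w = v then Poly_Mapping.lookup f w else 0)"
    by (intro sum.cong) (auto simp: lookup_single when_def)
  then show "Poly_Mapping.lookup (\<Sum>w\<in>Poly_Mapping.keys f. Poly_Mapping.single w (Poly_Mapping.lookup f w)) v
      = Poly_Mapping.lookup f v"
    by (simp add: lookup_sum in_keys_iff)
qed

lemma evf_mult:
  fixes f g :: "'m::cancel_comm_monoid_add \<Rightarrow>\<^sub>0 'k::field"
  shows "evf \<phi> (f * g) = (\<Sum>u\<in>Poly_Mapping.keys f. \<Sum>v\<in>Poly_Mapping.keys g.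
    Poly_Mapping.lookup f u * Poly_Mapping.lookup g v * \<phi> (u + v))"
proof -
  have "f * g = (\<Sum>u\<in>Poly_Mapping.keys f. \<Sum>v\<in>Poly_Mapping.keys g.
      Poly_Mapping.single (u + v) (Poly_Mapping.lookup f u * Poly_Mapping.lookup g v))"
    by (subst sum_singles[of f, symmetric], subst sum_singles[of g, symmetric])
       (simp add: sum_product mult_single)
  then show ?thesis by (simp add: evf_sum)
qed

text \<open>The derivative of \<open>f\<close> at \<open>x\<close> in the direction
  \<open>x * a\<close>.\<close>

definition ldiff :: "('k::field, 'n::finite) laurent \<Rightarrow> 'k ^ 'n \<Rightarrow> 'k ^ 'n \<Rightarrow> 'k" where
  "ldiff f x a = evf (\<lambda>w. lmono x w * ip w a) f"

lemma leval_evf: "leval f x = evf (lmono x) f"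
  by (simp add: leval_def evf_def lmono_def)

lemma leval_mult: "x \<in> torus \<Longrightarrow> leval (f * g) x = leval f x * leval g x"
  unfolding leval_evf evf_mult by (simp add: evf_def lmono_add sum_product mult_ac)

lemma ldiff_mult:
  assumes "x \<in> torus" shows "ldiff (f * g) x a = ldiff f x a * leval g x + leval f x * ldiff g x a"
  unfolding leval_evf ldiff_def evf_mult unfolding evf_def sum_product sum.distrib[symmetric]
  by (intro sum.cong refl) (simp add: lmono_add[OF assms] ip_add_left algebra_simps)

definition hmono :: "'k::field ^ 'n::finite \<Rightarrow> nat ^ 'n \<Rightarrow> 'k" where
  "hmono x w = (\<Prod>j\<in>UNIV. x $ j ^ (w $ j))"

definition hdiff :: "('k::field, 'n::finite) hpoly \<Rightarrow> 'k ^ 'n \<Rightarrow> 'k ^ 'n \<Rightarrow> 'k" where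
  "hdiff F x a = evf (\<lambda>w. hmono x w * (\<Sum>j\<in>UNIV. of_nat (w $ j) * a $ j)) F"

lemma heval_evf: "heval F x = evf (hmono x) F"
  by (simp add: heval_def evf_def hmono_def)

lemma partial_deriv_mult:
  assumes "x \<in> torus"
  shows "heval (partial_deriv j F) x * x $ j = evf (\<lambda>w. hmono x w * of_nat (w $ j)) F"
proof -
  have "of_nat (w $ j) * c * hmono x (w - axis j 1) * x $ j = c * (hmono x w * of_nat (w $ j))" for w c
  proof (cases "w $ j")
    case (Suc m)
    have "hmono x w = x $ j ^ (w $ j) * (\<Prod>i\<in>-{j}. x $ i ^ (w $ i))"
      unfolding hmono_def by (subst prod.remove[of _ j]) (auto simp: Compl_eq_Diff_UNIV)
    moreover have "hmono x (w - axis j 1) = x $ j ^ m * (\<Prod>i\<in>-{j}. x $ i ^ (w $ i))"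
      unfolding hmono_def using Suc
      by (subst prod.remove[of _ j]) (auto simp: Compl_eq_Diff_UNIV axis_def intro!: prod.cong)
    ultimately show ?thesis using Suc by (simp add: algebra_simps)
  qed simp
  then show ?thesis
    unfolding heval_evf partial_deriv_def evf_sum evf_single evf_def[of _ F] sum_distrib_right
    by (intro sum.cong refl) blast
qed

lemma hdiff_partial_deriv:
  assumes "x \<in> torus"
  shows "(\<Sum>j\<in>UNIV. heval (partial_deriv j F) x * (x * a) $ j) = hdiff F x a"
proof -
  have "(\<Sum>j\<in>UNIV. heval (partial_deriv j F) x * (x * a) $ j)
      = (\<Sum>j\<in>UNIV. evf (\<lambda>w. hmono x w * of_nat (w $ j)) F * a $ j)"
    by (simp add: partial_deriv_mult[OF assms, symmetric] mult.assoc)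
  also have "\<dots> = hdiff F x a"
    unfolding evf_def hdiff_def sum_distrib_right sum_distrib_left
    by (subst sum.swap) (simp add: mult_ac)
  finally show ?thesis .
qed

text \<open>Exponents in \<open>char_lattice\<close> sum to \<open>0\<close>, so multiplying by the
  \<open>M\<close>-th power of every coordinate gives a form of degree \<open>CARD('n) * M\<close>.
  It vanishes off the torus, and hence on all of \<open>X\<close> as soon as \<open>f\<close>
  vanishes on \<open>X \<inter> torus\<close>.\<close>

lemma clear_denominators:
  fixes f :: "('k::field, 'n::finite) laurent"
  assumes "f \<in> torus_ring"
  obtains F :: "('k, 'n) hpoly" and M :: nat where "homogeneous F"
    "\<And>x. x \<notin> torus \<Longrightarrow> heval F x = 0"
    "\<And>x. x \<in> torus \<Longrightarrow> heval F x = (\<Prod>j\<in>UNIV. x $ j) ^ M * leval f x"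
    "\<And>x a. x \<in> torus \<Longrightarrow> hdiff F x a =
       (\<Prod>j\<in>UNIV. x $ j) ^ M * (ldiff f x a + of_nat M * (\<Sum>j\<in>UNIV. a $ j) * leval f x)"
proof -
  \<comment> \<open>The \<open>Suc\<close> leaves every coordinate with a positive exponent in every
    term, which makes \<open>F\<close> vanish outside the torus.\<close>
  define M where "M = Suc (\<Sum>w\<in>Poly_Mapping.keys f. \<Sum>j\<in>UNIV. nat \<bar>w $ j\<bar>)"
  have M: "w $ j + int M \<ge> 1" if "w \<in> Poly_Mapping.keys f" for w j
  proof -
    have "nat \<bar>w $ j\<bar> \<le> (\<Sum>j\<in>UNIV. nat \<bar>w $ j\<bar>)" by (rule member_le_sum) auto
    also have "\<dots> \<le> (\<Sum>w\<in>Poly_Mapping.keys f. \<Sum>j\<in>UNIV. nat \<bar>w $ j\<bar>)"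
      using that by (intro member_le_sum[of w]) auto
    finally have "nat \<bar>w $ j\<bar> < M" unfolding M_def by (rule le_imp_less_Suc)
    then show ?thesis by linarith
  qed
  define h where "h w = (\<chi> j. nat (w $ j + int M))" for w :: "int ^ 'n"
  define F where "F = (\<Sum>w\<in>Poly_Mapping.keys f. Poly_Mapping.single (h w) (Poly_Mapping.lookup f w))"
  have evF: "evf \<phi> F = (\<Sum>w\<in>Poly_Mapping.keys f. Poly_Mapping.lookup f w * \<phi> (h w))" for \<phi>
    by (simp add: F_def evf_sum)
  have hm: "hmono x (h w) = (\<Prod>j\<in>UNIV. x $ j) ^ M * lmono x w"
    if "x \<in> torus" "w \<in> Poly_Mapping.keys f" for x :: "'k ^ 'n" and w
  proof -
    have "x $ j ^ nat (w $ j + int M) = x $ j ^ M * x $ j powi (w $ j)" for j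
    proof -
      have "x $ j \<noteq> 0" using that by (auto simp: torus_def)
      then have "x $ j powi (w $ j + int M) = x $ j powi (w $ j) * x $ j powi (int M)"
        by (rule power_int_add[OF disjI1])
      then show ?thesis using M[OF that(2), of j] by (simp add: power_int_def[of _ "w $ j + int M"] mult.commute)
    qed
    then show ?thesis by (simp add: hmono_def h_def lmono_def prod.distrib prod_power_distrib)
  qed
  have "homogeneous F"
    unfolding homogeneous_def
  proof (intro exI ballI)
    fix v assume "v \<in> Poly_Mapping.keys F"
    then have "v \<in> (\<Union>w\<in>Poly_Mapping.keys f. Poly_Mapping.keys (Poly_Mapping.single (h w) (Poly_Mapping.lookup f w)))"
      unfolding F_def by (rule subsetD[OF keys_sum])
    then obtain w where w: "w \<in> Poly_Mapping.keys f" "v = h w" by (auto split: if_splits)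
    have "int (\<Sum>j\<in>UNIV. v $ j) = (\<Sum>j\<in>UNIV. w $ j + int M)"
      unfolding w(2) h_def of_nat_sum
    proof (rule sum.cong[OF refl])
      show "int ((\<chi> j. nat (w $ j + int M)) $ j) = w $ j + int M" for j
        using M[OF w(1), of j] by simp
    qed
    also have "\<dots> = int (CARD('n) * M)"
      using assms w(1) by (auto simp: torus_ring_def char_lattice_def sum.distrib)
    finally show "(\<Sum>j\<in>UNIV. v $ j) = CARD('n) * M" by (simp only: of_nat_eq_iff)
  qed
  moreover have "heval F x = 0" if "x \<notin> torus" for x
  proof -
    from that obtain j where j: "x $ j = 0" by (auto simp: torus_def)
    have "hmono x (h w) = 0" if "w \<in> Poly_Mapping.keys f" for w
      using M[OF that, of j] j by (auto simp: hmono_def h_def intro!: exI[of _ j])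
    then show ?thesis by (simp add: heval_evf evF)
  qed
  moreover have "heval F x = (\<Prod>j\<in>UNIV. x $ j) ^ M * leval f x" if "x \<in> torus" for x
    unfolding heval_evf evF leval_evf evf_def[of _ f] sum_distrib_left
    by (intro sum.cong refl) (simp add: hm[OF that] mult_ac)
  moreover have "hdiff F x a = (\<Prod>j\<in>UNIV. x $ j) ^ M * (ldiff f x a + of_nat M * (\<Sum>j\<in>UNIV. a $ j) * leval f x)"
    if "x \<in> torus" for x a
  proof -
    define S where "S = (\<Sum>j\<in>UNIV. a $ j)"
    have eq: "(\<Sum>j\<in>UNIV. of_nat (h w $ j) * a $ j) = ip w a + of_nat M * S"
      if "w \<in> Poly_Mapping.keys f" for w
    proof -
      have "(of_nat (h w $ j) :: 'k) = of_int (w $ j) + of_nat M" for j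
      proof -
        have "int (h w $ j) = w $ j + int M" using M[OF that, of j] by (simp add: h_def)
        then have "(of_int (int (h w $ j)) :: 'k) = of_int (w $ j + int M)" by simp
        then show ?thesis by simp
      qed
      then show ?thesis by (simp add: ip_def S_def algebra_simps sum.distrib sum_distrib_left)
    qed
    have "hdiff F x a = (\<Sum>w\<in>Poly_Mapping.keys f. Poly_Mapping.lookup f w *
        ((\<Prod>j\<in>UNIV. x $ j) ^ M * lmono x w * (ip w a + of_nat M * S)))"
      unfolding hdiff_def evF by (intro sum.cong refl) (simp only: hm[OF that] eq)
    then show ?thesis
      unfolding leval_evf ldiff_def evf_def[of _ f] S_def[symmetric]
      by (simp add: sum_distrib_left sum.distrib algebra_simps)
  qed
  ultimately show ?thesis using that by blast
qed

text \<open>Divides by the power \<open>D\<close> of one arbitrarily chosen coordinate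
  \<open>j0\<close>. The extra summand in \<open>hdiff\<close> is a multiple of the value of
  \<open>g\<close> and disappears where \<open>F\<close> vanishes.\<close>

lemma dehomogenise:
  fixes F :: "('k::field, 'n::finite) hpoly"
  assumes "homogeneous F"
  obtains g :: "('k, 'n) laurent" and j0 :: 'n and D :: nat where "g \<in> torus_ring"
    "\<And>x. x \<in> torus \<Longrightarrow> heval F x = x $ j0 ^ D * leval g x"
    "\<And>x a. x \<in> torus \<Longrightarrow> hdiff F x a = x $ j0 ^ D * (ldiff g x a + of_nat D * a $ j0 * leval g x)"
proof -
  obtain D where D: "\<And>w. w \<in> Poly_Mapping.keys F \<Longrightarrow> (\<Sum>j\<in>UNIV. w $ j) = D"
    using assms unfolding homogeneous_def by blast
  define j0 :: 'n where "j0 = undefined"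
  define h where "h w = (\<chi> j. int (w $ j) - (if j = j0 then int D else 0))" for w :: "nat ^ 'n"
  define g where "g = (\<Sum>w\<in>Poly_Mapping.keys F. Poly_Mapping.single (h w) (Poly_Mapping.lookup F w))"
  have evg: "evf \<phi> g = (\<Sum>w\<in>Poly_Mapping.keys F. Poly_Mapping.lookup F w * \<phi> (h w))" for \<phi>
    by (simp add: g_def evf_sum)
  have hm: "hmono x w = x $ j0 ^ D * lmono x (h w)" if "x \<in> torus" for x :: "'k ^ 'n" and w
  proof -
    have nz: "x $ j \<noteq> 0" for j using that by (auto simp: torus_def)
    have "x $ j powi (h w $ j) = x $ j ^ (w $ j) * (if j = j0 then x $ j powi (- int D) else 1)" for j
      using power_int_add[OF disjI1[OF nz[of j]], of "int (w $ j)" "- int D"] by (cases "j = j0") (simp_all add: h_def)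
    then have "lmono x (h w) = hmono x w * (\<Prod>j\<in>UNIV. if j = j0 then x $ j powi (- int D) else 1)"
      by (simp add: lmono_def hmono_def prod.distrib)
    also have "\<dots> = hmono x w * x $ j0 powi (- int D)" by simp
    finally show ?thesis using nz[of j0] by (simp add: power_int_minus field_simps)
  qed
  have "g \<in> torus_ring"
    unfolding torus_ring_def
  proof (intro CollectI subsetI)
    fix v assume "v \<in> Poly_Mapping.keys g"
    then have "v \<in> (\<Union>w\<in>Poly_Mapping.keys F. Poly_Mapping.keys (Poly_Mapping.single (h w) (Poly_Mapping.lookup F w)))"
      unfolding g_def by (rule subsetD[OF keys_sum])
    then obtain w where w: "w \<in> Poly_Mapping.keys F" "v = h w" by (auto split: if_splits)
    have "(\<Sum>j\<in>UNIV. v $ j) = int (\<Sum>j\<in>UNIV. w $ j) - int D"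
      by (simp add: w(2) h_def sum_subtractf)
    then show "v \<in> char_lattice" using D[OF w(1)] by (simp add: char_lattice_def)
  qed
  moreover have "heval F x = x $ j0 ^ D * leval g x" if "x \<in> torus" for x
    unfolding heval_evf leval_evf evg evf_def[of _ F] sum_distrib_left
    by (intro sum.cong refl) (simp add: hm[OF that] mult_ac)
  moreover have "hdiff F x a = x $ j0 ^ D * (ldiff g x a + of_nat D * a $ j0 * leval g x)"
    if "x \<in> torus" for x a
  proof -
    have eq: "(\<Sum>j\<in>UNIV. of_nat (w $ j) * a $ j) = ip (h w) a + of_nat D * a $ j0" for w
    proof -
      have "ip (h w) a = (\<Sum>j\<in>UNIV. of_nat (w $ j) * a $ j - (if j = j0 then of_nat D * a $ j else 0))"
        unfolding ip_def h_def by (intro sum.cong) (auto simp: algebra_simps)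
      then show ?thesis by (simp add: sum_subtractf)
    qed
    have "hdiff F x a = (\<Sum>w\<in>Poly_Mapping.keys F. Poly_Mapping.lookup F w *
        (x $ j0 ^ D * lmono x (h w) * (ip (h w) a + of_nat D * a $ j0)))"
      unfolding hdiff_def evf_def[of _ F] by (intro sum.cong refl) (simp only: hm[OF that] eq)
    then show ?thesis
      unfolding leval_evf ldiff_def evg by (simp add: sum_distrib_left sum.distrib algebra_simps)
  qed
  ultimately show ?thesis using that by blast
qed

lemma ldiff_sum: "ldiff (sum F A) x a = (\<Sum>i\<in>A. ldiff (F i) x a)"
  by (simp add: ldiff_def evf_sum)

text \<open>For one direction the denominators of \<open>f i\<close> are cleared to obtain a form
  vanishing on \<open>X\<close>. For the other, a form vanishing on \<open>X\<close> is
  dehomogenised to a member of the ideal generated by the \<open>f i\<close>, and the product rule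
  kills its differential at \<open>P\<close>.\<close>

lemma tangent_space_iff:
  fixes f :: "nat \<Rightarrow> ('k::field, 'n::finite) laurent"
  assumes ci: "torus_complete_intersection n f X" and f: "\<And>i. i \<in> {1..<n} \<Longrightarrow> f i \<in> torus_ring"
    and P: "P \<in> X" "P \<in> torus"
  shows "P * a \<in> tangent_space X P \<longleftrightarrow> (\<forall>i\<in>{1..<n}. ldiff (f i) P a = 0)"
proof -
  have X: "X \<inter> torus = {x \<in> torus. \<forall>i\<in>{1..<n}. x \<in> hypersurface (f i)}"
    using ci by (simp add: torus_complete_intersection_def)
  have ideal: "\<exists>h. g = (\<Sum>i\<in>{1..<n}. h i * f i)" if "g \<in> torus_ring" "\<forall>x\<in>X \<inter> torus. leval g x = 0" for g
    using ci that unfolding torus_complete_intersection_def by blast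
  have fX: "leval (f i) x = 0" if "i \<in> {1..<n}" "x \<in> X" "x \<in> torus" for i x
  proof -
    have "x \<in> X \<inter> torus" using that by blast
    then show ?thesis using that(1) unfolding X hypersurface_def by blast
  qed
  note fP = fX[OF _ P]
  have prodP: "(\<Prod>j\<in>UNIV. P $ j) \<noteq> 0" using P(2) by (simp add: torus_def)
  show ?thesis
  proof
    assume t: "P * a \<in> tangent_space X P"
    show "\<forall>i\<in>{1..<n}. ldiff (f i) P a = 0"
    proof
      fix i assume i: "i \<in> {1..<n}"
      obtain F :: "('k, 'n) hpoly" and M where F: "homogeneous F"
        "\<And>x. x \<notin> torus \<Longrightarrow> heval F x = 0"
        "\<And>x. x \<in> torus \<Longrightarrow> heval F x = (\<Prod>j\<in>UNIV. x $ j) ^ M * leval (f i) x"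
        "\<And>x a. x \<in> torus \<Longrightarrow> hdiff F x a =
          (\<Prod>j\<in>UNIV. x $ j) ^ M * (ldiff (f i) x a + of_nat M * (\<Sum>j\<in>UNIV. a $ j) * leval (f i) x)"
        using clear_denominators[OF f[OF i]] by metis
      have "heval F x = 0" if "x \<in> X" for x
      proof (cases "x \<in> torus")
        case True
        then show ?thesis using F(3)[OF True] fX[OF i that True] by simp
      qed (use F(2) in blast)
      then have "hdiff F P a = 0"
        using t F(1) unfolding tangent_space_def by (simp add: hdiff_partial_deriv[OF P(2), symmetric])
      then show "ldiff (f i) P a = 0" using F(4)[OF P(2)] fP[OF i] prodP by simp
    qed
  next
    assume d: "\<forall>i\<in>{1..<n}. ldiff (f i) P a = 0"
    have "hdiff F P a = 0" if F: "homogeneous F" "\<forall>x\<in>X. heval F x = 0" for F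
    proof -
      obtain g j0 D where g: "g \<in> torus_ring"
        "\<And>x. x \<in> torus \<Longrightarrow> heval F x = x $ j0 ^ D * leval g x"
        "\<And>x a. x \<in> torus \<Longrightarrow> hdiff F x a = x $ j0 ^ D * (ldiff g x a + of_nat D * a $ j0 * leval g x)"
        using dehomogenise[OF F(1)] by metis
      have g0: "leval g x = 0" if "x \<in> X" "x \<in> torus" for x
        using g(2)[OF that(2)] F(2) that by (auto simp: torus_def)
      then obtain h where h: "g = (\<Sum>i\<in>{1..<n}. h i * f i)" using ideal[OF g(1)] by blast
      have "ldiff g P a = 0"
        unfolding h ldiff_sum ldiff_mult[OF P(2)] using d fP by (intro sum.neutral) simp
      then show ?thesis using g(3)[OF P(2)] g0[OF P] by simp
    qed
    then show "P * a \<in> tangent_space X P"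
      unfolding tangent_space_def mem_Collect_eq hdiff_partial_deriv[OF P(2)] by blast
  qed
qed

section \<open>Tangent directions at a vertex\<close>

context valued_field
begin

text \<open>Membership in the maximal ideal. Arguments in the residue field are carried out as
  congruences modulo \<open>vpos\<close>, without forming the quotient.\<close>

definition vpos :: "'k \<Rightarrow> bool" where
  "vpos x \<longleftrightarrow> val x > 0"

lemma vpos_0 [simp]: "vpos 0" by (simp add: vpos_def)

lemma vpos_add: "vpos x \<Longrightarrow> vpos y \<Longrightarrow> vpos (x + y)"
  unfolding vpos_def using val_add[of x y] by (metis min_def less_le_trans)

lemma vpos_minus_iff [simp]: "vpos (- x) \<longleftrightarrow> vpos x"
  by (simp add: vpos_def)

lemma vpos_diff: "vpos x \<Longrightarrow> vpos y \<Longrightarrow> vpos (x - y)"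
  using vpos_add[of x "- y"] by simp

lemma vpos_sum: "(\<And>i. i \<in> A \<Longrightarrow> vpos (f i)) \<Longrightarrow> vpos (sum f A)"
  by (induction A rule: infinite_finite_induct) (auto intro: vpos_add)

lemma vpos_mult: "vge 0 x \<Longrightarrow> vpos y \<Longrightarrow> vpos (x * y)"
  unfolding vpos_def vge_def val_mult
  by (metis add.left_neutral add_mono order_less_le_trans order_refl zero_ereal_def)

lemma vpos_mult': "vpos y \<Longrightarrow> vge 0 x \<Longrightarrow> vpos (y * x)"
  using vpos_mult[of x y] by (simp add: mult.commute)

lemma vpos_cong: "vpos x \<Longrightarrow> vpos (x - y) \<Longrightarrow> vpos y"
  using vpos_diff[of x "x - y"] by simp

lemma vge_vpos: "vge \<mu> x \<Longrightarrow> \<mu> > 0 \<Longrightarrow> vpos x"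
  unfolding vge_def vpos_def by (metis ereal_less(2) order_less_le_trans)

lemma val_0_vge: "val x = 0 \<Longrightarrow> vge 0 x"
  by (simp add: vge_def zero_ereal_def)

lemma val_0_not_vpos: "val x = 0 \<Longrightarrow> \<not> vpos x"
  by (simp add: vpos_def)

lemma vge_0_cases: "vge 0 x \<Longrightarrow> \<not> vpos x \<Longrightarrow> val x = 0"
  by (simp add: vge_def vpos_def zero_ereal_def)

lemma vpos_unit_cancel: assumes "val x = 0" "vpos (x * y)" shows "vpos y"
  using assms by (simp add: vpos_def val_mult)

lemma val_eq_0_cong: assumes "val x = 0" "vpos (y - x)" shows "val y = 0"
  using val_add_eq'[of x y] assms by (simp add: vpos_def)

text \<open>A direction matters only up to scaling and adding multiples of \<open>1\<close>, the
  latter being the direction of the point itself. Dividing by the coordinate difference of least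
  valuation makes all differences integral and one of them \<open>1\<close>.\<close>

lemma normalise_direction:
  fixes a :: "'k ^ 'n"
  assumes "a $ k0 \<noteq> a $ l0"
  obtains c e k l where "c \<noteq> 0" "k \<noteq> l" "\<And>j. vge 0 ((c *s (a - e *s 1)) $ j)"
    "val ((c *s (a - e *s 1)) $ k - (c *s (a - e *s 1)) $ l) = 0"
proof -
  define S where "S = {(k, l). a $ k \<noteq> a $ l}"
  have "finite S" "S \<noteq> {}" using assms by (auto simp: S_def)
  then obtain kl where kl: "kl \<in> S" "\<And>z. z \<in> S \<Longrightarrow>
      val (a $ fst kl - a $ snd kl) \<le> val (a $ fst z - a $ snd z)"
    using ex_min_if_finite[of "(\<lambda>z. val (a $ fst z - a $ snd z)) ` S"]
    by (auto simp: not_less)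
  obtain k l where "kl = (k, l)" by (cases kl)
  with kl have kl: "a $ k \<noteq> a $ l" "\<And>k' l'. a $ k' \<noteq> a $ l' \<Longrightarrow> val (a $ k - a $ l) \<le> val (a $ k' - a $ l')"
    by (auto simp: S_def)
  define z where "z = a $ k - a $ l"
  have z: "z \<noteq> 0" using kl by (simp add: z_def)
  obtain r where r: "val z = ereal r" using val_finite[OF z] .
  have "vge 0 ((inverse z *s (a - a $ l *s 1)) $ j)" for j
  proof (cases "a $ j = a $ l")
    case False
    then obtain s where s: "val (a $ j - a $ l) = ereal s" using val_finite[of "a $ j - a $ l"] by auto
    have "r \<le> s" using kl(2)[OF False] r s by (simp add: z_def)
    moreover have "(inverse z *s (a - a $ l *s 1)) $ j = inverse z * (a $ j - a $ l)"
      by (simp add: algebra_simps)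
    ultimately show ?thesis using s r by (simp only: vge_def val_mult val_inverse[OF z]) simp
  qed simp
  moreover have "(inverse z *s (a - a $ l *s 1)) $ k - (inverse z *s (a - a $ l *s 1)) $ l = 1"
  proof -
    have "(inverse z *s (a - a $ l *s 1)) $ k - (inverse z *s (a - a $ l *s 1)) $ l = inverse z * z"
      unfolding z_def by (simp add: algebra_simps)
    then show ?thesis using z by simp
  qed
  ultimately show ?thesis using that[of "inverse z" k l "a $ l"] z kl(1) by auto
qed

end

lemma ip_one: "w \<in> char_lattice \<Longrightarrow> ip w 1 = 0"
  by (simp add: ip_def char_lattice_def flip: of_int_sum)

locale residue_char_0_field = alg_closed_valued_field val
  for val :: "'k::{alg_closed_field, field_char_0} \<Rightarrow> ereal" +
  assumes val_int: "\<And>m::int. m \<noteq> 0 \<Longrightarrow> val (of_int m) = 0"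
    and nontrivial: "\<exists>x. x \<noteq> 0 \<and> val x \<noteq> 0"
begin

text \<open>Lets rational linear algebra on exponents be reduced modulo the maximal ideal.\<close>

lemma val_rat: assumes "q \<noteq> 0" shows "val (of_rat q) = 0"
proof -
  obtain a b where ab: "quotient_of q = (a, b)" by (cases "quotient_of q")
  then have b: "b > 0" by (rule quotient_of_denom_pos)
  have q: "q = of_int a / of_int b" using quotient_of_div[OF ab] .
  then have a: "a \<noteq> 0" using assms by auto
  show ?thesis using val_divide[of "of_int b" "of_int a"] a b val_int by (simp add: q of_rat_divide)
qed

lemma vge_rat: "vge 0 (of_rat q)"
  by (cases "q = 0") (auto intro: val_0_vge val_rat)

end

text \<open>The members of \<open>T i\<close> are the exponents of \<open>f i\<close>, normalised so that \<open>0\<close> belongs to them and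
  has minimal valuation. The vectors \<open>V (Some i)\<close> are the other exponents of minimal valuation,
  together with a third one, \<open>V None\<close>, for the distinguished index \<open>i0\<close>.\<close>

locale vertex_configuration = residue_char_0_field val
  for val :: "'k::{alg_closed_field, field_char_0} \<Rightarrow> ereal" +
  fixes I :: "nat set" and i0 :: nat and T :: "nat \<Rightarrow> (int ^ 'n::finite) set"
    and V :: "nat option \<Rightarrow> int ^ 'n" and D :: "nat option \<Rightarrow> rat ^ 'n"
    and C :: "'n \<Rightarrow> 'n \<Rightarrow> nat option \<Rightarrow> rat"
  assumes finI: "finite I" and i0: "i0 \<in> I" and finT: "\<And>i. i \<in> I \<Longrightarrow> finite (T i)"
    and T_lattice: "\<And>i. i \<in> I \<Longrightarrow> T i \<subseteq> char_lattice"
    and T_0: "\<And>i. i \<in> I \<Longrightarrow> 0 \<in> T i"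
    and T_V: "\<And>i. i \<in> I \<Longrightarrow> V (Some i) \<in> T i" and V_nz: "\<And>i. i \<in> I \<Longrightarrow> V (Some i) \<noteq> 0"
    and T_None: "V None \<in> T i0" "V None \<noteq> 0" "V None \<noteq> V (Some i0)"
    and V_D: "\<And>p q. p \<in> insert None (Some ` I) \<Longrightarrow> q \<in> insert None (Some ` I) \<Longrightarrow>
        (\<Sum>j\<in>UNIV. of_int (V p $ j) * D q $ j) = (if p = q then 1 else 0)"
    and C_V: "\<And>k l j. (if j = k then 1 else 0) - (if j = l then 1 else 0) =
        (\<Sum>p\<in>insert None (Some ` I). C k l p * of_int (V p $ j))"
    and C_nz: "\<And>k l. k \<noteq> l \<Longrightarrow> C k l (Some i0) \<noteq> 0 \<or> C k l None \<noteq> 0"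
begin

text \<open>\<open>\<gamma> i w\<close> stands for the value of the term with exponent
  \<open>w\<close> at a point over the vertex: terms of minimal valuation are units, the others lie
  in the maximal ideal, and the sum is \<open>0\<close> because the point is on the
  hypersurface.\<close>

definition admissible :: "(nat \<Rightarrow> int ^ 'n \<Rightarrow> 'k) \<Rightarrow> bool" where
  "admissible \<gamma> \<longleftrightarrow> (\<forall>i\<in>I. (\<Sum>w\<in>T i. \<gamma> i w) = 0 \<and> (\<forall>w\<in>T i.
      (w = 0 \<or> w = V (Some i) \<or> i = i0 \<and> w = V None \<longrightarrow> val (\<gamma> i w) = 0) \<and>
      (\<not> (w = 0 \<or> w = V (Some i) \<or> i = i0 \<and> w = V None) \<longrightarrow> vpos (\<gamma> i w))))"

definition L :: "(nat \<Rightarrow> int ^ 'n \<Rightarrow> 'k) \<Rightarrow> nat \<Rightarrow> 'k ^ 'n \<Rightarrow> 'k" where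
  "L \<gamma> i a = (\<Sum>w\<in>T i. \<gamma> i w * ip w a)"

definition minor_terms :: "nat \<Rightarrow> (int ^ 'n) set" where
  "minor_terms i = T i - {0, V (Some i)} - (if i = i0 then {V None} else {})"

definition special_term :: "(nat \<Rightarrow> int ^ 'n \<Rightarrow> 'k) \<Rightarrow> nat \<Rightarrow> (int ^ 'n \<Rightarrow> 'k) \<Rightarrow> 'k" where
  "special_term \<gamma> i g = (if i = i0 then \<gamma> i (V None) * g (V None) else 0)"

lemma sum_T:
  assumes "i \<in> I"
  shows "(\<Sum>w\<in>T i. \<gamma> i w * g w) = \<gamma> i 0 * g 0 + \<gamma> i (V (Some i)) * g (V (Some i))
    + special_term \<gamma> i g + (\<Sum>w\<in>minor_terms i. \<gamma> i w * g w)"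
proof -
  let ?h = "\<lambda>w. \<gamma> i w * g w"
  have "sum ?h (T i) = ?h 0 + sum ?h (T i - {0})"
    using finT[OF assms] T_0[OF assms] by (rule sum.remove)
  also have "sum ?h (T i - {0}) = ?h (V (Some i)) + sum ?h (T i - {0} - {V (Some i)})"
    using finT[OF assms] T_V[OF assms] V_nz[OF assms] by (intro sum.remove) auto
  also have "T i - {0} - {V (Some i)} = T i - {0, V (Some i)}" by blast
  also have "sum ?h (T i - {0, V (Some i)}) = special_term \<gamma> i g + sum ?h (minor_terms i)"
  proof (cases "i = i0")
    case True
    then show ?thesis unfolding minor_terms_def special_term_def
      using finT[OF assms] T_None by (simp, intro sum.remove) auto
  qed (simp add: minor_terms_def special_term_def)
  finally show ?thesis by (simp add: add.assoc)
qed

lemma minor_terms: "admissible \<gamma> \<Longrightarrow> i \<in> I \<Longrightarrow> w \<in> minor_terms i \<Longrightarrow> vpos (\<gamma> i w)"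
  by (auto simp: admissible_def minor_terms_def split: if_splits)

lemma units:
  assumes "admissible \<gamma>" "i \<in> I"
  shows "val (\<gamma> i 0) = 0" "val (\<gamma> i (V (Some i))) = 0" "val (\<gamma> i0 (V None)) = 0"
  using assms T_0[of i] T_V[of i] T_None i0 by (auto simp: admissible_def)

lemma \<gamma>_vge: "admissible \<gamma> \<Longrightarrow> i \<in> I \<Longrightarrow> w \<in> T i \<Longrightarrow> vge 0 (\<gamma> i w)"
  unfolding admissible_def by (metis val_0_vge vge_def vpos_def less_imp_le zero_ereal_def)

lemma minor_sum:
  assumes "admissible \<gamma>" "i \<in> I" "\<And>w. vge 0 (g w)"
  shows "vpos (\<Sum>w\<in>minor_terms i. \<gamma> i w * g w)"
  using assms by (intro vpos_sum vpos_mult' minor_terms)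

lemma L_leading:
  assumes "admissible \<gamma>" "i \<in> I" "\<And>j. vge 0 (a $ j)"
  shows "vpos (L \<gamma> i a - (\<gamma> i (V (Some i)) * ip (V (Some i)) a
     + special_term \<gamma> i (\<lambda>w. ip w a)))"
  using minor_sum[OF assms(1,2), of "\<lambda>w. ip w a"] ip_vge[OF assms(3)]
  unfolding L_def sum_T[OF assms(2), of \<gamma> "\<lambda>w. ip w a"] by simp

lemma sum_leading:
  assumes "admissible \<gamma>"
  shows "vpos (\<gamma> i0 0 + \<gamma> i0 (V (Some i0)) + \<gamma> i0 (V None))"
proof -
  have "(\<Sum>w\<in>T i0. \<gamma> i0 w * 1) = 0" using assms i0 by (simp add: admissible_def)
  moreover have "vpos (\<Sum>w\<in>minor_terms i0. \<gamma> i0 w * 1)"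
    using assms i0 by (intro minor_sum) auto
  ultimately show ?thesis unfolding sum_T[OF i0, of \<gamma> "\<lambda>w. 1"]
    by (simp add: special_term_def eq_neg_iff_add_eq_0[symmetric])
qed

lemma difference_expansion:
  "a $ k - a $ l = (\<Sum>p\<in>insert None (Some ` I). of_rat (C k l p) * ip (V p) a)" for a :: "'k ^ 'n"
proof -
  have "a $ k - a $ l = (\<Sum>j\<in>UNIV. of_rat ((if j = k then 1 else 0) - (if j = l then 1 else 0)) * a $ j)"
    by (simp add: of_rat_diff algebra_simps sum_subtractf if_distrib[of of_rat]
        if_distrib[of "\<lambda>z. _ * z"] cong: if_cong)
  also have "\<dots> = (\<Sum>j\<in>UNIV. \<Sum>p\<in>insert None (Some ` I). of_rat (C k l p) * (of_int (V p $ j) * a $ j))"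
    unfolding C_V by (simp only: of_rat_sum of_rat_mult of_rat_of_int_eq sum_distrib_right mult.assoc)
  also have "\<dots> = (\<Sum>p\<in>insert None (Some ` I). of_rat (C k l p) * ip (V p) a)"
    by (subst sum.swap) (simp add: ip_def sum_distrib_left)
  finally show ?thesis .
qed

text \<open>Modulo the maximal ideal only the leading terms remain: the equations with
  \<open>i \<noteq> i0\<close> become \<open>ip (V (Some i)) a = 0\<close>, and the one at
  \<open>i0\<close> ties together the two remaining components of \<open>a\<close>.\<close>

lemma L_zero_leading:
  assumes "admissible \<gamma>" "\<And>j. vge 0 (a $ j)" "\<And>i. i \<in> I \<Longrightarrow> vpos (L \<gamma> i a)"
  shows "i \<in> I \<Longrightarrow> i \<noteq> i0 \<Longrightarrow> vpos (ip (V (Some i)) a)"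
    and "vpos (\<gamma> i0 (V (Some i0)) * ip (V (Some i0)) a + \<gamma> i0 (V None) * ip (V None) a)"
proof -
  show "vpos (\<gamma> i0 (V (Some i0)) * ip (V (Some i0)) a + \<gamma> i0 (V None) * ip (V None) a)"
    using vpos_cong[OF assms(3)[OF i0] L_leading[OF assms(1) i0 assms(2)]] by (simp add: special_term_def)
  assume i: "i \<in> I" "i \<noteq> i0"
  have "vpos (\<gamma> i (V (Some i)) * ip (V (Some i)) a)"
    using vpos_cong[OF assms(3)[OF i(1)] L_leading[OF assms(1) i(1) assms(2)]] i by (simp add: special_term_def)
  then show "vpos (ip (V (Some i)) a)" by (rule vpos_unit_cancel[OF units(2)[OF assms(1) i(1)]])
qed

lemma difference_leading:
  assumes "\<And>i. i \<in> I \<Longrightarrow> i \<noteq> i0 \<Longrightarrow> vpos (ip (V (Some i)) a)"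
  shows "vpos ((a $ k - a $ l) - (of_rat (C k l (Some i0)) * ip (V (Some i0)) a
     + of_rat (C k l None) * ip (V None) a))"
proof -
  let ?g = "\<lambda>p. of_rat (C k l p) * ip (V p) a"
  have "a $ k - a $ l = ?g None + (\<Sum>i\<in>I. ?g (Some i))"
    unfolding difference_expansion using finI by (subst sum.insert) (auto simp: sum.reindex)
  also have "(\<Sum>i\<in>I. ?g (Some i)) = ?g (Some i0) + (\<Sum>i\<in>I - {i0}. ?g (Some i))"
    using finI i0 by (rule sum.remove)
  finally have "(a $ k - a $ l) - (?g (Some i0) + ?g None) = (\<Sum>i\<in>I - {i0}. ?g (Some i))" by simp
  moreover have "vpos (\<Sum>i\<in>I - {i0}. ?g (Some i))"
    using assms by (intro vpos_sum vpos_mult vge_rat) auto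
  ultimately show ?thesis by simp
qed

text \<open>The components at \<open>Some i0\<close> and \<open>None\<close> are residually
  proportional with unit factors. If one of them vanished, so would all components of
  \<open>a\<close>, and by \<open>difference_leading\<close> also the unit
  \<open>a k - a l\<close>.\<close>

lemma tangent_unit:
  assumes adm: "admissible \<gamma>" and a: "\<And>j. vge 0 (a $ j)" "\<And>i. i \<in> I \<Longrightarrow> vpos (L \<gamma> i a)"
    and kl: "val (a $ k - a $ l) = 0"
  shows "val (ip (V (Some i0)) a) = 0" "val (ip (V None) a) = 0"
proof -
  let ?p = "ip (V (Some i0)) a" and ?q = "ip (V None) a"
  let ?g1 = "\<gamma> i0 (V (Some i0))" and ?g2 = "\<gamma> i0 (V None)"
  note lead = L_zero_leading[OF adm a]
  have o: "vge 0 ?p" "vge 0 ?q" using a(1) by (auto intro: ip_vge)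
  have u: "val ?g1 = 0" "val ?g2 = 0" using units[OF adm i0] by auto
  have pq: "vpos ?p \<longleftrightarrow> vpos ?q"
  proof
    assume "vpos ?p"
    then have "vpos (?g1 * ?p)" using u by (intro vpos_mult val_0_vge)
    from vpos_diff[OF lead(2) this] have "vpos (?g2 * ?q)" by simp
    then show "vpos ?q" by (rule vpos_unit_cancel[OF u(2)])
  next
    assume "vpos ?q"
    then have "vpos (?g2 * ?q)" using u by (intro vpos_mult val_0_vge)
    from vpos_diff[OF lead(2) this] have "vpos (?g1 * ?p)" by simp
    then show "vpos ?p" by (rule vpos_unit_cancel[OF u(1)])
  qed
  have "\<not> vpos ?p"
  proof
    assume p: "vpos ?p"
    then have "vpos ?q" using pq by simp
    with p have "vpos (of_rat (C k l (Some i0)) * ?p + of_rat (C k l None) * ?q)"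
      by (intro vpos_add vpos_mult vge_rat)
    from vpos_add[OF difference_leading[of a k l, OF lead(1)] this] have "vpos (a $ k - a $ l)" by simp
    then show False using kl val_0_not_vpos by blast
  qed
  then show "val ?p = 0" "val ?q = 0" using pq o by (auto intro: vge_0_cases)
qed

text \<open>If \<open>a k\<close> and \<open>a l\<close> agree in the residue field then they are separated at first order: modulo the
  maximal ideal, \<open>a\<close> and its first order variation \<open>b\<close> span the plane orthogonal to
  the \<open>V (Some i)\<close> for \<open>i \<noteq> i0\<close>, on which no difference of coordinates vanishes.\<close>

lemma second_order_unit:
  assumes adm: "admissible \<gamma>" and a: "\<And>j. vge 0 (a $ j)" "\<And>i. i \<in> I \<Longrightarrow> vpos (L \<gamma> i a)"
    and ne: "val (a $ k' - a $ l') = 0"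
    and b: "\<And>j. vge 0 (b $ j)"
    and ab: "\<And>i. i \<in> I \<Longrightarrow> vpos (L \<gamma> i b + (\<Sum>w\<in>T i. \<gamma> i w * (ip w a * ip w a)))"
    and kl: "k \<noteq> l" "vpos (a $ k - a $ l)"
  shows "val (b $ k - b $ l) = 0"
proof -
  define p q p' q' where "p = ip (V (Some i0)) a" and "q = ip (V None) a"
    and "p' = ip (V (Some i0)) b" and "q' = ip (V None) b"
  define g1 g2 where "g1 = \<gamma> i0 (V (Some i0))" and "g2 = \<gamma> i0 (V None)"
  define l1 l2 :: 'k where "l1 = of_rat (C k l (Some i0))" and "l2 = of_rat (C k l None)"
  note lead = L_zero_leading[OF adm a]
  have pq: "val p = 0" "val q = 0" using tangent_unit[OF adm a ne] by (auto simp: p_def q_def)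
  have u: "val g1 = 0" "val g2 = 0" "val (\<gamma> i0 0) = 0" using units[OF adm i0] by (auto simp: g1_def g2_def)
  have o: "vge 0 p" "vge 0 q" "vge 0 p'" "vge 0 q'" "vge 0 g1" "vge 0 g2" "vge 0 l1" "vge 0 l2"
    using a(1) b pq u by (auto simp: p'_def q'_def l1_def l2_def intro: ip_vge val_0_vge vge_rat)
  have ipa: "vge 0 (ip w a)" "vge 0 (ip w b)" for w using a(1) b by (auto intro: ip_vge)
  have quad: "vpos ((\<Sum>w\<in>T i. \<gamma> i w * (ip w a * ip w a)) -
      (\<gamma> i (V (Some i)) * (ip (V (Some i)) a * ip (V (Some i)) a)
        + special_term \<gamma> i (\<lambda>w. ip w a * ip w a)))" if "i \<in> I" for i
    using minor_sum[OF adm that, of "\<lambda>w. ip w a * ip w a"] vge_mult_left[OF ipa(1) ipa(1)]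
    unfolding sum_T[OF that, of \<gamma> "\<lambda>w. ip w a * ip w a"] by simp
  have R: "vpos (\<gamma> i (V (Some i)) * ip (V (Some i)) b + special_term \<gamma> i (\<lambda>w. ip w b)
      + (\<gamma> i (V (Some i)) * (ip (V (Some i)) a * ip (V (Some i)) a)
      + special_term \<gamma> i (\<lambda>w. ip w a * ip w a)))" if "i \<in> I" for i
    by (rule vpos_cong[OF ab[OF that]])
       (use vpos_add[OF L_leading[OF adm that b] quad[OF that]] in \<open>simp add: algebra_simps\<close>)
  have Vb: "vpos (ip (V (Some i)) b)" if i: "i \<in> I" "i \<noteq> i0" for i
  proof -
    have ui: "vge 0 (\<gamma> i (V (Some i)))" using units(2)[OF adm i(1)] by (rule val_0_vge)
    have "vpos (\<gamma> i (V (Some i)) * (ip (V (Some i)) a * ip (V (Some i)) a))"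
      by (intro vpos_mult ui ipa lead(1) i)
    from vpos_diff[OF R[OF i(1)] this] have "vpos (\<gamma> i (V (Some i)) * ip (V (Some i)) b)"
      using i by (simp add: special_term_def)
    then show ?thesis by (rule vpos_unit_cancel[OF units(2)[OF adm i(1)]])
  qed
  have R1: "vpos (g1 * p + g2 * q)" using lead(2) by (simp add: g1_def g2_def p_def q_def)
  have R2: "vpos (l1 * p + l2 * q)"
    using vpos_cong[OF kl(2) difference_leading[of a k l, OF lead(1)]]
    by (simp add: l1_def l2_def p_def q_def)
  have R3: "vpos (g1 * p' + g2 * q' + (g1 * (p * p) + g2 * (q * q)))"
    using R[OF i0] by (simp add: special_term_def g1_def g2_def p_def q_def p'_def q'_def)
  have bkl: "vpos ((b $ k - b $ l) - (l1 * p' + l2 * q'))"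
    using difference_leading[of b k l, OF Vb] by (simp add: l1_def l2_def p'_def q'_def)
  \<comment> \<open>Otherwise, modulo the maximal ideal, \<open>(l1, l2)\<close> and
    \<open>(g1, g2)\<close> both annihilate the vector \<open>(p, q)\<close> of units and are
    proportional. Then \<open>R3\<close> and \<open>R4\<close> force
    \<open>Q = g1 p^2 + g2 q^2\<close> to vanish. With \<open>g1 p = - g2 q\<close> this gives
    \<open>g2 q^2 (g1 + g2) = 0\<close>, so \<open>g1 + g2\<close> vanishes, and with it the unit
    \<open>\<gamma> i0 0\<close>.\<close>
  have "\<not> vpos (l1 * p' + l2 * q')"
  proof
    assume R4: "vpos (l1 * p' + l2 * q')"
    have "vpos (p * (l1 * g2 - l2 * g1))"
      using vpos_diff[OF vpos_mult[OF o(6) R2] vpos_mult[OF o(8) R1]] by (simp add: algebra_simps)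
    then have det: "vpos (l1 * g2 - l2 * g1)" by (rule vpos_unit_cancel[OF pq(1)])
    define Q where "Q = g1 * (p * p) + g2 * (q * q)"
    have "vpos (l1 * (g1 * p' + g2 * q' + Q) - g1 * (l1 * p' + l2 * q') - (l1 * g2 - l2 * g1) * q')"
      unfolding Q_def by (intro vpos_diff[OF vpos_diff] vpos_mult vpos_mult' o R3 R4 det)
    then have Q1: "vpos (l1 * Q)" by (simp add: algebra_simps)
    have "vpos (l2 * (g1 * p' + g2 * q' + Q) - g2 * (l1 * p' + l2 * q') + (l1 * g2 - l2 * g1) * p')"
      unfolding Q_def by (intro vpos_add vpos_diff vpos_mult vpos_mult' o R3 R4 det)
    then have Q2: "vpos (l2 * Q)" by (simp add: algebra_simps)
    \<comment> \<open>Here \<open>C_nz\<close>, the combinatorial form of tameness, enters.\<close>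
    have "val l1 = 0 \<or> val l2 = 0" using C_nz[OF kl(1)] val_rat by (auto simp: l1_def l2_def)
    then have Q: "vpos Q" using vpos_unit_cancel[OF _ Q1] vpos_unit_cancel[OF _ Q2] by blast
    have "vpos (g1 * Q - g1 * p * (g1 * p + g2 * q) + g2 * q * (g1 * p + g2 * q))"
      by (intro vpos_add vpos_diff vpos_mult vge_mult_left o Q R1)
    then have "vpos ((g2 * (q * q)) * (g1 + g2))" unfolding Q_def by (simp add: algebra_simps)
    moreover have "val (g2 * (q * q)) = 0" using u pq by (simp add: val_mult)
    ultimately have "vpos (g1 + g2)" by (rule vpos_unit_cancel[rotated])
    from vpos_diff[OF sum_leading[OF adm] this] have "vpos (\<gamma> i0 0)" by (simp add: g1_def g2_def)
    then show False using u(3) val_0_not_vpos by blast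
  qed
  moreover have "vge 0 (l1 * p' + l2 * q')" using o by (intro vge_add vge_mult_left)
  ultimately have "val (l1 * p' + l2 * q') = 0" by (rule vge_0_cases[rotated])
  then show ?thesis using bkl by (rule val_eq_0_cong)
qed

lemma L_scale: "L \<gamma> i (c *s a) = c * L \<gamma> i a"
  by (simp add: L_def ip_scale sum_distrib_left algebra_simps)

lemma L_diff: "L \<gamma> i (a - b) = L \<gamma> i a - L \<gamma> i b"
  by (simp add: L_def ip_diff algebra_simps sum_subtractf)

lemma L_one: assumes "i \<in> I" shows "L \<gamma> i 1 = 0"
  unfolding L_def
proof (intro sum.neutral ballI)
  fix w assume "w \<in> T i"
  then have "w \<in> char_lattice" using T_lattice[OF assms] by blast
  then show "\<gamma> i w * ip w 1 = 0" by (simp add: ip_one)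
qed

lemma V_lattice: "p \<in> insert None (Some ` I) \<Longrightarrow> V p \<in> char_lattice"
  using T_lattice T_V T_None i0 by (cases p) auto

text \<open>After normalisation \<open>tangent_unit\<close> makes this component a unit. So the
  functional \<open>ip (V (Some i0))\<close> is injective on the kernel modulo constants, which
  bounds the dimension of the kernel by two.\<close>

lemma kernel_direction:
  assumes adm: "admissible \<gamma>" and a: "\<And>i. i \<in> I \<Longrightarrow> L \<gamma> i a = 0" "a $ k0 \<noteq> a $ l0"
  shows "ip (V (Some i0)) a \<noteq> 0"
proof
  assume z: "ip (V (Some i0)) a = 0"
  obtain c e k l where *: "c \<noteq> 0" "k \<noteq> l" "\<And>j. vge 0 ((c *s (a - e *s 1)) $ j)"
    "val ((c *s (a - e *s 1)) $ k - (c *s (a - e *s 1)) $ l) = 0"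
    using normalise_direction[OF a(2)] by metis
  have "L \<gamma> i (c *s (a - e *s 1)) = 0" if "i \<in> I" for i
    unfolding L_scale L_diff L_one[OF that] a(1)[OF that] by simp
  then have "val (ip (V (Some i0)) (c *s (a - e *s 1))) = 0"
    using tangent_unit(1)[OF adm *(3) _ *(4)] by simp
  moreover have "ip (V (Some i0)) (1 :: 'k ^ 'n) = 0" using V_lattice[of "Some i0"] i0 by (simp add: ip_one)
  ultimately show False using z by (simp add: ip_scale ip_diff)
qed

text \<open>The combination \<open>z\<close> of \<open>a\<close> and \<open>b\<close> that is killed
  by the functional of \<open>kernel_direction\<close> must be constant.\<close>

lemma kernel_dimension:
  assumes adm: "admissible \<gamma>" and a: "\<And>i. i \<in> I \<Longrightarrow> L \<gamma> i a = 0" "a $ k0 \<noteq> a $ l0"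
    and b: "\<And>i. i \<in> I \<Longrightarrow> L \<gamma> i b = 0"
  obtains c e where "b = c *s a + e *s 1"
proof -
  let ?v = "ip (V (Some i0))"
  have va: "?v a \<noteq> 0" using kernel_direction[OF adm a] by blast
  define z where "z = ?v a *s b - ?v b *s a"
  have "L \<gamma> i z = 0" if "i \<in> I" for i
    using a(1)[OF that] b[OF that] by (simp add: z_def L_diff L_scale)
  moreover have "?v z = 0" by (simp add: z_def ip_diff ip_scale)
  ultimately have "z $ k = z $ l" for k l using kernel_direction[OF adm, of z k l] by blast
  then obtain e where e: "\<And>k. z $ k = e" by blast
  have "b $ k = (?v b / ?v a) * a $ k + e / ?v a" for k
    using e[of k] va by (simp add: z_def field_simps)
  then have "b = (?v b / ?v a) *s a + (e / ?v a) *s 1" by (simp add: vec_eq_iff)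
  then show ?thesis by (rule that)
qed

text \<open>A difference \<open>a k - a l\<close> of valuation below \<open>s\<close> is too large
  to be affected. Any other lies in the maximal ideal, so \<open>b k - b l\<close> is a unit by
  \<open>second_order_unit\<close> and \<open>t * (b k - b l)\<close> has valuation
  \<open>s\<close>; the choice of \<open>c\<close> excludes cancellation with
  \<open>a k - a l\<close>.\<close>

lemma deformation:
  assumes adm: "admissible \<gamma>" and a: "\<And>j. vge 0 (a $ j)" "\<And>i. i \<in> I \<Longrightarrow> L \<gamma> i a = 0"
    and ne: "val (a $ k' - a $ l') = 0"
    and t0: "val t0 = ereal s" "s > 0"
  shows "\<exists>x a'. (\<forall>j. vge s (x $ j - 1)) \<and>
     (\<forall>i\<in>I. (\<Sum>w\<in>T i. \<gamma> i w * lmono x w) = 0 \<and> (\<Sum>w\<in>T i. \<gamma> i w * lmono x w * ip w a') = 0) \<and>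
     (\<forall>k l. k \<noteq> l \<longrightarrow> val (a' $ k - a' $ l) = min (val (a $ k - a $ l)) (ereal s))"
proof -
  have "finite (\<Union>i\<in>I. \<gamma> i ` minor_terms i)"
    using finI finT by (auto simp: minor_terms_def)
  moreover have "val z > 0" if "z \<in> (\<Union>i\<in>I. \<gamma> i ` minor_terms i)" for z
    using that minor_terms[OF adm] by (auto simp: vpos_def)
  ultimately have "\<exists>\<mu>0>0. \<forall>z\<in>(\<Union>i\<in>I. \<gamma> i ` minor_terms i). vge \<mu>0 z"
    by (rule val_pos_uniform)
  then obtain \<mu>0 where \<mu>0: "\<mu>0 > 0" "\<And>z. z \<in> (\<Union>i\<in>I. \<gamma> i ` minor_terms i) \<Longrightarrow> vge \<mu>0 z"
    by blast
  \<comment> \<open>\<open>\<mu>0\<close> bounds the non-leading terms and hence the failure of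
    \<open>d\<close> to be an exact dual basis; \<open>\<mu> \<le> s\<close> is required by
    \<open>tangent_deformation\<close>.\<close>
  define \<mu> where "\<mu> = min \<mu>0 s"
  have \<mu>: "\<mu> > 0" "\<mu> \<le> s" using \<mu>0 t0 by (auto simp: \<mu>_def)
  have minor: "vge \<mu> (\<gamma> i w)" if "i \<in> I" "w \<in> minor_terms i" for i w
    unfolding \<mu>_def using \<mu>0(2) that by (intro vge_min1) auto
  \<comment> \<open>Rational dual vectors divided by leading coefficients. They are orthogonal to
    \<open>V None\<close>, so the third leading term of the equation \<open>i0\<close> does not
    disturb the duality.\<close>
  define d :: "nat \<Rightarrow> 'k ^ 'n" where
    "d k = (\<chi> j. inverse (\<gamma> k (V (Some k))) * of_rat (D (Some k) $ j))" for k
  have d: "vge 0 (d k $ j)" if "k \<in> I" for k j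
  proof -
    have "val (\<gamma> k (V (Some k))) = 0" by (rule units(2)[OF adm that])
    then have "val (inverse (\<gamma> k (V (Some k)))) = 0" using val_inverse[of "\<gamma> k (V (Some k))"] by force
    then show ?thesis by (simp add: d_def vge_mult_left val_0_vge vge_rat)
  qed
  have ipd: "ip (V p) (d k) = (if p = Some k then inverse (\<gamma> k (V (Some k))) else 0)"
    if "k \<in> I" "p \<in> insert None (Some ` I)" for k p
  proof -
    have "ip (V p) (d k) = inverse (\<gamma> k (V (Some k))) * of_rat (\<Sum>j\<in>UNIV. of_int (V p $ j) * D (Some k) $ j)"
      by (simp add: ip_def d_def of_rat_sum of_rat_mult sum_distrib_left mult_ac)
    then show ?thesis using V_D[OF that(2), of "Some k"] that(1) by simp
  qed
  have dual: "vge \<mu> ((\<Sum>w\<in>T i. \<gamma> i w * ip w (d k)) - (if i = k then 1 else 0))"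
    if ik: "i \<in> I" "k \<in> I" for i k
  proof -
    have "val (\<gamma> k (V (Some k))) = 0" by (rule units(2)[OF adm ik(2)])
    then have nz: "\<gamma> k (V (Some k)) \<noteq> 0" by auto
    have "\<gamma> i (V (Some i)) * ip (V (Some i)) (d k) = (if i = k then 1 else 0)"
      using ipd[OF ik(2), of "Some i"] ik nz by auto
    moreover have "special_term \<gamma> i (\<lambda>w. ip w (d k)) = 0"
      using ipd[OF ik(2), of None] by (simp add: special_term_def)
    ultimately have "(\<Sum>w\<in>T i. \<gamma> i w * ip w (d k)) - (if i = k then 1 else 0)
        = (\<Sum>w\<in>minor_terms i. \<gamma> i w * ip w (d k))"
      unfolding sum_T[OF ik(1), of \<gamma> "\<lambda>w. ip w (d k)"] by simp
    also have "vge \<mu> \<dots>"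
      using minor[OF ik(1)] d[OF ik(2)] by (intro vge_sum vge_mult_right ip_vge) auto
    finally show ?thesis .
  qed
  interpret loc: local_equations val I T \<gamma> d \<mu>
    using finI finT \<gamma>_vge[OF adm] \<mu>(1) d dual by unfold_locales auto
  have A1: "loc.A i 1 v = L \<gamma> i v" for i v by (simp add: loc.A_def L_def)
  have H1: "loc.H i 1 = 0" if "i \<in> I" for i
    using adm that by (simp add: loc.H_def admissible_def)
  define b where "b = loc.second_order a"
  have b: "vge 0 (b $ j)" for j using loc.second_order(1)[OF a(1)] by (simp add: b_def)
  have ab: "vpos (L \<gamma> i b + (\<Sum>w\<in>T i. \<gamma> i w * (ip w a * ip w a)))" if "i \<in> I" for i
    using vge_vpos[OF loc.second_order(2)[OF a(1) that] \<mu>(1)]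
    by (simp add: A1 b_def loc.B_def mult.assoc)
  have unit: "val (b $ k - b $ l) = 0" if "k \<noteq> l" "vpos (a $ k - a $ l)" for k l
    using a by (intro second_order_unit[OF adm a(1) _ ne b ab that]) auto
  have t0nz: "t0 \<noteq> 0" using t0 by auto
  text \<open>Among more multiples of \<open>t0\<close> than there are pairs of coordinates, one avoids cancellation.\<close>
  define bad where "bad p c \<longleftrightarrow> (case p of (k, l) \<Rightarrow> val (b $ k - b $ l) = 0 \<and>
      vpos ((a $ k - a $ l) / t0 + of_nat c * (b $ k - b $ l)))" for p and c :: nat
  have bad_unique: "c = c'" if "bad p c" "bad p c'" for p c c'
  proof (rule ccontr)
    assume ne: "c \<noteq> c'"
    obtain k l where p: "p = (k, l)" by (cases p)
    have "vpos (((a $ k - a $ l) / t0 + of_nat c * (b $ k - b $ l))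
        - ((a $ k - a $ l) / t0 + of_nat c' * (b $ k - b $ l)))"
      using that by (intro vpos_diff) (auto simp: bad_def p)
    then have "vpos (of_int (int c - int c') * (b $ k - b $ l))" by (simp add: algebra_simps)
    moreover have "val (of_int (int c - int c') * (b $ k - b $ l)) = 0"
      using that ne by (simp add: bad_def p val_mult val_int del: of_int_diff)
    ultimately show False using val_0_not_vpos by blast
  qed
  have "\<exists>c>0. \<forall>p. \<not> bad p c"
  proof (rule ccontr)
    assume no: "\<not> ?thesis"
    have "\<forall>c\<in>{1..Suc (card (UNIV :: ('n \<times> 'n) set))}. \<exists>p. bad p c"
    proof
      fix c assume "c \<in> {1..Suc (card (UNIV :: ('n \<times> 'n) set))}"
      then have "c > 0" by simp
      then show "\<exists>p. bad p c" using no by blast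
    qed
    then obtain g where g: "\<And>c. c \<in> {1..Suc (card (UNIV :: ('n \<times> 'n) set))} \<Longrightarrow> bad (g c) c" by metis
    have "inj_on g {1..Suc (card (UNIV :: ('n \<times> 'n) set))}"
      by (rule inj_onI) (metis g bad_unique)
    then have "card {1..Suc (card (UNIV :: ('n \<times> 'n) set))} \<le> card (UNIV :: ('n \<times> 'n) set)"
      by (rule card_inj_on_le) auto
    then show False by simp
  qed
  then obtain c :: nat where c: "c > 0" "\<And>p. \<not> bad p c" by blast
  define t where "t = of_nat c * t0"
  have "val (of_nat c) = 0" using val_int[of "int c"] c(1) by simp
  then have t: "val t = ereal s" using t0 by (simp add: t_def val_mult)
  have "\<exists>x a'. (\<forall>j. vge s (x $ j - 1)) \<and> (\<forall>i\<in>I. loc.H i x = 0 \<and> loc.A i x a' = 0) \<and>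
           (\<forall>j. vge (s + \<mu>) (a' $ j - (a $ j + t * loc.second_order a $ j)))"
    using H1 a A1 t t0(2) \<mu>(2) by (intro loc.tangent_deformation) auto
  then obtain x a' where x: "\<And>j. vge s (x $ j - 1)" "\<And>i. i \<in> I \<Longrightarrow> loc.H i x = 0 \<and> loc.A i x a' = 0"
    and a': "\<And>j. vge (s + \<mu>) (a' $ j - (a $ j + t * b $ j))" unfolding b_def by blast
  have "val (a' $ k - a' $ l) = min (val (a $ k - a $ l)) (ereal s)" if "k \<noteq> l" for k l
  proof -
    define u where "u = a $ k - a $ l"
    define \<beta> where "\<beta> = b $ k - b $ l"
    define z where "z = a' $ k - a' $ l"
    have z: "vge (s + \<mu>) (z - (u + t * \<beta>))"
      using vge_diff[OF a'[of k] a'[of l]] by (simp add: z_def u_def \<beta>_def algebra_simps)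
    have \<beta>: "vge 0 \<beta>" unfolding \<beta>_def using b by (intro vge_diff)
    have "vge s t" using t by (simp add: vge_def)
    then have t\<beta>: "vge s (t * \<beta>)" using \<beta> by (rule vge_mult_right)
    have "vge s (z - (u + t * \<beta>))" using z by (rule vge_mono) (use \<mu> in simp)
    from vge_add[OF this t\<beta>] have zu: "vge s (z - u)" by simp
    show ?thesis
    proof (cases "val u < ereal s")
      case True
      then have "val u < val (z - u)" using zu by (auto simp: vge_def intro: less_le_trans)
      from val_add_eq'[OF this] show ?thesis
        using True min_absorb1[OF less_imp_le[OF True]] by (simp add: z_def u_def)
    next
      case False
      then have us: "ereal s \<le> val u" by simp
      then have "vpos u" using t0(2) by (auto simp: vpos_def intro: less_le_trans[of _ "ereal s"])
      then have unit': "val \<beta> = 0" using unit[OF that] by (simp add: u_def \<beta>_def)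
      have "val (u / t0) = val u - ereal s" using val_divide[OF t0nz, of u] t0 by simp
      then have "vge 0 (u / t0)" using us by (cases "val u") (auto simp: vge_def)
      then have "vge 0 (u / t0 + of_nat c * \<beta>)"
        using \<beta> vge_of_nat by (intro vge_add vge_mult_left)
      moreover have "\<not> vpos (u / t0 + of_nat c * \<beta>)"
        using c(2)[of "(k, l)"] unit' by (auto simp: bad_def u_def \<beta>_def)
      ultimately have "val (u / t0 + of_nat c * \<beta>) = 0" by (rule vge_0_cases)
      then have "val (t0 * (u / t0 + of_nat c * \<beta>)) = ereal s" using t0 by (simp add: val_mult)
      moreover have "t0 * (u / t0 + of_nat c * \<beta>) = u + t * \<beta>"
        using t0nz by (simp add: t_def field_simps)
      ultimately have s: "val (u + t * \<beta>) = ereal s" by simp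
      then have "val (u + t * \<beta>) < ereal (s + \<mu>)" using \<mu>(1) by simp
      also have "\<dots> \<le> val (z - (u + t * \<beta>))" using z by (simp add: vge_def)
      finally have "val z = val (u + t * \<beta>)" by (rule val_add_eq')
      then show ?thesis using s min_absorb2[OF us] by (simp add: z_def u_def)
    qed
  qed
  then show ?thesis using x by (intro exI[of _ x] exI[of _ a']) (auto simp: loc.H_def loc.A_def)
qed

end

section \<open>Rational linear algebra\<close>

lemma matrix_two_sided_inverse:
  fixes M :: "rat ^ 'n ^ 'n"
  assumes "\<And>x. M *v x = 0 \<Longrightarrow> x = 0"
  obtains N where "N ** M = mat 1" "M ** N = mat 1"
proof -
  have "\<exists>N. N ** M = mat 1" unfolding matrix_left_invertible_ker using assms by simp
  then obtain N where N: "N ** M = mat 1" ..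
  moreover have "M ** N = mat 1" using N by (simp only: matrix_left_right_inverse)
  ultimately show ?thesis by (rule that)
qed

text \<open>By \<open>orth\<close> a row of ones completes the vectors \<open>V p\<close> to an
  invertible square matrix. Columns of the inverse give \<open>D\<close>. Differences of its rows
  give \<open>C\<close>, since the column belonging to the ones is constant and drops out.\<close>

lemma dual_basis:
  fixes V :: "'p \<Rightarrow> int ^ 'n::finite"
  assumes J: "finite J" "card J + 1 = CARD('n)" and V: "\<And>p. p \<in> J \<Longrightarrow> V p \<in> char_lattice"
    and orth: "\<And>x :: real ^ 'n. (\<And>p. p \<in> J \<Longrightarrow> (\<Sum>j\<in>UNIV. of_int (V p $ j) * x $ j) = 0) \<Longrightarrow> \<exists>c. x = c *\<^sub>R 1"
  shows "\<exists>(D :: 'p \<Rightarrow> rat ^ 'n) (C :: 'n \<Rightarrow> 'n \<Rightarrow> 'p \<Rightarrow> rat).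
    (\<forall>p\<in>J. \<forall>q\<in>J. (\<Sum>j\<in>UNIV. of_int (V p $ j) * D q $ j) = (if p = q then 1 else 0)) \<and>
    (\<forall>k l j. (if j = k then 1 else 0) - (if j = l then 1 else 0) = (\<Sum>p\<in>J. C k l p * of_int (V p $ j)))"
proof -
  \<comment> \<open>Any index will do: it marks the row of ones, and \<open>h\<close> distributes
    \<open>J\<close> over the other rows.\<close>
  define r0 :: 'n where "r0 = undefined"
  have "card (UNIV - {r0}) = card J" using J(2) by (simp add: card_Diff_singleton)
  then obtain h where h: "bij_betw h J (UNIV - {r0})"
    using J(1) by (metis finite finite_same_card_bij)
  define g where "g = inv_into J h"
  have hJ: "p \<in> J \<Longrightarrow> h p \<noteq> r0" "p \<in> J \<Longrightarrow> g (h p) = p" for p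
    using h bij_betw_apply[OF h] by (auto simp: g_def bij_betw_def)
  define M :: "rat ^ 'n ^ 'n" where "M = (\<chi> r j. if r = r0 then 1 else of_int (V (g r) $ j))"
  have M0: "M $ r0 $ j = 1" and Mp: "p \<in> J \<Longrightarrow> M $ h p $ j = of_int (V p $ j)" for p j
    using hJ by (auto simp: M_def)
  have "x = 0" if x: "M *v x = 0" for x
  proof -
    have row: "(\<Sum>j\<in>UNIV. M $ r $ j * x $ j) = 0" for r
      using arg_cong[OF x, of "\<lambda>v. v $ r"] by (simp add: matrix_vector_mult_def)
    define y :: "real ^ 'n" where "y = (\<chi> j. of_rat (x $ j))"
    have "\<exists>c. y = c *\<^sub>R 1"
    proof (rule orth)
      fix p assume p: "p \<in> J"
      have "(\<Sum>j\<in>UNIV. of_int (V p $ j) * y $ j) = of_rat (\<Sum>j\<in>UNIV. M $ h p $ j * x $ j)"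
        using p by (simp add: Mp y_def of_rat_sum of_rat_mult)
      then show "(\<Sum>j\<in>UNIV. of_int (V p $ j) * y $ j) = 0" by (simp add: row)
    qed
    then obtain c where c: "y = c *\<^sub>R 1" by blast
    have "real CARD('n) * c = of_rat (\<Sum>j\<in>UNIV. M $ r0 $ j * x $ j)"
      using arg_cong[OF c, of "\<lambda>v. \<Sum>j\<in>UNIV. v $ j"] by (simp add: M0 y_def of_rat_sum)
    then have "c = 0" by (simp add: row)
    then have "of_rat (x $ j) = (0 :: real)" for j using arg_cong[OF c, of "\<lambda>v. v $ j"] by (simp add: y_def)
    then show ?thesis by (simp add: vec_eq_iff)
  qed
  then obtain N where N: "N ** M = mat 1" "M ** N = mat 1" by (rule matrix_two_sided_inverse)
  define D where "D q = (\<chi> j. N $ j $ h q)" for q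
  define C where "C k l p = N $ k $ h p - N $ l $ h p" for k l p
  have "(\<Sum>j\<in>UNIV. of_int (V p $ j) * D q $ j) = (if p = q then 1 else 0)" if "p \<in> J" "q \<in> J" for p q
  proof -
    have "(\<Sum>j\<in>UNIV. of_int (V p $ j) * D q $ j) = (M ** N) $ h p $ h q"
      using that by (simp add: matrix_matrix_mult_def Mp D_def)
    then show ?thesis using that h by (auto simp: N mat_def bij_betw_def inj_on_def)
  qed
  moreover have "(if j = k then 1 else 0) - (if j = l then 1 else 0) = (\<Sum>p\<in>J. C k l p * of_int (V p $ j))"
    for k l j
  proof -
    have UN: "UNIV = insert r0 (h ` J)" "r0 \<notin> h ` J" "inj_on h J"
      using h by (auto simp: bij_betw_def)
    have NM: "(if j = k then 1 else 0) = N $ k $ r0 + (\<Sum>p\<in>J. N $ k $ h p * of_int (V p $ j))" for k j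
    proof -
      have "(if j = k then 1 else 0) = (N ** M) $ k $ j" by (simp add: N mat_def)
      also have "\<dots> = (\<Sum>r\<in>insert r0 (h ` J). N $ k $ r * M $ r $ j)"
        by (simp add: matrix_matrix_mult_def flip: UN(1))
      also have "\<dots> = N $ k $ r0 + (\<Sum>p\<in>J. N $ k $ h p * M $ h p $ j)"
        using UN(2,3) J(1) by (simp add: M0 sum.reindex)
      finally show ?thesis by (simp add: Mp)
    qed
    \<comment> \<open>Summing \<open>NM\<close> over \<open>j\<close> removes the exponents, which
      lie in \<open>char_lattice\<close>, and shows this column to be constant.\<close>
    have "N $ k $ r0 * of_nat CARD('n) = 1" for k
    proof -
      have "(1 :: rat) = (\<Sum>j\<in>UNIV. if j = k then 1 else 0)" by simp
      also have "\<dots> = (\<Sum>j\<in>UNIV. N $ k $ r0 + (\<Sum>p\<in>J. N $ k $ h p * of_int (V p $ j)))"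
        by (intro sum.cong refl NM)
      also have "\<dots> = N $ k $ r0 * of_nat CARD('n) + (\<Sum>p\<in>J. N $ k $ h p * (\<Sum>j\<in>UNIV. of_int (V p $ j)))"
        by (simp add: sum.distrib sum_distrib_left sum.swap[of _ _ J])
      also have "(\<Sum>p\<in>J. N $ k $ h p * (\<Sum>j\<in>UNIV. of_int (V p $ j))) = 0"
        using V by (intro sum.neutral) (simp add: char_lattice_def flip: of_int_sum)
      finally show ?thesis by simp
    qed
    from this[of k] this[of l] have "N $ k $ r0 = N $ l $ r0"
      by (metis mult_cancel_right of_nat_eq_0_iff zero_less_card_finite less_numeral_extra(3))
    then show ?thesis unfolding NM[of j k] NM[of j l] C_def
      by (simp add: algebra_simps sum_subtractf)
  qed
  ultimately show ?thesis by (intro exI[of _ D] exI[of _ C] conjI ballI allI)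
qed

lemma common_denominator:
  assumes "finite S" shows "\<exists>N::int. N > 0 \<and> (\<forall>x\<in>S. \<exists>m::int. of_int N * r x = (of_int m :: rat))"
  using assms
proof (induction S)
  case empty
  show ?case by (intro exI[of _ 1]) simp
next
  case (insert x S)
  then obtain N where N: "N > 0" "\<forall>x\<in>S. \<exists>m::int. of_int N * r x = (of_int m :: rat)" by blast
  obtain a b where ab: "quotient_of (r x) = (a, b)" by (cases "quotient_of (r x)")
  have b: "b > 0" "r x = of_int a / of_int b"
    using quotient_of_denom_pos[OF ab] quotient_of_div[OF ab] by auto
  have "\<exists>m::int. of_int (b * N) * r y = (of_int m :: rat)" if y: "y \<in> insert x S" for y
  proof (cases "y = x")
    case True
    have "of_int (b * N) * r y = (of_int (N * a) :: rat)" using b True by simp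
    then show ?thesis by blast
  next
    case False
    then obtain m :: int where "of_int N * r y = (of_int m :: rat)" using N y by blast
    then have "of_int (b * N) * r y = (of_int (b * m) :: rat)" by (simp add: mult.assoc)
    then show ?thesis by blast
  qed
  then show ?case using N(1) b(1) by (intro exI[of _ "b * N"]) auto
qed

text \<open>The integral vectors are obtained from the coordinates with respect to a rational basis of the
  span of the entries of \<open>x\<close>.\<close>

lemma integral_decomposition:
  fixes x :: "real ^ 'n::finite"
  shows "\<exists>(L :: real set) (c :: real \<Rightarrow> real) (y :: real \<Rightarrow> int ^ 'n). finite L \<and>
    (\<forall>j. x $ j = (\<Sum>b\<in>L. c b * of_int (y b $ j))) \<and>
    (\<forall>w :: int ^ 'n. (\<Sum>j\<in>UNIV. of_int (w $ j) * x $ j) = 0 \<longrightarrow> (\<forall>b\<in>L. (\<Sum>j\<in>UNIV. w $ j * y b $ j) = 0))"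
proof -
  interpret rv: vector_space "\<lambda>(q::rat) (z::real). of_rat q * z"
    by unfold_locales (auto simp: algebra_simps of_rat_add of_rat_mult)
  obtain B where B: "B \<subseteq> range (($) x)" "rv.independent B" "range (($) x) \<subseteq> rv.span B"
    using rv.maximal_independent_subset by metis
  have finB: "finite B" by (rule finite_subset[OF B(1)]) simp
  have "\<exists>r. x $ j = (\<Sum>b\<in>B. of_rat (r b) * b)" for j
  proof -
    have "x $ j \<in> rv.span B" using B(3) by blast
    then show ?thesis unfolding rv.span_finite[OF finB] by auto
  qed
  then obtain r where r: "\<And>j. x $ j = (\<Sum>b\<in>B. of_rat (r j b) * b)" by metis
  obtain N where N: "N > 0" "\<And>z. z \<in> UNIV \<times> B \<Longrightarrow> \<exists>m::int. of_int N * r (fst z) (snd z) = (of_int m :: rat)"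
    using common_denominator[of "UNIV \<times> B" "\<lambda>z. r (fst z) (snd z)"] finB by auto
  define m where "m j b = (SOME m::int. of_int N * r j b = (of_int m :: rat))" for j b
  have m: "of_int N * r j b = (of_int (m j b) :: rat)" if "b \<in> B" for j b
  proof -
    have "\<exists>m::int. of_int N * r j b = (of_int m :: rat)" using N(2)[of "(j, b)"] that by simp
    then show ?thesis unfolding m_def by (rule someI_ex)
  qed
  define y :: "real \<Rightarrow> int ^ 'n" where "y b = (\<chi> j. m j b)" for b
  have ry: "of_rat (r j b) = (of_int (y b $ j) :: real) / of_int N" if "b \<in> B" for j b
  proof -
    have "of_rat (of_int N * r j b) = (of_int (m j b) :: real)" unfolding m[OF that] by simp
    then show ?thesis using N(1) by (simp add: y_def of_rat_mult field_simps)
  qed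
  have "x $ j = (\<Sum>b\<in>B. (b / of_int N) * of_int (y b $ j))" for j
    unfolding r by (intro sum.cong refl) (simp add: ry)
  moreover have "\<forall>b\<in>B. (\<Sum>j\<in>UNIV. w $ j * y b $ j) = 0"
    if w: "(\<Sum>j\<in>UNIV. of_int (w $ j) * x $ j) = 0" for w :: "int ^ 'n"
  proof
    fix b assume b: "b \<in> B"
    define q where "q b = (\<Sum>j\<in>UNIV. of_int (w $ j) * r j b)" for b
    have "(\<Sum>b\<in>B. of_rat (q b) * b) = (\<Sum>j\<in>UNIV. of_int (w $ j) * x $ j)"
      unfolding q_def r of_rat_sum of_rat_mult sum_distrib_left sum_distrib_right
      by (subst sum.swap) (simp add: mult.assoc)
    then have "q b = 0" using rv.independentD[OF B(2) finB order_refl _ b] w by simp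
    then have "of_rat (q b) * of_int N = (0 :: real)" by simp
    moreover have "of_rat (q b) * of_int N = (\<Sum>j\<in>UNIV. of_int (w $ j) * (of_int (y b $ j) :: real))"
      using N(1) by (simp add: q_def of_rat_sum of_rat_mult ry[OF b] sum_distrib_right)
    ultimately have "of_int (\<Sum>j\<in>UNIV. w $ j * y b $ j) = (0 :: real)" by simp
    then show "(\<Sum>j\<in>UNIV. w $ j * y b $ j) = 0" by (simp only: of_int_eq_0_iff)
  qed
  ultimately show ?thesis
    using finB by (intro exI[of _ B] exI[of _ "\<lambda>b. b / of_int N"] exI[of _ y] conjI allI impI) simp_all
qed

text \<open>Finitely many hyperplanes do not cover the lattice. If \<open>d\<close> is orthogonal to
  the new \<open>v\<close>, then \<open>N * d + v\<close> is not; and \<open>N\<close> exceeds the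
  products of \<open>v\<close> with the old vectors, which keeps it off the old hyperplanes.\<close>

lemma separating_integer_vector:
  fixes S :: "(int ^ 'n::finite) set"
  assumes "finite S" "0 \<notin> S" shows "\<exists>d::int ^ 'n. \<forall>v\<in>S. (\<Sum>j\<in>UNIV. v $ j * d $ j) \<noteq> 0"
  using assms
proof (induction S)
  case (insert v S)
  then obtain d :: "int ^ 'n" where d: "\<forall>u\<in>S. (\<Sum>j\<in>UNIV. u $ j * d $ j) \<noteq> 0" by auto
  define N where "N = 1 + (\<Sum>u\<in>S. \<bar>\<Sum>j\<in>UNIV. u $ j * v $ j\<bar>)"
  show ?case
  proof (cases "(\<Sum>j\<in>UNIV. v $ j * d $ j) = 0")
    case False
    then show ?thesis using d by auto
  next
    case True
    let ?e = "\<chi> j. N * d $ j + v $ j"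
    have e: "(\<Sum>j\<in>UNIV. u $ j * ?e $ j) = N * (\<Sum>j\<in>UNIV. u $ j * d $ j) + (\<Sum>j\<in>UNIV. u $ j * v $ j)" for u
      by (simp add: algebra_simps sum.distrib sum_distrib_left)
    have "(\<Sum>j\<in>UNIV. v $ j * v $ j) \<noteq> 0"
    proof
      assume "(\<Sum>j\<in>UNIV. v $ j * v $ j) = 0"
      then have "v $ j * v $ j = 0" for j
        using sum_nonneg_eq_0_iff[of UNIV "\<lambda>j. v $ j * v $ j"] by simp
      then show False using insert.prems by (auto simp: vec_eq_iff)
    qed
    moreover have "(\<Sum>j\<in>UNIV. u $ j * ?e $ j) \<noteq> 0" if u: "u \<in> S" for u
    proof -
      define p q where "p = (\<Sum>j\<in>UNIV. u $ j * d $ j)" and "q = (\<Sum>j\<in>UNIV. u $ j * v $ j)"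
      have "\<bar>q\<bar> \<le> (\<Sum>u\<in>S. \<bar>\<Sum>j\<in>UNIV. u $ j * v $ j\<bar>)"
        unfolding q_def using insert.hyps u by (intro member_le_sum) auto
      then have q: "\<bar>q\<bar> < N" by (simp add: N_def)
      have "\<bar>p\<bar> \<ge> 1" using d u by (auto simp: p_def)
      then have "N * 1 \<le> N * \<bar>p\<bar>" using q by (intro mult_left_mono) auto
      then have "\<bar>N * p\<bar> > \<bar>q\<bar>" using q by (simp add: abs_mult)
      then show ?thesis unfolding e p_def[symmetric] q_def[symmetric] by linarith
    qed
    ultimately show ?thesis using e True by (intro exI[of _ ?e]) auto
  qed
qed auto

section \<open>Tropical hypersurfaces near a point\<close>

definition dotp :: "int ^ 'n::finite \<Rightarrow> real ^ 'n \<Rightarrow> real" where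
  "dotp w u = (\<Sum>j\<in>UNIV. of_int (w $ j) * u $ j)"

lemma dotp_diff_left: "dotp (v - w) u = dotp v u - dotp w u"
  by (simp add: dotp_def algebra_simps sum_subtractf)

lemma dotp_add: "dotp w (u + v) = dotp w u + dotp w v"
  by (simp add: dotp_def algebra_simps sum.distrib)

lemma dotp_diff: "dotp w (u - v) = dotp w u - dotp w v"
  by (simp add: dotp_def algebra_simps sum_subtractf)

lemma dotp_scale: "dotp w (c *\<^sub>R u) = c * dotp w u"
  by (simp add: dotp_def sum_distrib_left algebra_simps)

lemma dotp_one: "w \<in> char_lattice \<Longrightarrow> dotp w 1 = 0"
  by (simp add: dotp_def char_lattice_def flip: of_int_sum)

lemma tendsto_dotp: "(dotp w \<longlongrightarrow> dotp w u) (nhds u)"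
  unfolding dotp_def[abs_def] by (intro tendsto_intros filterlim_ident)

lemma term_val_dotp: "term_val val f u w = real_of_ereal (val (Poly_Mapping.lookup f w)) + dotp w u"
  by (simp add: term_val_def dotp_def)

lemma trop_eq_refl [simp]: "trop_eq u u"
  unfolding trop_eq_def by (rule exI[of _ 0]) simp

lemma trop_eq_sym: "trop_eq u v \<Longrightarrow> trop_eq v u"
proof -
  assume "trop_eq u v"
  then obtain c where "u = v + c *\<^sub>R 1" by (auto simp: trop_eq_def)
  then have "v = u + (- c) *\<^sub>R 1" by simp
  then show "trop_eq v u" unfolding trop_eq_def by blast
qed

lemma trop_eq_trans: "trop_eq u v \<Longrightarrow> trop_eq v w \<Longrightarrow> trop_eq u w"
proof -
  assume "trop_eq u v" "trop_eq v w"
  then obtain c d where "u = v + c *\<^sub>R 1" "v = w + d *\<^sub>R 1" by (auto simp: trop_eq_def)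
  then have "u = w + (d + c) *\<^sub>R 1" by (simp add: scaleR_left_distrib)
  then show "trop_eq u w" unfolding trop_eq_def by blast
qed

lemma min_terms_trop_eq:
  assumes "f \<in> torus_ring" "trop_eq u v" shows "min_terms val f u = min_terms val f v"
proof -
  obtain c where c: "u = v + c *\<^sub>R 1" using assms(2) by (auto simp: trop_eq_def)
  have "term_val val f u w = term_val val f v w" if "w \<in> Poly_Mapping.keys f" for w
    using assms(1) that dotp_one[of w] by (auto simp: c term_val_dotp dotp_add dotp_scale torus_ring_def)
  then show ?thesis by (auto simp: min_terms_def)
qed

lemma min_terms_nonempty: assumes "f \<noteq> 0" shows "min_terms val f u \<noteq> {}"
proof -
  have "finite (term_val val f u ` Poly_Mapping.keys f)" "term_val val f u ` Poly_Mapping.keys f \<noteq> {}"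
    using assms by auto
  then obtain w where "w \<in> Poly_Mapping.keys f" "\<forall>w'\<in>Poly_Mapping.keys f. term_val val f u w \<le> term_val val f u w'"
    using ex_min_if_finite[of "term_val val f u ` Poly_Mapping.keys f"] by (auto simp: not_less)
  then show ?thesis by (auto simp: min_terms_def)
qed

lemma min_terms_keys: "min_terms val f u \<subseteq> Poly_Mapping.keys f"
  by (auto simp: min_terms_def)

lemma min_terms_equal: "w \<in> min_terms val f u \<Longrightarrow> w' \<in> min_terms val f u \<Longrightarrow> term_val val f u w = term_val val f u w'"
  by (auto simp: min_terms_def intro: antisym)

lemma min_terms_orth:
  assumes "w \<in> min_terms val f u" "w' \<in> min_terms val f u" "w \<in> min_terms val f v" "w' \<in> min_terms val f v"
  shows "dotp (w - w') (u - v) = 0"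
  using min_terms_equal[OF assms(1,2)] min_terms_equal[OF assms(3,4)]
  by (simp add: term_val_dotp dotp_diff_left dotp_diff)

text \<open>Finitely many strict inequalities between affine functions persist near
  \<open>\<alpha>\<close>.\<close>

lemma min_terms_near: "\<forall>\<^sub>F u in nhds \<alpha>. min_terms val f u \<subseteq> min_terms val f \<alpha>"
proof (cases "f = 0")
  case False
  obtain w0 where w0: "w0 \<in> min_terms val f \<alpha>" using min_terms_nonempty[OF False, of val \<alpha>] by blast
  have "\<forall>\<^sub>F u in nhds \<alpha>. term_val val f u w0 < term_val val f u w"
    if w: "w \<in> Poly_Mapping.keys f - min_terms val f \<alpha>" for w
  proof -
    have "term_val val f \<alpha> w0 < term_val val f \<alpha> w"
    proof (rule ccontr)
      assume "\<not> ?thesis"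
      then have "w \<in> min_terms val f \<alpha>" using w0 w by (auto simp: min_terms_def)
      then show False using w by simp
    qed
    then show ?thesis
    proof -
      have "((\<lambda>u. term_val val f u w - term_val val f u w0) \<longlongrightarrow> term_val val f \<alpha> w - term_val val f \<alpha> w0) (nhds \<alpha>)"
        unfolding term_val_dotp
        by (intro tendsto_intros tendsto_dotp)
      from order_tendstoD(1)[OF this, of 0] show ?thesis
        using \<open>term_val val f \<alpha> w0 < term_val val f \<alpha> w\<close> by simp
    qed
  qed
  then have "\<forall>\<^sub>F u in nhds \<alpha>. \<forall>w\<in>Poly_Mapping.keys f - min_terms val f \<alpha>. term_val val f u w0 < term_val val f u w"
    by (intro eventually_ball_finite) auto
  then show ?thesis
  proof eventually_elim
    case (elim u)
    show ?case
    proof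
      fix w assume w: "w \<in> min_terms val f u"
      then have "\<not> term_val val f u w0 < term_val val f u w"
        using w0 by (auto simp: min_terms_def not_less)
      then show "w \<in> min_terms val f \<alpha>" using elim w by (auto simp: min_terms_def)
    qed
  qed
qed (simp add: min_terms_def)

text \<open>Moving orthogonally to the differences of minimal exponents preserves all ties between
  them.\<close>

lemma min_terms_eqI:
  assumes "f \<noteq> 0" "min_terms val f u \<subseteq> min_terms val f \<alpha>"
    and "\<And>w w'. w \<in> min_terms val f \<alpha> \<Longrightarrow> w' \<in> min_terms val f \<alpha> \<Longrightarrow> dotp (w - w') (u - \<alpha>) = 0"
  shows "min_terms val f u = min_terms val f \<alpha>"
proof
  show "min_terms val f \<alpha> \<subseteq> min_terms val f u"
  proof
    fix w assume w: "w \<in> min_terms val f \<alpha>"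
    obtain w0 where w0: "w0 \<in> min_terms val f u" using min_terms_nonempty[OF assms(1), of val u] by blast
    have "dotp (w - w0) (u - \<alpha>) = 0" using assms(2,3) w w0 by blast
    then have "term_val val f u w = term_val val f u w0"
      using min_terms_equal[OF w subsetD[OF assms(2) w0]]
      by (simp add: term_val_dotp dotp_diff_left dotp_diff)
    then show "w \<in> min_terms val f u" using w w0 by (auto simp: min_terms_def)
  qed
qed (rule assms(2))

section \<open>Lifting points of tropical hypersurfaces\<close>

context residue_char_0_field
begin

lemma val_powi: assumes "x \<noteq> 0" "val x = ereal r" shows "val (x powi m) = ereal (of_int m * r)"
proof (cases "m \<ge> 0")
  case True
  then show ?thesis using assms by (simp add: power_int_def val_power)
next
  case False
  then show ?thesis using assms val_power[of x "nat (- m)"]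
    by (simp add: power_int_def val_inverse power_inverse)
qed

lemma val_trop_point: "x \<in> torus \<Longrightarrow> val (x $ j) = ereal (trop_point val x $ j)"
  using val_real[of "x $ j"] by (simp add: torus_def trop_point_def)

lemma val_lmono:
  assumes "x \<in> torus" shows "val (lmono x w) = ereal (dotp w (trop_point val x))"
proof -
  have "val (\<Prod>j\<in>S. x $ j powi (w $ j)) = ereal (\<Sum>j\<in>S. of_int (w $ j) * trop_point val x $ j)" for S
  proof (induction S rule: infinite_finite_induct)
    case (insert j S)
    have "x $ j \<noteq> 0" using assms by (simp add: torus_def)
    then show ?case using insert val_powi[OF _ val_trop_point[OF assms]] by (simp add: val_mult)
  qed (auto simp: zero_ereal_def)
  then show ?thesis by (simp add: lmono_def dotp_def)
qed

lemma val_term: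
  assumes "x \<in> torus" "w \<in> Poly_Mapping.keys f"
  shows "val (Poly_Mapping.lookup f w * lmono x w) = ereal (term_val val f (trop_point val x) w)"
  using val_real[of "Poly_Mapping.lookup f w"] assms
  by (cases "val (Poly_Mapping.lookup f w)") (auto simp: val_mult val_lmono term_val_dotp in_keys_iff)

lemma val_sum_greater:
  assumes "finite A" "\<And>i. i \<in> A \<Longrightarrow> val (f i) > ereal r" shows "val (sum f A) > ereal r"
  using assms
proof (induction A)
  case (insert i A)
  then have "ereal r < min (val (f i)) (val (sum f A))" by simp
  also have "\<dots> \<le> val (f i + sum f A)" by (rule val_add)
  finally show ?case using insert by simp
qed simp

text \<open>A single term of least valuation could not be cancelled by the others. This is the easy
  half of Kapranov's theorem.\<close>

lemma two_min_terms:
  assumes "x \<in> torus" "leval f x = 0" "f \<noteq> 0"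
  obtains w w' where "w \<noteq> w'" "w \<in> min_terms val f (trop_point val x)" "w' \<in> min_terms val f (trop_point val x)"
proof -
  let ?u = "trop_point val x" and ?K = "Poly_Mapping.keys f"
  let ?t = "\<lambda>w. Poly_Mapping.lookup f w * lmono x w"
  obtain w where w: "w \<in> min_terms val f ?u" using min_terms_nonempty[OF assms(3), of val ?u] by blast
  have "\<exists>w'. w' \<noteq> w \<and> w' \<in> min_terms val f ?u"
  proof (rule ccontr)
    assume no: "\<not> ?thesis"
    have wK: "w \<in> ?K" using w by (simp add: min_terms_def)
    have gt: "val (?t w') > ereal (term_val val f ?u w)" if "w' \<in> ?K - {w}" for w'
    proof -
      have "w' \<notin> min_terms val f ?u" using no that by blast
      then have "term_val val f ?u w < term_val val f ?u w'"
        using w that unfolding min_terms_def by (auto simp: not_le intro: less_le_trans)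
      then show ?thesis using val_term[OF assms(1), of w' f] that by simp
    qed
    have "val (sum ?t (?K - {w})) > ereal (term_val val f ?u w)"
      using gt by (intro val_sum_greater) auto
    then have "val (?t w) < val (sum ?t (?K - {w}))" using val_term[OF assms(1) wK] by simp
    from val_add_eq[OF this] have "val (sum ?t ?K) = val (?t w)"
      using wK by (simp add: sum.remove[of ?K w])
    moreover have "sum ?t ?K = 0" using assms(2) by (simp add: leval_evf evf_def)
    ultimately show False using val_term[OF assms(1) wK] by simp
  qed
  then show ?thesis using that w by blast
qed

text \<open>The Newton polygon of \<open>q\<close> has no horizontal edge, as happens when no root
  has valuation \<open>0\<close>.\<close>

definition isolated_min_coeff :: "'k poly \<Rightarrow> bool" where
  "isolated_min_coeff q \<longleftrightarrow> (\<exists>i r. val (coeff q i) = ereal r \<and> (\<forall>j. j \<noteq> i \<longrightarrow> val (coeff q j) > ereal r))"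

text \<open>One coefficient of the linear factor dominates. For \<open>val x > 0\<close> it is the
  leading one, and the minimum moves to the next index; for \<open>val x < 0\<close> it is the
  constant one, and the minimum keeps its index and changes by \<open>val x\<close>.\<close>

lemma isolated_min_coeff_mult:
  assumes "isolated_min_coeff q" "val x \<noteq> 0" shows "isolated_min_coeff ([:- x, 1:] * q)"
proof -
  obtain i r where ir: "val (coeff q i) = ereal r" "\<And>j. j \<noteq> i \<Longrightarrow> val (coeff q j) > ereal r"
    using assms(1) by (auto simp: isolated_min_coeff_def)
  have all: "val (coeff q j) \<ge> ereal r" for j using ir by (cases "j = i") (auto intro: less_imp_le)
  have c: "coeff ([:- x, 1:] * q) j = (case j of 0 \<Rightarrow> 0 | Suc m \<Rightarrow> coeff q m) - x * coeff q j" for j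
    by (simp add: coeff_pCons split: nat.split)
  show ?thesis
  proof (cases "val x > 0")
    case True
    have big: "val (x * coeff q j) > ereal r" for j
      using True all[of j] by (cases "val x"; cases "val (coeff q j)") (auto simp: val_mult)
    have "val (coeff ([:- x, 1:] * q) (Suc i)) = ereal r"
      using val_add_eq[of "coeff q i" "- (x * coeff q (Suc i))"] big[of "Suc i"] ir(1) by (simp add: c)
    moreover have "val (coeff ([:- x, 1:] * q) j) > ereal r" if "j \<noteq> Suc i" for j
    proof -
      have "val (case j of 0 \<Rightarrow> 0 | Suc m \<Rightarrow> coeff q m) > ereal r"
        using ir(2) that by (auto split: nat.split)
      then have "ereal r < min (val (case j of 0 \<Rightarrow> 0 | Suc m \<Rightarrow> coeff q m)) (val (- (x * coeff q j)))"
        using big[of j] by simp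
      also have "\<dots> \<le> val (coeff ([:- x, 1:] * q) j)" unfolding c
        using val_add[of "case j of 0 \<Rightarrow> 0 | Suc m \<Rightarrow> coeff q m" "- (x * coeff q j)"] by simp
      finally show ?thesis .
    qed
    ultimately show ?thesis unfolding isolated_min_coeff_def by blast
  next
    case False
    then have "val x < 0" using assms(2) by simp
    moreover from False have "x \<noteq> 0" by auto
    then obtain s' where "val x = ereal s'" by (rule val_finite)
    ultimately have s': "val x = ereal s'" "s' < 0" by simp_all
    define s where "s = - s'"
    have s: "val x = ereal (- s)" "s > 0" using s' by (auto simp: s_def)
    have low: "val (case j of 0 \<Rightarrow> 0 | Suc m \<Rightarrow> coeff q m) > ereal (r - s)" for j
    proof -
      have "ereal (r - s) < ereal r" using s by simp
      also have "\<dots> \<le> val (case j of 0 \<Rightarrow> 0 | Suc m \<Rightarrow> coeff q m)" using all by (auto split: nat.split)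
      finally show ?thesis .
    qed
    have vi: "val (- (x * coeff q i)) = ereal (r - s)" using s ir(1) by (simp add: val_mult)
    have "val (coeff ([:- x, 1:] * q) i) = ereal (r - s)"
      using val_add_eq[of "- (x * coeff q i)" "case i of 0 \<Rightarrow> 0 | Suc m \<Rightarrow> coeff q m"] low[of i] vi
      unfolding c by (simp add: add.commute)
    moreover have "val (coeff ([:- x, 1:] * q) j) > ereal (r - s)" if "j \<noteq> i" for j
    proof -
      have "val (- (x * coeff q j)) > ereal (r - s)"
        using ir(2)[OF that] s by (cases "val (coeff q j)") (auto simp: val_mult)
      then have "ereal (r - s) < min (val (case j of 0 \<Rightarrow> 0 | Suc m \<Rightarrow> coeff q m)) (val (- (x * coeff q j)))"
        using low[of j] by simp
      also have "\<dots> \<le> val (coeff ([:- x, 1:] * q) j)" unfolding c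
        using val_add[of "case j of 0 \<Rightarrow> 0 | Suc m \<Rightarrow> coeff q m" "- (x * coeff q j)"] by simp
      finally show ?thesis .
    qed
    ultimately show ?thesis unfolding isolated_min_coeff_def by blast
  qed
qed

text \<open>If no root had valuation \<open>0\<close>, building \<open>q\<close> up from a constant
  by \<open>isolated_min_coeff_mult\<close> would make the minimum unique, but it is attained at
  \<open>i\<close> and \<open>j\<close>.\<close>

lemma unit_root:
  assumes "i \<noteq> j" "val (coeff q i) = ereal r" "val (coeff q j) = ereal r" "\<And>k. val (coeff q k) \<ge> ereal r"
  shows "\<exists>x. poly q x = 0 \<and> val x = 0"
proof (rule ccontr)
  assume no: "\<not> ?thesis"
  have "q \<noteq> 0" using assms(2) by auto
  then obtain A where A: "size A = degree q" "q = smult (lead_coeff q) (\<Prod>x\<in>#A. [:-x, 1:])"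
    using alg_closed_imp_factorization by blast
  have root: "poly q x = 0" if "x \<in># A" for x
    by (subst A(2)) (use that in \<open>auto simp: poly_prod_mset image_mset.compositionality o_def prod_mset_zero_iff\<close>)
  have "isolated_min_coeff (smult c (\<Prod>x\<in>#B. [:-x, 1:]))" if "B \<subseteq># A" and c0: "c \<noteq> 0" for B c
    using that(1)
  proof (induction B)
    case empty
    obtain s where "val c = ereal s" using val_finite[OF c0] .
    then show ?case unfolding isolated_min_coeff_def by (rule_tac exI[of _ "0::nat"], rule_tac exI[of _ s]) (auto simp: coeff_pCons split: nat.split)
  next
    case (add x B)
    have "x \<in># A" using add.prems by (meson insert_subset_eq_iff)
    then have "val x \<noteq> 0" using no root by blast
    moreover have "isolated_min_coeff (smult c (\<Prod>x\<in>#B. [:-x, 1:]))"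
      using add.prems by (intro add.IH) (meson mset_subset_eq_insertD subset_mset.less_imp_le)
    ultimately have "isolated_min_coeff ([:- x, 1:] * smult c (\<Prod>x\<in>#B. [:-x, 1:]))"
      by (rule isolated_min_coeff_mult[rotated])
    then show ?case by (simp only: image_mset_add_mset prod_mset.add_mset mult_smult_right)
  qed
  from this[of A "lead_coeff q"] have "isolated_min_coeff q" using \<open>q \<noteq> 0\<close> A(2) by simp
  then obtain k s where ks: "val (coeff q k) = ereal s" "\<And>j. j \<noteq> k \<Longrightarrow> val (coeff q j) > ereal s"
    by (auto simp: isolated_min_coeff_def)
  have "ereal r \<le> ereal s" using assms(4)[of k] ks(1) by simp
  moreover have "ereal s < ereal r" using ks(2)[of i] ks(2)[of j] assms(1-3) by (cases "i = k") auto
  ultimately show False by simp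
qed

text \<open>Along the one-parameter subgroup \<open>l powi (d $ j)\<close> the equation becomes a
  polynomial in \<open>l\<close>. For \<open>d\<close> separating the exponents of \<open>f\<close>
  no terms merge, so two coefficients share the least valuation, and a root \<open>l\<close> of
  valuation \<open>0\<close> moves \<open>x\<close> onto the hypersurface without changing its
  tropicalisation.\<close>

lemma kapranov:
  fixes x :: "'k ^ 'n::finite"
  assumes x: "x \<in> torus" and w: "w1 \<noteq> w2" "w1 \<in> min_terms val f (trop_point val x)"
    "w2 \<in> min_terms val f (trop_point val x)"
  shows "\<exists>x'\<in>hypersurface f. trop_point val x' = trop_point val x"
proof -
  let ?K = "Poly_Mapping.keys f" and ?u = "trop_point val x"
  have "finite ((\<lambda>(v, w). v - w) ` (?K \<times> ?K) - {0})" by simp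
  then obtain d :: "int ^ 'n" where
    d: "\<forall>v\<in>(\<lambda>(v, w). v - w) ` (?K \<times> ?K) - {0}. (\<Sum>j\<in>UNIV. v $ j * d $ j) \<noteq> 0"
    using separating_integer_vector by blast
  define e where "e w = (\<Sum>j\<in>UNIV. w $ j * d $ j)" for w
  have e_inj: "v = w" if "v \<in> ?K" "w \<in> ?K" "e v = e w" for v w
  proof (rule ccontr)
    assume "v \<noteq> w"
    then have "v - w \<in> (\<lambda>(v, w). v - w) ` (?K \<times> ?K) - {0}" using that by force
    then have "(\<Sum>j\<in>UNIV. (v - w) $ j * d $ j) \<noteq> 0" using d by blast
    then show False using that(3) by (simp add: e_def algebra_simps sum_subtractf)
  qed
  \<comment> \<open>Shifts the powers of \<open>l\<close> to nonnegative ones.\<close>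
  define M where "M = (\<Sum>w\<in>?K. \<bar>e w\<bar>)"
  have M: "e w + M \<ge> 0" if "w \<in> ?K" for w
  proof -
    have "\<bar>e w\<bar> \<le> M" unfolding M_def using that by (intro member_le_sum) auto
    then show ?thesis by linarith
  qed
  define t where "t w = Poly_Mapping.lookup f w * lmono x w" for w
  define q where "q = (\<Sum>w\<in>?K. monom (t w) (nat (e w + M)))"
  have cq: "coeff q k = (\<Sum>w\<in>?K. if nat (e w + M) = k then t w else 0)" for k
    by (simp add: q_def coeff_sum)
  have cw: "coeff q (nat (e w + M)) = t w" if w: "w \<in> ?K" for w
  proof -
    have "coeff q (nat (e w + M)) = (\<Sum>v\<in>?K. if v = w then t v else 0)"
      unfolding cq
    proof (rule sum.cong[OF refl])
      fix v assume v: "v \<in> ?K"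
      have "nat (e v + M) = nat (e w + M) \<longleftrightarrow> v = w"
        using M[OF v] M[OF w] e_inj[OF v w] by (auto simp: nat_eq_iff)
      then show "(if nat (e v + M) = nat (e w + M) then t v else 0) = (if v = w then t v else 0)" by simp
    qed
    then show ?thesis using w by simp
  qed
  have wK: "w1 \<in> ?K" "w2 \<in> ?K" using w by (auto simp: min_terms_def)
  define r where "r = term_val val f ?u w1"
  have tr: "val (t w) \<ge> ereal r" if "w \<in> ?K" for w
    using val_term[OF x that] w that by (auto simp: t_def r_def min_terms_def)
  have "\<exists>l. poly q l = 0 \<and> val l = 0"
  proof (rule unit_root)
    show "nat (e w1 + M) \<noteq> nat (e w2 + M)"
      using e_inj[OF wK] w(1) M[OF wK(1)] M[OF wK(2)] by (auto simp: nat_eq_iff)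
    show "val (coeff q (nat (e w1 + M))) = ereal r"
      using val_term[OF x wK(1)] by (simp add: cw[OF wK(1)] t_def r_def)
    show "val (coeff q (nat (e w2 + M))) = ereal r"
      using val_term[OF x wK(2)] min_terms_equal[OF w(2,3)] by (simp add: cw[OF wK(2)] t_def r_def)
    show "val (coeff q k) \<ge> ereal r" for k
    proof (cases "\<exists>w\<in>?K. nat (e w + M) = k")
      case True
      then show ?thesis using cw tr by auto
    next
      case False
      then have "coeff q k = 0" unfolding cq by (intro sum.neutral) auto
      then show ?thesis by simp
    qed
  qed
  then obtain l where l: "poly q l = 0" "val l = 0" by blast
  have l0: "l \<noteq> 0" using l(2) by auto
  define x' where "x' = (\<chi> j. x $ j * l powi (d $ j))"
  have "x' \<in> torus" using x l0 by (simp add: torus_def x'_def)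
  moreover have "leval f x' = 0"
  proof -
    have lm: "lmono x' w = lmono x w * l powi (e w)" for w
    proof -
      have "(\<Prod>j\<in>S. l powi (d $ j * w $ j)) = l powi (\<Sum>j\<in>S. w $ j * d $ j)" for S
        using l0 by (induction S rule: infinite_finite_induct) (auto simp: power_int_add mult.commute)
      then show ?thesis
        by (simp add: lmono_def x'_def power_int_mult_distrib prod.distrib e_def flip: power_int_mult)
    qed
    have "leval f x' * l powi M = (\<Sum>w\<in>?K. t w * l ^ nat (e w + M))"
      unfolding leval_evf evf_def sum_distrib_right
    proof (rule sum.cong[OF refl])
      fix w assume "w \<in> ?K"
      then have "l ^ nat (e w + M) = l powi (e w) * l powi M"
        using M l0 by (simp add: power_int_def[of l "e w + M", symmetric] power_int_add[symmetric] flip: power_int_of_nat)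
      then show "Poly_Mapping.lookup f w * lmono x' w * l powi M = t w * l ^ nat (e w + M)"
        by (simp add: lm t_def)
    qed
    also have "\<dots> = 0" using l(1) by (simp add: q_def poly_sum poly_monom)
    finally show ?thesis using l0 by simp
  qed
  moreover have "trop_point val x' = trop_point val x"
    using val_powi[OF l0, of 0] l(2) by (simp add: trop_point_def x'_def val_mult vec_eq_iff zero_ereal_def)
  ultimately show ?thesis by (auto simp: hypersurface_def)
qed

text \<open>The value group is nonzero, and it is divisible because \<open>n\<close>-th roots exist;
  a sufficiently small \<open>g / n\<close> has a multiple near \<open>r\<close>.\<close>

lemma value_group_dense:
  assumes "e > 0" shows "\<exists>\<rho> v. \<rho> \<noteq> 0 \<and> val \<rho> = ereal v \<and> \<bar>v - r\<bar> < e"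
proof -
  obtain z where z: "z \<noteq> 0" "val z \<noteq> 0" using nontrivial by blast
  obtain g where g: "val z = ereal g" using val_finite[OF z(1)] .
  have g0: "g \<noteq> 0" using z(2) g by (auto simp: zero_ereal_def)
  obtain n :: nat where n: "real n * e > \<bar>g\<bar>" using reals_Archimedean3[OF assms] by blast
  have n0: "n > 0"
  proof (rule ccontr)
    assume "\<not> n > 0"
    then show False using n by simp
  qed
  obtain y where y: "y ^ n = z" using nth_root_exists[OF n0] by blast
  have y0: "y \<noteq> 0" using y z(1) n0 by auto
  obtain h where h: "val y = ereal h" using val_finite[OF y0] .
  have gh: "g = real n * h" using val_power[of y n] y g h by simp
  have h0: "h \<noteq> 0" using g0 gh by auto
  have "real n * \<bar>h\<bar> < real n * e" using n gh by (simp add: abs_mult)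
  then have he: "\<bar>h\<bar> < e" using n0 by simp
  define m where "m = \<lfloor>r / h\<rfloor>"
  have "\<bar>of_int m * h - r\<bar> = \<bar>h\<bar> * \<bar>of_int m - r / h\<bar>"
    using h0 by (simp add: abs_mult[symmetric] algebra_simps)
  also have "\<dots> \<le> \<bar>h\<bar> * 1" unfolding m_def by (intro mult_left_mono) linarith+
  finally have "\<bar>of_int m * h - r\<bar> < e" using he by simp
  then show ?thesis using y0 val_powi[OF y0 h, of m]
    by (intro exI[of _ "y powi m"] exI[of _ "of_int m * h"]) simp
qed

lemma trop_memI:
  assumes "x \<in> Y" "x \<in> torus" "trop_eq u (trop_point val x)" shows "u \<in> trop val Y"
proof -
  have "u \<in> {u. \<exists>x\<in>Y \<inter> torus. trop_eq u (trop_point val x)}" using assms by auto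
  then show ?thesis unfolding trop_def by (rule subsetD[OF closure_subset])
qed

text \<open>The coordinates of \<open>u\<close> need not lie in the value group, and approximations
  must keep the ties at \<open>\<alpha>\<close> exactly. So \<open>u - \<alpha>\<close> is
  decomposed into integer vectors orthogonal to the same exponent differences, and only their real
  coefficients are approximated; \<open>kapranov\<close> lifts the resulting points.\<close>

lemma trop_hypersurface_near:
  fixes \<alpha> :: "real ^ 'n::finite"
  assumes P: "P \<in> torus" "trop_eq \<alpha> (trop_point val P)" and f: "f \<in> torus_ring" "f \<noteq> 0"
    and two: "w1 \<noteq> w2" "w1 \<in> min_terms val f \<alpha>" "w2 \<in> min_terms val f \<alpha>"
  shows "\<forall>\<^sub>F u in nhds \<alpha>. (\<forall>w\<in>min_terms val f \<alpha>. \<forall>w'\<in>min_terms val f \<alpha>. dotp (w - w') (u - \<alpha>) = 0) \<longrightarrow>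
      u \<in> trop val (hypersurface f) \<and> min_terms val f u = min_terms val f \<alpha>"
proof -
  obtain S where S: "open S" "\<alpha> \<in> S" "\<And>u. u \<in> S \<Longrightarrow> min_terms val f u \<subseteq> min_terms val f \<alpha>"
    using min_terms_near[of val f \<alpha>] unfolding eventually_nhds by blast
  have "u \<in> trop val (hypersurface f) \<and> min_terms val f u = min_terms val f \<alpha>"
    if u: "u \<in> S" and orth: "\<forall>w\<in>min_terms val f \<alpha>. \<forall>w'\<in>min_terms val f \<alpha>. dotp (w - w') (u - \<alpha>) = 0" for u
  proof
    show "min_terms val f u = min_terms val f \<alpha>"
      using orth by (intro min_terms_eqI f S(3) u) auto
    from integral_decomposition[of "u - \<alpha>"]
    obtain B :: "real set" and c and y :: "real \<Rightarrow> int ^ 'n" where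
      B: "finite B" "\<And>j. (u - \<alpha>) $ j = (\<Sum>b\<in>B. c b * of_int (y b $ j))"
      "\<And>w :: int ^ 'n. (\<Sum>j\<in>UNIV. of_int (w $ j) * (u - \<alpha>) $ j) = 0 \<Longrightarrow> \<forall>b\<in>B. (\<Sum>j\<in>UNIV. w $ j * y b $ j) = 0"
      by blast
    have *: "\<exists>u'\<in>{u. \<exists>x\<in>hypersurface f \<inter> torus. trop_eq u (trop_point val x)}. dist u' u < e" if "e > 0" for e
    proof -
      obtain e' where e': "e' > 0" "ball u e' \<subseteq> S" using S(1) u open_contains_ball by blast
      define e1 where "e1 = min e e'"
      define N where "N = 1 + (\<Sum>j\<in>UNIV. \<Sum>b\<in>B. \<bar>real_of_int (y b $ j)\<bar>)"
      have N: "N > 0" unfolding N_def by (simp add: add_pos_nonneg sum_nonneg)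
      have "\<exists>\<rho> v. \<rho> \<noteq> 0 \<and> val \<rho> = ereal v \<and> \<bar>v - c b\<bar> < e1 / N" for b
        using \<open>e > 0\<close> e'(1) N by (intro value_group_dense) (simp add: e1_def)
      then obtain \<rho> v where \<rho>: "\<And>b. \<rho> b \<noteq> 0" "\<And>b. val (\<rho> b) = ereal (v b)" "\<And>b. \<bar>v b - c b\<bar> < e1 / N"
        by metis
      \<comment> \<open>Multiplication by these powers moves the tropicalisation of \<open>P\<close>
        by \<open>\<delta>\<close>, which is close to \<open>u - \<alpha>\<close>.\<close>
      define Q where "Q = (\<chi> j. P $ j * (\<Prod>b\<in>B. \<rho> b powi (y b $ j)))"
      define \<delta> where "\<delta> = (\<chi> j. \<Sum>b\<in>B. v b * of_int (y b $ j))"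
      have Q: "Q \<in> torus" using P(1) B(1) \<rho>(1) by (simp add: torus_def Q_def)
      have tQ: "trop_point val Q = trop_point val P + \<delta>"
      proof (subst vec_eq_iff, rule allI)
        fix j
        have "val (\<Prod>b\<in>A. \<rho> b powi (y b $ j)) = ereal (\<Sum>b\<in>A. v b * of_int (y b $ j))" for A
          by (induction A rule: infinite_finite_induct)
             (auto simp: val_mult val_powi[OF \<rho>(1,2)] mult.commute zero_ereal_def)
        then have "val (Q $ j) = ereal (trop_point val P $ j + \<delta> $ j)"
          using val_trop_point[OF P(1), of j] by (simp add: Q_def \<delta>_def val_mult)
        then show "trop_point val Q $ j = (trop_point val P + \<delta>) $ j"
          using val_trop_point[OF Q, of j] by simp
      qed
      have "\<bar>(\<alpha> + \<delta> - u) $ j\<bar> \<le> (e1 / N) * (\<Sum>b\<in>B. \<bar>real_of_int (y b $ j)\<bar>)" for j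
      proof -
        have "(\<alpha> + \<delta> - u) $ j = (\<Sum>b\<in>B. (v b - c b) * of_int (y b $ j))"
          using B(2)[of j] by (simp add: \<delta>_def algebra_simps sum_subtractf)
        also have "\<bar>\<dots>\<bar> \<le> (\<Sum>b\<in>B. \<bar>(v b - c b) * of_int (y b $ j)\<bar>)" by (rule sum_abs)
        also have "\<dots> \<le> (\<Sum>b\<in>B. (e1 / N) * \<bar>real_of_int (y b $ j)\<bar>)"
          unfolding abs_mult using \<rho>(3) by (intro sum_mono mult_right_mono) (auto intro: less_imp_le)
        finally show ?thesis by (simp add: sum_distrib_left)
      qed
      then have "(\<Sum>j\<in>UNIV. \<bar>(\<alpha> + \<delta> - u) $ j\<bar>) \<le> (\<Sum>j\<in>UNIV. (e1 / N) * (\<Sum>b\<in>B. \<bar>real_of_int (y b $ j)\<bar>))"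
        by (intro sum_mono)
      also have "\<dots> = (e1 / N) * (N - 1)" by (simp add: N_def sum_distrib_left)
      also have "\<dots> = e1 - e1 / N" using N by (simp add: field_simps)
      also have "\<dots> < e1"
      proof -
        have "e1 > 0" using \<open>e > 0\<close> e'(1) by (simp add: e1_def)
        then show ?thesis using N by simp
      qed
      finally have close: "dist (\<alpha> + \<delta>) u < e1"
        using norm_le_l1_cart[of "\<alpha> + \<delta> - u"] by (simp add: dist_norm)
      then have "\<alpha> + \<delta> \<in> S" using e'(2) by (auto simp: e1_def dist_commute)
      have "dotp (w - w') \<delta> = 0" if ww: "w \<in> min_terms val f \<alpha>" "w' \<in> min_terms val f \<alpha>" for w w'
      proof -
        have "\<forall>b\<in>B. (\<Sum>j\<in>UNIV. (w - w') $ j * y b $ j) = 0"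
          using orth ww by (intro B(3)) (auto simp: dotp_def)
        note zero = this
        have z: "(\<Sum>j\<in>UNIV. real_of_int ((w - w') $ j) * real_of_int (y b $ j)) = 0" if "b \<in> B" for b
        proof -
          have "(\<Sum>j\<in>UNIV. (w - w') $ j * y b $ j) = 0"
            using zero that by blast
          from arg_cong[OF this, of real_of_int] show ?thesis
            unfolding of_int_sum of_int_mult by simp
        qed
        have "dotp (w - w') \<delta> = (\<Sum>b\<in>B. v b * (\<Sum>j\<in>UNIV. real_of_int ((w - w') $ j) * real_of_int (y b $ j)))"
          unfolding dotp_def \<delta>_def by (simp add: sum_distrib_left sum.swap[of _ _ B] mult_ac)
        then show ?thesis using z by simp
      qed
      then have "min_terms val f (\<alpha> + \<delta>) = min_terms val f \<alpha>"
        using \<open>\<alpha> + \<delta> \<in> S\<close> by (intro min_terms_eqI f S(3)) auto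
      moreover have teq: "trop_eq (\<alpha> + \<delta>) (trop_point val Q)"
        using P(2) unfolding tQ trop_eq_def by (auto simp: algebra_simps)
      ultimately have "min_terms val f (trop_point val Q) = min_terms val f \<alpha>"
        using min_terms_trop_eq[OF f(1)] by metis
      then obtain x where x: "x \<in> hypersurface f" "trop_point val x = trop_point val Q"
        using kapranov[OF Q two(1)] two(2,3) by blast
      then have "x \<in> hypersurface f \<inter> torus" by (simp add: hypersurface_def)
      moreover have "trop_eq (\<alpha> + \<delta>) (trop_point val x)" using x(2) teq by simp
      ultimately show ?thesis using close
        by (intro bexI[of _ "\<alpha> + \<delta>"] CollectI) (auto simp: e1_def)
    qed
    then show "u \<in> trop val (hypersurface f)" unfolding trop_def closure_approachable by blast
  qed
  then show ?thesis unfolding eventually_nhds using S(1,2) by blast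
qed

end

section \<open>The local structure at a tame vertex\<close>

definition normalised_term :: "('k::field, 'n::finite) laurent \<Rightarrow> int ^ 'n \<Rightarrow> ('k, 'n) laurent" where
  "normalised_term f b = Poly_Mapping.single (- b) (inverse (Poly_Mapping.lookup f b)) * f"

lemma evf_single_mult:
  fixes f :: "('k::field, 'n::finite) laurent"
  assumes "c \<noteq> 0"
  shows "evf \<phi> (Poly_Mapping.single a c * f) = c * evf (\<lambda>w. \<phi> (a + w)) f"
  using assms unfolding evf_mult by (simp add: evf_def sum_distrib_left mult.assoc)

lemma lookup_evf: "Poly_Mapping.lookup f v = evf (\<lambda>w. if w = v then 1 else 0) f"
  by (simp add: evf_def if_distrib[of "\<lambda>z. _ * z"] in_keys_iff cong: if_cong)

lemma lookup_normalised_term: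
  fixes f :: "('k::field, 'n::finite) laurent"
  assumes "b \<in> Poly_Mapping.keys f"
  shows "Poly_Mapping.lookup (normalised_term f b) w = Poly_Mapping.lookup f (w + b) / Poly_Mapping.lookup f b"
proof -
  have nz: "inverse (Poly_Mapping.lookup f b) \<noteq> 0" using assms by (simp add: in_keys_iff)
  have "(\<lambda>v. if - b + v = w then 1 else 0 :: 'k) = (\<lambda>v. if v = w + b then 1 else 0)"
    by (auto simp: fun_eq_iff algebra_simps)
  then show ?thesis
    unfolding lookup_evf[of "normalised_term f b"] unfolding normalised_term_def evf_single_mult[OF nz]
    by (simp only: lookup_evf[of f "w + b", symmetric] divide_inverse mult.commute)
qed

lemma keys_normalised_term:
  assumes "b \<in> Poly_Mapping.keys f"
  shows "Poly_Mapping.keys (normalised_term f b) = (\<lambda>w. w - b) ` Poly_Mapping.keys f"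
proof (intro set_eqI iffI)
  fix w assume "w \<in> Poly_Mapping.keys (normalised_term f b)"
  then have "w + b \<in> Poly_Mapping.keys f" by (auto simp: in_keys_iff lookup_normalised_term[OF assms])
  then show "w \<in> (\<lambda>w. w - b) ` Poly_Mapping.keys f" by (rule rev_image_eqI) simp
qed (use assms in \<open>auto simp: in_keys_iff lookup_normalised_term\<close>)

lemma normalised_term_torus_ring:
  assumes "f \<in> torus_ring" "b \<in> Poly_Mapping.keys f" shows "normalised_term f b \<in> torus_ring"
proof -
  have "w - b \<in> char_lattice" if "w \<in> Poly_Mapping.keys f" for w
  proof -
    have "w \<in> char_lattice" "b \<in> char_lattice" using assms that by (auto simp: torus_ring_def)
    then show ?thesis by (simp add: char_lattice_def sum_subtractf)
  qed
  then show ?thesis unfolding torus_ring_def mem_Collect_eq keys_normalised_term[OF assms(2)] by blast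
qed

lemma leval_normalised_term:
  assumes "x \<in> torus" "b \<in> Poly_Mapping.keys f"
  shows "leval (normalised_term f b) x = 0 \<longleftrightarrow> leval f x = 0"
    and "leval f x = 0 \<Longrightarrow> ldiff (normalised_term f b) x a = 0 \<longleftrightarrow> ldiff f x a = 0"
proof -
  have "leval (Poly_Mapping.single (- b) (inverse (Poly_Mapping.lookup f b))) x \<noteq> 0"
    using assms by (simp add: leval_evf lmono_nz in_keys_iff)
  then show "leval (normalised_term f b) x = 0 \<longleftrightarrow> leval f x = 0"
    and "leval f x = 0 \<Longrightarrow> ldiff (normalised_term f b) x a = 0 \<longleftrightarrow> ldiff f x a = 0"
    by (simp_all add: normalised_term_def leval_mult[OF assms(1)] ldiff_mult[OF assms(1)])
qed

lemma (in valued_field) term_val_normalised_term: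
  assumes "b \<in> Poly_Mapping.keys f" "w \<in> Poly_Mapping.keys f"
  shows "term_val val (normalised_term f b) u (w - b) = term_val val f u w - term_val val f u b"
proof -
  have "real_of_ereal (val (Poly_Mapping.lookup f w / Poly_Mapping.lookup f b))
      = real_of_ereal (val (Poly_Mapping.lookup f w)) - real_of_ereal (val (Poly_Mapping.lookup f b))"
    using assms val_real[of "Poly_Mapping.lookup f w"] val_real[of "Poly_Mapping.lookup f b"]
      val_divide[of "Poly_Mapping.lookup f b" "Poly_Mapping.lookup f w"]
    by (metis ereal_minus(1) in_keys_iff real_of_ereal.simps(1))
  then show ?thesis
    by (simp add: term_val_dotp lookup_normalised_term[OF assms(1)] dotp_diff_left)
qed

lemma (in valued_field) min_terms_normalised_term:
  assumes "b \<in> Poly_Mapping.keys f"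
  shows "min_terms val (normalised_term f b) u = (\<lambda>w. w - b) ` min_terms val f u"
  unfolding min_terms_def keys_normalised_term[OF assms]
  by (auto simp: term_val_normalised_term[OF assms])

lemma (in valued_field) normalised_at_normalised_term:
  assumes "f \<in> torus_ring" "b \<in> min_terms val f u"
  shows "normalised_at val u f (normalised_term f b)"
proof -
  have b: "b \<in> Poly_Mapping.keys f" using assms(2) by (simp add: min_terms_def)
  have "- b \<in> char_lattice" using b assms(1) by (auto simp: torus_ring_def char_lattice_def sum_negf)
  moreover have "inverse (Poly_Mapping.lookup f b) \<noteq> 0" using b by (simp add: in_keys_iff)
  moreover have "Poly_Mapping.lookup (normalised_term f b) 0 = 1"
    using b by (simp add: lookup_normalised_term[OF b] in_keys_iff)
  moreover have "0 \<in> min_terms val (normalised_term f b) u"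
    using assms(2) unfolding min_terms_normalised_term[OF b] by (rule rev_image_eqI) simp
  ultimately show ?thesis unfolding normalised_at_def normalised_term_def by blast
qed

lemma nonneg_sum_eq_1:
  fixes g :: "'i \<Rightarrow> int"
  assumes "finite A" "\<And>i. i \<in> A \<Longrightarrow> g i \<ge> 0" "sum g A = 1"
  obtains i where "i \<in> A" "g i = 1" "\<And>j. j \<in> A \<Longrightarrow> j \<noteq> i \<Longrightarrow> g j = 0"
proof -
  obtain i where i: "i \<in> A" "g i \<noteq> 0"
    using assms(3) by (metis sum.neutral zero_neq_one)
  have s: "sum g A = g i + sum g (A - {i})" using assms(1) i(1) by (rule sum.remove)
  have "sum g (A - {i}) \<ge> 0" using assms(2) by (intro sum_nonneg) auto
  then have "g i = 1" "sum g (A - {i}) = 0" using s assms(2)[OF i(1)] assms(3) i(2) by linarith+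
  then have "\<forall>j\<in>A - {i}. g j = 0" using assms(1,2) by (subst (asm) sum_nonneg_eq_0_iff) auto
  then show ?thesis using that i \<open>g i = 1\<close> by blast
qed

lemma trop_eq_class: "{u. trop_eq u v} = (\<lambda>x. v + x) ` span {1}"
  by (auto simp: trop_eq_def span_singleton)

lemma closed_trop_eq_class: "closed {u. trop_eq u v}" for v :: "real ^ 'n::finite"
  unfolding trop_eq_class by (intro closed_translation closed_subspace subspace_span)

lemma aff_dim_trop_eq_class: "aff_dim {u. trop_eq u v} = 1" for v :: "real ^ 'n::finite"
  unfolding trop_eq_class aff_dim_translation_eq
  by (simp add: aff_dim_subspace dim_singleton vec_eq_iff)

text \<open>Turns equality of two coordinates into the containment that tameness forbids for
  \<open>J = {k, l}\<close>.\<close>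

lemma equal_coordinates_coord_span:
  fixes x :: "real ^ 'n::finite"
  assumes "x $ k = x $ l" shows "x \<in> coord_span (- {k, l})"
proof -
  have "x = x $ k *\<^sub>R 1 + (\<Sum>i\<in>- {k, l}. (x $ i - x $ k) *\<^sub>R axis i 1)"
  proof (subst vec_eq_iff, rule allI)
    fix j
    have "(\<Sum>i\<in>- {k, l}. (x $ i - x $ l) * (if j = i then 1 else 0)) = (if j \<in> {k, l} then 0 else x $ j - x $ l)"
      by (auto simp: if_distrib[of "\<lambda>z. _ * z"] cong: if_cong)
    then show "x $ j = (x $ k *\<^sub>R 1 + (\<Sum>i\<in>- {k, l}. (x $ i - x $ k) *\<^sub>R axis i 1)) $ j"
      using assms by (auto simp: axis_def)
  qed
  also have "\<dots> \<in> coord_span (- {k, l})"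
    unfolding coord_span_def by (intro span_add span_scale span_sum span_base) auto
  finally show ?thesis .
qed

text \<open>Contains a lift \<open>P\<close> of \<open>\<alpha>\<close> to the curve, from which the
  ties at \<open>\<alpha>\<close> and the lifts of nearby points are obtained.\<close>

locale curve_vertex = residue_char_0_field val
  for val :: "'k::{alg_closed_field, field_char_0} \<Rightarrow> ereal" +
  fixes n :: nat and X :: "('k ^ 'n::finite) set" and f :: "nat \<Rightarrow> ('k, 'n) laurent"
    and \<alpha> :: "real ^ 'n" and P :: "'k ^ 'n"
  assumes card_n: "CARD('n) = n + 1" and n_pos: "n \<ge> 1"
    and f: "\<forall>i\<in>{1..<n}. f i \<in> torus_ring \<and> f i \<noteq> 0"
    and ci: "torus_complete_intersection n f X"
    and tci: "tropical_complete_intersection val n f"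
    and three: "\<forall>i\<in>{1..<n}. three_terms_in_codim_one val (f i)"
    and very_general: "very_general_valuations val n f X"
    and vertex: "vertex val n f \<alpha>"
    and tame: "tame val X \<alpha>"
    and P: "P \<in> X" "P \<in> torus" "trop_eq \<alpha> (trop_point val P)"
begin

abbreviation I :: "nat set" where "I \<equiv> {1..<n}"

definition m :: "nat \<Rightarrow> (int ^ 'n) set" where
  "m i = min_terms val (f i) \<alpha>"

text \<open>The direction space of the cell \<open>E i\<close> at \<open>\<alpha>\<close>, as
  \<open>E_orth\<close> and \<open>E_near\<close> show.\<close>

definition orth :: "nat \<Rightarrow> (real ^ 'n) set" where
  "orth i = {x. \<forall>w\<in>m i. \<forall>w'\<in>m i. dotp (w - w') x = 0}"

definition E :: "nat \<Rightarrow> (real ^ 'n) set" where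
  "E i = {v \<in> trop val (hypersurface (f i)). m i \<subseteq> min_terms val (f i) v}"

text \<open>The closure is not yet taken: these points have actual lifts on \<open>X\<close>, and
  hence two minimal terms of every \<open>f i\<close>.\<close>

definition trop_points :: "(real ^ 'n) set" where
  "trop_points = {u. \<exists>x\<in>X \<inter> torus. trop_eq u (trop_point val x)}"

lemma trop_X: "trop val X = closure trop_points"
  by (simp add: trop_def trop_points_def)

lemma fi: "i \<in> I \<Longrightarrow> f i \<in> torus_ring" "i \<in> I \<Longrightarrow> f i \<noteq> 0"
  using f by auto

lemma X_hypersurface: "x \<in> X \<Longrightarrow> x \<in> torus \<Longrightarrow> i \<in> I \<Longrightarrow> x \<in> hypersurface (f i)"
  using ci unfolding torus_complete_intersection_def by blast

lemma X_leval: "x \<in> X \<Longrightarrow> x \<in> torus \<Longrightarrow> i \<in> I \<Longrightarrow> leval (f i) x = 0"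
  using X_hypersurface[of x i] unfolding hypersurface_def by blast

lemma trop_points_two:
  assumes "u \<in> trop_points" "i \<in> I"
  shows "\<exists>w w'. w \<noteq> w' \<and> w \<in> min_terms val (f i) u \<and> w' \<in> min_terms val (f i) u"
proof -
  obtain x where x: "x \<in> X" "x \<in> torus" "trop_eq u (trop_point val x)"
    using assms(1) by (auto simp: trop_points_def)
  show ?thesis
    unfolding min_terms_trop_eq[OF fi(1)[OF assms(2)] x(3)]
    by (rule two_min_terms[OF x(2) X_leval[OF x(1,2) assms(2)] fi(2)[OF assms(2)]]) blast
qed

lemma \<alpha>_trop_points: "\<alpha> \<in> trop_points"
  using P by (auto simp: trop_points_def)

lemma m_two:
  assumes "i \<in> I" shows "\<exists>w w'. w \<noteq> w' \<and> w \<in> m i \<and> w' \<in> m i"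
  using trop_points_two[OF \<alpha>_trop_points assms] unfolding m_def .

lemma trop_eq_E: assumes "trop_eq u \<alpha>" "i \<in> I" shows "u \<in> E i"
proof -
  have "u \<in> trop val (hypersurface (f i))"
    using trop_memI[OF X_hypersurface[OF P(1,2) assms(2)] P(2) trop_eq_trans[OF assms(1) P(3)]] .
  then show ?thesis using min_terms_trop_eq[OF fi(1)[OF assms(2)] assms(1)] by (simp add: E_def m_def)
qed

lemma E_cell: "i \<in> I \<Longrightarrow> E i \<in> cells val (f i)"
  using trop_eq_E[of \<alpha> i] unfolding cells_def E_def m_def by auto

lemma E_orth: "v \<in> E i \<Longrightarrow> v - \<alpha> \<in> orth i"
  unfolding E_def orth_def m_def by (auto intro: min_terms_orth)

lemma E_near: assumes "i \<in> I" shows "\<forall>\<^sub>F u in nhds \<alpha>. u - \<alpha> \<in> orth i \<longrightarrow> u \<in> E i"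
proof -
  obtain w w' where w: "w \<noteq> w'" "w \<in> m i" "w' \<in> m i" using m_two[OF assms] by blast
  show ?thesis
    using trop_hypersurface_near[OF P(2,3) fi(1)[OF assms] fi(2)[OF assms] w(1), folded m_def, OF w(2,3)]
    by eventually_elim (auto simp: orth_def E_def)
qed

text \<open>\<open>E i\<close> is contained in every cell of \<open>f i\<close> through
  \<open>\<alpha>\<close>, so the cells witnessing that \<open>\<alpha>\<close> is a vertex can be
  replaced by the \<open>E i\<close>.\<close>

lemma Inter_E: "(\<Inter>i\<in>I. E i) = {u. trop_eq u \<alpha>}"
proof
  show "{u. trop_eq u \<alpha>} \<subseteq> (\<Inter>i\<in>I. E i)" using trop_eq_E by blast
  obtain E' where E': "{u. trop_eq u \<alpha>} = (\<Inter>i\<in>I. E' i)" "\<And>i. i \<in> I \<Longrightarrow> E' i \<in> cells val (f i)"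
    using vertex unfolding vertex_def ci_cells_def by auto
  have "E i \<subseteq> E' i" if i: "i \<in> I" for i
  proof -
    obtain u where u: "E' i = {v \<in> trop val (hypersurface (f i)). min_terms val (f i) u \<subseteq> min_terms val (f i) v}"
      using E'(2)[OF i] by (auto simp: cells_def)
    have "\<alpha> \<in> {u. trop_eq u \<alpha>}" by simp
    then have "\<alpha> \<in> E' i" unfolding E'(1) using i by blast
    then show ?thesis unfolding u E_def m_def by blast
  qed
  then show "(\<Inter>i\<in>I. E i) \<subseteq> {u. trop_eq u \<alpha>}" unfolding E'(1) by blast
qed

lemma codim_sum: "(\<Sum>i\<in>I. codim (E i)) = int n"
proof -
  have "(\<Inter>i\<in>I. E i) \<noteq> {}" unfolding Inter_E by (auto intro: trop_eq_refl)
  then have "codim (\<Inter>i\<in>I. E i) = (\<Sum>i\<in>I. codim (E i))"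
    using tci E_cell unfolding tropical_complete_intersection_def by blast
  then show ?thesis unfolding Inter_E by (simp add: codim_def aff_dim_trop_eq_class card_n)
qed

lemma subspace_orth: "subspace (orth i)"
  by (auto simp: subspace_def orth_def dotp_add dotp_scale) (simp add: dotp_def)

lemma orth_hyperplane:
  assumes "w \<noteq> w'" shows "dim {x :: real ^ 'n. dotp (w - w') x = 0} = n"
    and "subspace {x :: real ^ 'n. dotp (w - w') x = 0}"
proof -
  let ?a = "(\<chi> j. real_of_int ((w - w') $ j)) :: real ^ 'n"
  have eq: "{x. dotp (w - w') x = 0} = {x. ?a \<bullet> x = 0}"
    by (simp add: dotp_def inner_vec_def)
  have "?a \<noteq> 0" using assms by (auto simp: vec_eq_iff)
  then show "dim {x :: real ^ 'n. dotp (w - w') x = 0} = n"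
    unfolding eq by (subst dim_hyperplane) (auto simp: card_n)
  show "subspace {x :: real ^ 'n. dotp (w - w') x = 0}" unfolding eq by (rule subspace_hyperplane)
qed

lemma E_translate: "E i \<subseteq> (\<lambda>x. \<alpha> + x) ` orth i"
proof
  fix v assume "v \<in> E i"
  then have "v - \<alpha> \<in> orth i" by (rule E_orth)
  then show "v \<in> (\<lambda>x. \<alpha> + x) ` orth i" by (rule rev_image_eqI) simp
qed

lemma aff_dim_E: "aff_dim (E i) \<le> int (dim (orth i))"
  using aff_dim_subset[OF E_translate[of i]]
  by (simp add: aff_dim_translation_eq aff_dim_subspace[OF subspace_orth])

lemma orth_le: "w \<noteq> w' \<Longrightarrow> w \<in> m i \<Longrightarrow> w' \<in> m i \<Longrightarrow> orth i \<subseteq> {x. dotp (w - w') x = 0}"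
  by (auto simp: orth_def)

lemma codim_ge_1: assumes "i \<in> I" shows "codim (E i) \<ge> 1"
proof -
  obtain w w' where w: "w \<noteq> w'" "w \<in> m i" "w' \<in> m i" using m_two[OF assms] by blast
  have "dim (orth i) \<le> n" using dim_subset[OF orth_le[OF w]] orth_hyperplane(1)[OF w(1)] by simp
  then show ?thesis using aff_dim_E[of i] by (simp add: codim_def card_n)
qed

text \<open>For dimension reasons \<open>orth i\<close> is the whole hyperplane given by any single
  exponent difference.\<close>

lemma codim_1_orth:
  assumes "i \<in> I" "codim (E i) = 1" "w \<noteq> w'" "w \<in> m i" "w' \<in> m i" "dotp (w - w') x = 0"
  shows "x \<in> orth i"
proof -
  have "int n \<le> int (dim (orth i))" using aff_dim_E[of i] assms(2) by (simp add: codim_def card_n)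
  then have "orth i = {x. dotp (w - w') x = 0}"
    using orth_le[OF assms(3-5)] orth_hyperplane[OF assms(3)]
    by (intro subspace_dim_equal subspace_orth) auto
  then show ?thesis using assms(6) by simp
qed

text \<open>There are \<open>n - 1\<close> cells of codimension at least one, and the codimensions
  sum to \<open>n\<close>.\<close>

lemma distinguished_index:
  obtains i0 where "i0 \<in> I" "codim (E i0) = 2" "\<And>i. i \<in> I \<Longrightarrow> i \<noteq> i0 \<Longrightarrow> codim (E i) = 1"
proof -
  have "(\<Sum>i\<in>I. codim (E i) - 1) = 1" using codim_sum n_pos by (simp add: sum_subtractf of_nat_diff)
  then obtain i0 where i0: "i0 \<in> I" "codim (E i0) - 1 = 1" "\<And>i. i \<in> I \<Longrightarrow> i \<noteq> i0 \<Longrightarrow> codim (E i) - 1 = 0"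
    using nonneg_sum_eq_1[of I "\<lambda>i. codim (E i) - 1"] codim_ge_1 by (metis diff_ge_0_iff_ge finite_atLeastLessThan)
  show ?thesis
  proof (rule that[OF i0(1)])
    show "codim (E i0) = 2" using i0(2) by simp
    show "codim (E i) = 1" if "i \<in> I" "i \<noteq> i0" for i using i0(3)[OF that] by simp
  qed
qed

text \<open>Near \<open>\<alpha>\<close> the cell fills \<open>\<alpha> + orth i\<close>, so
  \<open>\<alpha>\<close> lies in its relative interior, where the terms are counted by
  hypothesis.\<close>

lemma card_m_3: assumes "i \<in> I" "codim (E i) = 2" shows "card (m i) = 3"
proof -
  obtain S where S: "open S" "\<alpha> \<in> S" "\<And>u. u \<in> S \<Longrightarrow> u - \<alpha> \<in> orth i \<longrightarrow> u \<in> E i"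
    using E_near[OF assms(1)] unfolding eventually_nhds by blast
  have "affine ((\<lambda>x. \<alpha> + x) ` orth i)"
    using affine_translation subspace_imp_affine[OF subspace_orth] by blast
  then have hull: "affine hull E i \<subseteq> (\<lambda>x. \<alpha> + x) ` orth i" by (rule hull_minimal[OF E_translate])
  have "\<alpha> \<in> rel_interior (E i)"
    unfolding mem_rel_interior
  proof (intro exI conjI)
    show "S \<inter> affine hull E i \<subseteq> E i" using hull S(3) by fastforce
    show "\<alpha> \<in> S \<inter> E i" using S(2) trop_eq_E[OF trop_eq_refl assms(1)] by blast
  qed (rule S(1))
  then show ?thesis
    using three assms E_cell[OF assms(1)] unfolding three_terms_in_codim_one_def m_def by blast
qed

text \<open>Two minimal terms at a point near \<open>\<alpha>\<close> already belong to
  \<open>m i\<close>, and in codimension one their tie alone implies all the ties of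
  \<open>m i\<close>.\<close>

lemma trop_points_near:
  assumes "i \<in> I" "codim (E i) = 1"
  shows "\<forall>\<^sub>F u in nhds \<alpha>. u \<in> trop_points \<longrightarrow> u - \<alpha> \<in> orth i \<and> min_terms val (f i) u = m i"
  using min_terms_near[of val "f i" \<alpha>]
proof eventually_elim
  case (elim u)
  show ?case
  proof
    assume u: "u \<in> trop_points"
    obtain w w' where w: "w \<noteq> w'" "w \<in> min_terms val (f i) u" "w' \<in> min_terms val (f i) u"
      using trop_points_two[OF u assms(1)] by blast
    then have "w \<in> m i" "w' \<in> m i" using elim by (auto simp: m_def)
    moreover from this have "dotp (w - w') (u - \<alpha>) = 0"
      using w by (intro min_terms_orth[of w val "f i" u w' \<alpha>]) (auto simp: m_def)
    ultimately have o: "u - \<alpha> \<in> orth i" using codim_1_orth[OF assms w(1)] by blast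
    then have "min_terms val (f i) u = m i"
      unfolding m_def using fi(2)[OF assms(1)] elim by (intro min_terms_eqI) (auto simp: orth_def m_def)
    with o show "u - \<alpha> \<in> orth i \<and> min_terms val (f i) u = m i" by blast
  qed
qed

text \<open>If coordinates \<open>k\<close> and \<open>l\<close> had the same difference as at
  \<open>\<alpha>\<close> on all nearby points, this would pass to the closure and to its affine
  span, which tameness forbids.\<close>

lemma tame_point:
  assumes S: "open S" "\<alpha> \<in> S" and kl: "k \<noteq> l"
  shows "\<exists>u\<in>trop_points \<inter> S. (u - \<alpha>) $ k \<noteq> (u - \<alpha>) $ l"
proof (rule ccontr)
  assume no: "\<not> ?thesis"
  obtain e where e: "e > 0" "ball \<alpha> e \<subseteq> S" using S open_contains_ball by blast
  obtain b where b: "b > 0" "\<And>\<epsilon>. 0 < \<epsilon> \<Longrightarrow> \<epsilon> < b \<Longrightarrow>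
      (let \<Lambda> = affine hull (trop val X \<inter> ball \<alpha> \<epsilon>)
       in \<forall>J. card J = 2 \<longrightarrow> \<not> span {x - y |x y. x \<in> \<Lambda> \<and> y \<in> \<Lambda>} \<subseteq> coord_span (- J))"
    using tame unfolding tame_def eventually_at_right_field by blast
  define \<epsilon> where "\<epsilon> = min e b / 2"
  have \<epsilon>: "0 < \<epsilon>" "\<epsilon> < b" "\<epsilon> < e" using e b by (auto simp: \<epsilon>_def min_def)
  define \<Lambda> where "\<Lambda> = affine hull (trop val X \<inter> ball \<alpha> \<epsilon>)"
  have notsub: "\<not> span {x - y |x y. x \<in> \<Lambda> \<and> y \<in> \<Lambda>} \<subseteq> coord_span (- {k, l})"
    using b(2)[OF \<epsilon>(1,2)] kl unfolding Let_def \<Lambda>_def by simp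
  define U where "U = ball \<alpha> \<epsilon> \<inter> {u. (u - \<alpha>) $ k \<noteq> (u - \<alpha>) $ l}"
  have "open {u :: real ^ 'n. (u - \<alpha>) $ k \<noteq> (u - \<alpha>) $ l}"
    by (intro open_Collect_neq continuous_intros)
  then have "open U" unfolding U_def by blast
  moreover have "U \<inter> trop_points = {}" using no e(2) \<epsilon>(3) by (auto simp: U_def subset_iff)
  ultimately have U: "U \<inter> trop val X = {}" unfolding trop_X using open_Int_closure_eq_empty by blast
  have "affine {u :: real ^ 'n. (axis k 1 - axis l 1) \<bullet> u = (axis k 1 - axis l 1) \<bullet> \<alpha>}"
    by (rule affine_hyperplane)
  moreover have "trop val X \<inter> ball \<alpha> \<epsilon> \<subseteq> {u. (axis k 1 - axis l 1) \<bullet> u = (axis k 1 - axis l 1) \<bullet> \<alpha>}"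
    using U by (auto simp: U_def inner_diff_left inner_axis' algebra_simps)
  ultimately have "\<Lambda> \<subseteq> {u. (axis k 1 - axis l 1) \<bullet> u = (axis k 1 - axis l 1) \<bullet> \<alpha>}"
    unfolding \<Lambda>_def by (intro hull_minimal)
  then have \<Lambda>: "u $ k - u $ l = \<alpha> $ k - \<alpha> $ l" if "u \<in> \<Lambda>" for u
    using that by (auto simp: inner_diff_left inner_axis' subset_iff)
  have "span {x - y |x y. x \<in> \<Lambda> \<and> y \<in> \<Lambda>} \<subseteq> coord_span (- {k, l})"
  proof (rule span_minimal)
    show "{x - y |x y. x \<in> \<Lambda> \<and> y \<in> \<Lambda>} \<subseteq> coord_span (- {k, l})"
    proof clarify
      fix x y assume "x \<in> \<Lambda>" "y \<in> \<Lambda>"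
      from \<Lambda>[OF this(1)] \<Lambda>[OF this(2)] show "x - y \<in> coord_span (- {k, l})"
        by (intro equal_coordinates_coord_span) simp
    qed
  qed (simp add: coord_span_def)
  then show False using notsub by blast
qed

text \<open>With \<open>f i\<close> normalised at \<open>w1\<close>, exchanging \<open>w2\<close>
  for \<open>w3\<close> in the \<open>i\<close>-th place changes the tuple of terms but not the
  total valuation.\<close>

lemma three_terms_critical:
  assumes i: "i \<in> I" and u: "u \<in> trop_points"
    and w: "w1 \<noteq> w2" "w1 \<noteq> w3" "w2 \<noteq> w3" "{w1, w2, w3} \<subseteq> min_terms val (f i) u"
  shows "u \<in> critical_locus val n f X"
proof -
  have "\<exists>w w'. w \<noteq> w' \<and> w \<in> min_terms val (f j) u \<and> w' \<in> min_terms val (f j) u" if "j \<in> I" for j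
    using trop_points_two[OF u that] .
  then have "\<forall>j\<in>I. \<exists>p. fst p \<noteq> snd p \<and> fst p \<in> min_terms val (f j) u \<and> snd p \<in> min_terms val (f j) u"
    by fastforce
  from bchoice[OF this] obtain p where p: "\<forall>j\<in>I. fst (p j) \<noteq> snd (p j) \<and>
      fst (p j) \<in> min_terms val (f j) u \<and> snd (p j) \<in> min_terms val (f j) u" by blast
  define b0 b1 where "b0 j = fst (p j)" and "b1 j = snd (p j)" for j
  have b01: "b0 j \<noteq> b1 j \<and> b0 j \<in> min_terms val (f j) u \<and> b1 j \<in> min_terms val (f j) u" if "j \<in> I" for j
    using p that by (simp add: b0_def b1_def)
  define b where "b j = (if j = i then w1 else b0 j)" for j
  define g where "g j = normalised_term (f j) (b j)" for j
  have b: "b j \<in> min_terms val (f j) u" if "j \<in> I" for j using b01[OF that] w(4) by (auto simp: b_def)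
  have bk: "b j \<in> Poly_Mapping.keys (f j)" if "j \<in> I" for j using b[OF that] by (simp add: min_terms_def)
  define c where "c v j = (if j = i then v else b1 j)" for v j
  have c: "c v j \<in> Poly_Mapping.keys (f j) - {b j}" if "j \<in> I" "v \<in> {w2, w3}" for v j
    using b01[OF that(1)] w that(2) by (auto simp: b_def c_def min_terms_def)
  define r where "r v = (\<lambda>j\<in>I. c v j - b j)" for v
  have r: "r v \<in> (\<Pi>\<^sub>E j\<in>I. Poly_Mapping.keys (g j) - {0})" if "v \<in> {w2, w3}" for v
    unfolding r_def g_def
  proof (rule restrict_PiE_iff[THEN iffD2], rule ballI)
    fix j assume j: "j \<in> I"
    show "c v j - b j \<in> Poly_Mapping.keys (normalised_term (f j) (b j)) - {0}"
      unfolding keys_normalised_term[OF bk[OF j]] using c[OF j that] by auto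
  qed
  have "r w2 i \<noteq> r w3 i" using w(3) i by (simp add: r_def c_def)
  then have "r w2 \<noteq> r w3" by metis
  moreover have "(\<Sum>j\<in>I. term_val val (g j) u (r w2 j)) = (\<Sum>j\<in>I. term_val val (g j) u (r w3 j))"
  proof (rule sum.cong[OF refl])
    fix j assume j: "j \<in> I"
    have "term_val val (f j) u (c w2 j) = term_val val (f j) u (c w3 j)"
      using w(4) min_terms_equal[of w2 val "f i" u w3] by (auto simp: c_def)
    then show "term_val val (g j) u (r w2 j) = term_val val (g j) u (r w3 j)"
      using j c[OF j, of w2] c[OF j, of w3] by (simp add: g_def r_def term_val_normalised_term[OF bk[OF j]])
  qed
  ultimately have "cancellative_pair val n g u (r w2) (r w3)"
    unfolding cancellative_pair_def using r by simp
  moreover have "\<forall>j\<in>I. normalised_at val u (f j) (g j)"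
    unfolding g_def using normalised_at_normalised_term fi(1) b by blast
  moreover have "u \<in> trop val X" unfolding trop_X using u closure_subset by blast
  ultimately show ?thesis unfolding critical_locus_def by blast
qed

lemma CARD_ge_2: obtains k l :: 'n where "k \<noteq> l"
proof -
  have "\<not> (\<forall>k l :: 'n. k = l)"
  proof
    assume "\<forall>k l :: 'n. k = l"
    then have "(UNIV :: 'n set) = {undefined}" by auto
    then have "CARD('n) = card {undefined :: 'n}" by simp
    then show False using card_n n_pos by simp
  qed
  then show ?thesis using that by blast
qed

text \<open>In codimension one, three minimal terms would persist at all points of
  \<open>trop_points\<close> near \<open>\<alpha>\<close> and make them critical. But
  \<open>tame_point\<close> provides such points outside the class of \<open>\<alpha>\<close> and,
  the critical locus being finite, outside every other critical class.\<close>

lemma card_m_2: assumes i: "i \<in> I" "codim (E i) = 1" and w: "w1 \<in> m i" "w2 \<in> m i" "w3 \<in> m i"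
  shows "w1 = w2 \<or> w1 = w3 \<or> w2 = w3"
proof (rule ccontr)
  assume ne: "\<not> ?thesis"
  let ?cl = "\<lambda>u. {v. trop_eq v u}"
  obtain S where S: "open S" "\<alpha> \<in> S" "\<And>u. u \<in> S \<Longrightarrow> u \<in> trop_points \<Longrightarrow> min_terms val (f i) u = m i"
    using trop_points_near[OF i] unfolding eventually_nhds by blast
  have crit: "u \<in> critical_locus val n f X" if "u \<in> S" "u \<in> trop_points" for u
    using three_terms_critical[OF i(1) that(2), of w1 w2 w3] ne w S(3)[OF that] by blast
  \<comment> \<open>\<open>\<alpha>\<close> itself may be critical, so only the other critical
    classes are removed.\<close>
  define G where "G = {c \<in> ?cl ` critical_locus val n f X. \<alpha> \<notin> c}"
  have "finite G" using very_general by (simp add: very_general_valuations_def G_def)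
  moreover have "closed c" if "c \<in> G" for c using that closed_trop_eq_class by (auto simp: G_def)
  ultimately have "closed (\<Union>G)" by blast
  then have "open (S \<inter> - \<Union>G)" using S(1) by blast
  moreover have "\<alpha> \<in> S \<inter> - \<Union>G" using S(2) by (auto simp: G_def)
  moreover obtain k l :: 'n where "k \<noteq> l" by (rule CARD_ge_2)
  ultimately obtain u where u: "u \<in> trop_points" "u \<in> S" "u \<notin> \<Union>G" "(u - \<alpha>) $ k \<noteq> (u - \<alpha>) $ l"
    using tame_point[of "S \<inter> - \<Union>G" k l] by blast
  have "?cl u \<in> ?cl ` critical_locus val n f X" using crit[OF u(2,1)] by (rule imageI)
  moreover have "u \<in> ?cl u" by simp
  ultimately have "\<alpha> \<in> ?cl u" using u(3) unfolding G_def by blast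
  then obtain c where "\<alpha> = u + c *\<^sub>R 1" by (auto simp: trop_eq_def)
  then show False using u(4) by simp
qed

end

section \<open>From the equations at the vertex to a vertex configuration\<close>

lemma vec_span_pair:
  fixes u v :: "'k::field ^ 'n"
  shows "x \<in> vec.span {u, v} \<longleftrightarrow> (\<exists>c e. x = c *s u + e *s v)"
proof -
  have "x - c *s u \<in> range (\<lambda>e. e *s v) \<longleftrightarrow> (\<exists>e. x = c *s u + e *s v)" for c
    by (auto simp: image_iff algebra_simps)
  then show ?thesis unfolding vec.span_breakdown_eq vec.span_singleton by blast
qed

lemma vec_independent_pair:
  fixes u v :: "'k::field ^ 'n"
  assumes "u \<noteq> v"
  shows "vec.independent {u, v} \<longleftrightarrow> v \<noteq> 0 \<and> (\<forall>c. u \<noteq> c *s v)"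
  using assms by (auto simp: vec.independent_insert vec.span_singleton vec.dependent_single)

lemma (in vertex_configuration) admissibleI:
  assumes "\<And>i. i \<in> I \<Longrightarrow> (\<Sum>w\<in>T i. \<gamma> i w) = 0"
    and "\<And>i w. i \<in> I \<Longrightarrow> w \<in> T i \<Longrightarrow> w = 0 \<or> w = V (Some i) \<or> i = i0 \<and> w = V None \<Longrightarrow> val (\<gamma> i w) = 0"
    and "\<And>i w. i \<in> I \<Longrightarrow> w \<in> T i \<Longrightarrow> \<not> (w = 0 \<or> w = V (Some i) \<or> i = i0 \<and> w = V None) \<Longrightarrow> vpos (\<gamma> i w)"
  shows "admissible \<gamma>"
  unfolding admissible_def using assms by blast

context curve_vertex
begin

text \<open>The values at \<open>Q\<close> of the terms of the normalised equation; they are its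
  coefficients in coordinates relative to \<open>Q\<close>.\<close>

definition coefficient :: "(nat \<Rightarrow> int ^ 'n) \<Rightarrow> 'k ^ 'n \<Rightarrow> nat \<Rightarrow> int ^ 'n \<Rightarrow> 'k" where
  "coefficient b Q i w = Poly_Mapping.lookup (normalised_term (f i) (b i)) w * lmono Q w"

text \<open>A small multiple of \<open>x\<close> moves \<open>\<alpha>\<close> inside all the cells
  \<open>E i\<close>, whose intersection is the class of \<open>\<alpha>\<close>.\<close>

lemma orth_constant:
  assumes "\<And>i. i \<in> I \<Longrightarrow> x \<in> orth i" shows "\<exists>c. x = c *\<^sub>R 1"
proof -
  have "\<forall>\<^sub>F u in nhds \<alpha>. \<forall>i\<in>I. u - \<alpha> \<in> orth i \<longrightarrow> u \<in> E i"
    using E_near by (intro eventually_ball_finite) auto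
  then obtain S where S: "open S" "\<alpha> \<in> S" "\<And>u. u \<in> S \<Longrightarrow> \<forall>i\<in>I. u - \<alpha> \<in> orth i \<longrightarrow> u \<in> E i"
    unfolding eventually_nhds by blast
  obtain e where e: "e > 0" "ball \<alpha> e \<subseteq> S" using S(1,2) open_contains_ball by blast
  define \<eta> where "\<eta> = e / (norm x + 1)"
  have \<eta>: "\<eta> > 0" using e(1) by (simp add: \<eta>_def add_nonneg_pos)
  have "norm (\<eta> *\<^sub>R x) = \<eta> * norm x" using \<eta> by simp
  also have "\<dots> < \<eta> * (norm x + 1)" using \<eta> by simp
  also have "\<dots> = e" using norm_ge_zero[of x] unfolding \<eta>_def by (intro nonzero_eq_divide_eq[THEN iffD1] refl) linarith
  finally have "\<alpha> + \<eta> *\<^sub>R x \<in> S" using e(2) by (auto simp: dist_norm subset_iff)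
  from S(3)[OF this] have "\<alpha> + \<eta> *\<^sub>R x \<in> (\<Inter>i\<in>I. E i)"
    using assms subspace_scale[OF subspace_orth] by auto
  then have "trop_eq (\<alpha> + \<eta> *\<^sub>R x) \<alpha>" unfolding Inter_E by blast
  then obtain c where c: "\<eta> *\<^sub>R x = c *\<^sub>R 1" by (auto simp: trop_eq_def)
  have "x = inverse \<eta> *\<^sub>R (\<eta> *\<^sub>R x)" using \<eta> by simp
  also have "\<dots> = (inverse \<eta> * c) *\<^sub>R 1" unfolding c by simp
  finally show ?thesis by blast
qed

text \<open>The leading exponents depend on \<open>\<alpha>\<close> alone, so one choice of
  \<open>b\<close>, \<open>V\<close>, \<open>D\<close> and \<open>C\<close> serves all points
  \<open>Q\<close> of the curve over \<open>\<alpha>\<close>.\<close>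

lemma configuration:
  "\<exists>i0 b V D C. vertex_configuration val I i0 (\<lambda>i. Poly_Mapping.keys (normalised_term (f i) (b i))) V D C \<and>
     (\<forall>i\<in>I. b i \<in> Poly_Mapping.keys (f i)) \<and>
     (\<forall>Q\<in>X \<inter> torus. trop_eq \<alpha> (trop_point val Q) \<longrightarrow>
        vertex_configuration.admissible val I i0 (\<lambda>i. Poly_Mapping.keys (normalised_term (f i) (b i))) V (coefficient b Q))"
proof -
  obtain i0 where i0: "i0 \<in> I" "codim (E i0) = 2" "\<And>i. i \<in> I \<Longrightarrow> i \<noteq> i0 \<Longrightarrow> codim (E i) = 1"
    by (rule distinguished_index) blast
  obtain x y z where m0: "m i0 = {x, y, z}" "x \<noteq> y" "y \<noteq> z" "x \<noteq> z"
    using card_m_3[OF i0(1,2)] unfolding card_3_iff by blast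
  have "\<forall>i\<in>I. \<exists>p. fst p \<noteq> snd p \<and> (if i = i0 then p = (x, y) else m i = {fst p, snd p})"
  proof
    fix i assume i: "i \<in> I"
    show "\<exists>p. fst p \<noteq> snd p \<and> (if i = i0 then p = (x, y) else m i = {fst p, snd p})"
    proof (cases "i = i0")
      case True
      then show ?thesis using m0 by auto
    next
      case False
      obtain w w' where w: "w \<noteq> w'" "w \<in> m i" "w' \<in> m i" using m_two[OF i] by blast
      have "m i = {w, w'}" using card_m_2[OF i i0(3)[OF i False] w(2,3)] w by blast
      then show ?thesis using w(1) False by (intro exI[of _ "(w, w')"]) simp
    qed
  qed
  from bchoice[OF this] obtain p where
    p: "\<forall>i\<in>I. fst (p i) \<noteq> snd (p i) \<and> (if i = i0 then p i = (x, y) else m i = {fst (p i), snd (p i)})" by blast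
  \<comment> \<open>The minimal exponent that is moved to \<open>0\<close>; \<open>V\<close> lists
    the other minimal ones relative to it.\<close>
  define b where "b i = fst (p i)" for i
  define V where "V q = (case q of None \<Rightarrow> z - x | Some i \<Rightarrow> snd (p i) - fst (p i))" for q
  have V: "V None = z - x" "V (Some i) = snd (p i) - b i" for i by (auto simp: V_def b_def)
  have p0: "b i0 = x" "snd (p i0) = y" using p i0(1) by (auto simp: b_def)
  have m_iff: "v \<in> m i \<longleftrightarrow> v - b i = 0 \<or> v - b i = V (Some i) \<or> i = i0 \<and> v - b i = V None"
    if "i \<in> I" for i v
  proof (cases "i = i0")
    case True
    then show ?thesis using m0 p0 by (auto simp: V)
  next
    case False
    then show ?thesis using bspec[OF p that] by (auto simp: V b_def)
  qed
  have bm: "b i \<in> m i" if "i \<in> I" for i using m_iff[OF that, of "b i"] by simp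
  have mk: "m i \<subseteq> Poly_Mapping.keys (f i)" for i unfolding m_def by (rule min_terms_keys)
  have bk: "b i \<in> Poly_Mapping.keys (f i)" if "i \<in> I" for i using bm[OF that] mk by blast
  define T where "T i = Poly_Mapping.keys (normalised_term (f i) (b i))" for i
  have T: "T i = (\<lambda>w. w - b i) ` Poly_Mapping.keys (f i)" if "i \<in> I" for i
    unfolding T_def by (rule keys_normalised_term[OF bk[OF that]])
  have T_m: "w \<in> T i" if "i \<in> I" "w = 0 \<or> w = V (Some i) \<or> i = i0 \<and> w = V None" for i w
  proof -
    have "w + b i \<in> m i" using m_iff[OF that(1), of "w + b i"] that(2) by simp
    then show ?thesis unfolding T[OF that(1)] using mk by (intro image_eqI[of _ _ "w + b i"]) auto
  qed
  have T_lattice: "T i \<subseteq> char_lattice" if "i \<in> I" for i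
    using normalised_term_torus_ring[OF fi(1)[OF that] bk[OF that]] by (simp add: T_def torus_ring_def)
  define J where "J = insert None (Some ` I)"
  have V_lattice: "V q \<in> char_lattice" if "q \<in> J" for q
  proof (cases q)
    case None
    then show ?thesis using T_lattice[OF i0(1)] T_m[OF i0(1), of "V None"] by blast
  next
    case (Some i)
    then have "i \<in> I" using that by (auto simp: J_def)
    then show ?thesis using T_lattice[of i] T_m[of i "V (Some i)"] Some by blast
  qed
  have orthI: "v \<in> orth i" if v: "\<And>q. q \<in> J' \<Longrightarrow> dotp (V q) v = 0" "Some i \<in> J'" "i = i0 \<longrightarrow> None \<in> J'"
    and i: "i \<in> I" for v i J'
  proof -
    have "dotp (w - b i) v = 0" if "w \<in> m i" for w
    proof -
      have "dotp (0 :: int ^ 'n) v = 0" by (simp add: dotp_def)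
      then show ?thesis using m_iff[OF i, of w] that v by metis
    qed
    then have "dotp w v = dotp (b i) v" if "w \<in> m i" for w using that by (simp add: dotp_diff_left)
    then show ?thesis by (simp add: orth_def dotp_diff_left)
  qed
  have orthD: "dotp (V (Some i)) v = 0" if "v \<in> orth i" "i \<in> I" for v i
  proof -
    have "snd (p i) \<in> m i" using m_iff[OF that(2), of "snd (p i)"] by (simp add: V)
    then show ?thesis using that(1) bm[OF that(2)] by (simp add: orth_def V)
  qed
  have cardJ: "finite J" "card J + 1 = CARD('n)"
    unfolding J_def using n_pos by (auto simp: card_n card_image card_insert_if)
  have const: "\<exists>c. v = c *\<^sub>R 1" if v: "\<And>q. q \<in> J \<Longrightarrow> (\<Sum>j\<in>UNIV. of_int (V q $ j) * v $ j) = 0" for v :: "real ^ 'n"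
  proof (rule orth_constant)
    show "v \<in> orth i" if "i \<in> I" for i
      using that v by (intro orthI[of J]) (auto simp: dotp_def J_def)
  qed
  have "\<exists>(D :: nat option \<Rightarrow> rat ^ 'n) (C :: 'n \<Rightarrow> 'n \<Rightarrow> nat option \<Rightarrow> rat).
    (\<forall>p\<in>J. \<forall>q\<in>J. (\<Sum>j\<in>UNIV. of_int (V p $ j) * D q $ j) = (if p = q then 1 else 0)) \<and>
    (\<forall>k l j. (if j = k then 1 else 0) - (if j = l then 1 else 0) = (\<Sum>p\<in>J. C k l p * of_int (V p $ j)))"
    by (rule dual_basis[OF cardJ]) (use V_lattice const in blast)+
  then obtain D :: "nat option \<Rightarrow> rat ^ 'n" and C :: "'n \<Rightarrow> 'n \<Rightarrow> nat option \<Rightarrow> rat" where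
    DC: "\<forall>p\<in>J. \<forall>q\<in>J. (\<Sum>j\<in>UNIV. of_int (V p $ j) * D q $ j) = (if p = q then 1 else 0)"
    "\<forall>k l j. (if j = k then 1 else 0) - (if j = l then 1 else 0) = (\<Sum>p\<in>J. C k l p * of_int (V p $ j))"
    by blast
  \<comment> \<open>If both vanished, the difference of coordinates \<open>k\<close> and
    \<open>l\<close> would be a combination of the \<open>V (Some i)\<close> with
    \<open>i \<noteq> i0\<close>. By \<open>trop_points_near\<close> these are orthogonal to
    \<open>u - \<alpha>\<close> for all \<open>u\<close> in \<open>trop_points\<close> near
    \<open>\<alpha>\<close>, contrary to \<open>tame_point\<close>.\<close>
  have C_nz: "C k l (Some i0) \<noteq> 0 \<or> C k l None \<noteq> 0" if kl: "k \<noteq> l" for k l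
  proof (rule ccontr)
    assume "\<not> ?thesis"
    then have C0: "C k l (Some i0) = 0" "C k l None = 0" by auto
    have "\<forall>\<^sub>F u in nhds \<alpha>. \<forall>i\<in>I - {i0}. u \<in> trop_points \<longrightarrow> u - \<alpha> \<in> orth i \<and> min_terms val (f i) u = m i"
      using trop_points_near i0(3) by (intro eventually_ball_finite) auto
    then obtain S where S: "open S" "\<alpha> \<in> S" "\<And>u. u \<in> S \<Longrightarrow> \<forall>i\<in>I - {i0}. u \<in> trop_points \<longrightarrow> u - \<alpha> \<in> orth i \<and> min_terms val (f i) u = m i"
      unfolding eventually_nhds by blast
    obtain u where u: "u \<in> trop_points" "u \<in> S" "(u - \<alpha>) $ k \<noteq> (u - \<alpha>) $ l"
      using tame_point[OF S(1,2) kl] by blast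
    define v where "v = u - \<alpha>"
    have "C k l q = 0 \<or> dotp (V q) v = 0" if q: "q \<in> J" for q
    proof (cases q)
      case (Some i)
      then have "i \<in> I" using q by (auto simp: J_def)
      then show ?thesis using orthD[of v i] S(3)[OF u(2)] u(1) C0 Some by (cases "i = i0") (auto simp: v_def)
    qed (use C0 in simp)
    then have z: "of_rat (C k l q) * dotp (V q) v = 0" if "q \<in> J" for q using that by auto
    have "v $ k - v $ l = (\<Sum>j\<in>UNIV. of_rat ((if j = k then 1 else 0) - (if j = l then 1 else 0)) * v $ j)"
      by (simp add: of_rat_diff algebra_simps sum_subtractf if_distrib[of of_rat]
          if_distrib[of "\<lambda>z. _ * z"] cong: if_cong)
    also have "\<dots> = (\<Sum>j\<in>UNIV. \<Sum>p\<in>J. of_rat (C k l p) * (of_int (V p $ j) * v $ j))"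
      unfolding DC(2)[rule_format] by (simp only: of_rat_sum of_rat_mult of_rat_of_int_eq sum_distrib_right mult.assoc)
    also have "\<dots> = (\<Sum>p\<in>J. of_rat (C k l p) * dotp (V p) v)"
      by (subst sum.swap) (simp add: dotp_def sum_distrib_left)
    also have "\<dots> = 0" using z by (intro sum.neutral) blast
    finally show False using u(3) by (simp add: v_def)
  qed
  have conf: "vertex_configuration val I i0 T V D C"
  proof unfold_locales
    show "finite (T i)" for i by (simp add: T_def)
    show "0 \<in> T i" "V (Some i) \<in> T i" if "i \<in> I" for i using T_m[OF that] by auto
    show "V (Some i) \<noteq> 0" if "i \<in> I" for i using bspec[OF p that] by (auto simp: V b_def)
    show "V None \<in> T i0" using T_m[OF i0(1)] by auto
    show "V None \<noteq> 0" "V None \<noteq> V (Some i0)" using m0 p0 by (auto simp: V)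
    show "(\<Sum>j\<in>UNIV. of_int (V p $ j) * D q $ j) = (if p = q then 1 else 0)"
      if "p \<in> insert None (Some ` I)" "q \<in> insert None (Some ` I)" for p q
      using DC(1) that unfolding J_def by blast
    show "(if j = k then 1 else 0) - (if j = l then 1 else 0) = (\<Sum>p\<in>insert None (Some ` I). C k l p * of_int (V p $ j))"
      for k l j using DC(2) unfolding J_def by blast
  qed (use i0(1) T_lattice C_nz in auto)
  moreover have "vertex_configuration.admissible val I i0 T V (coefficient b Q)"
    if Q: "Q \<in> X \<inter> torus" "trop_eq \<alpha> (trop_point val Q)" for Q
  proof (rule vertex_configuration.admissibleI[OF conf])
    fix i assume i: "i \<in> I"
    have Qt: "Q \<in> X" "Q \<in> torus" using Q by auto
    have "leval (normalised_term (f i) (b i)) Q = 0"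
      using leval_normalised_term(1)[OF Qt(2) bk[OF i]] X_leval[OF Qt i] by simp
    then show "(\<Sum>w\<in>T i. coefficient b Q i w) = 0" by (simp add: leval_evf evf_def T_def coefficient_def)
    have mQ: "m i = min_terms val (f i) (trop_point val Q)"
      unfolding m_def by (rule min_terms_trop_eq[OF fi(1)[OF i] Q(2)])
    have v: "val (coefficient b Q i (v - b i)) =
        ereal (term_val val (f i) (trop_point val Q) v - term_val val (f i) (trop_point val Q) (b i))"
      if "v \<in> Poly_Mapping.keys (f i)" for v
      using val_term[OF Qt(2), of "v - b i" "normalised_term (f i) (b i)"] that
      by (simp add: coefficient_def keys_normalised_term[OF bk[OF i]] term_val_normalised_term[OF bk[OF i] that])
    fix w assume "w \<in> T i"
    then obtain v' where v': "v' \<in> Poly_Mapping.keys (f i)" "w = v' - b i" by (auto simp: T[OF i])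
    show "val (coefficient b Q i w) = 0" if "w = 0 \<or> w = V (Some i) \<or> i = i0 \<and> w = V None"
    proof -
      have "v' \<in> m i" using that m_iff[OF i, of v'] by (simp add: v'(2))
      then show ?thesis using min_terms_equal[of v' val "f i" "trop_point val Q" "b i"] bm[OF i] mQ v[OF v'(1)]
        by (simp add: v'(2) zero_ereal_def)
    qed
    show "vpos (coefficient b Q i w)" if "\<not> (w = 0 \<or> w = V (Some i) \<or> i = i0 \<and> w = V None)"
    proof -
      have nm: "v' \<notin> m i" using that m_iff[OF i, of v'] by (simp add: v'(2))
      have "term_val val (f i) (trop_point val Q) (b i) < term_val val (f i) (trop_point val Q) v'"
      proof (rule ccontr)
        assume "\<not> ?thesis"
        then have "v' \<in> m i" using bm[OF i] v'(1) unfolding mQ min_terms_def by force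
        then show False using nm by blast
      qed
      then show ?thesis using v[OF v'(1)] by (simp add: vpos_def v'(2))
    qed
  qed
  ultimately show ?thesis unfolding T_def using bk by blast
qed

definition base_point :: "'k ^ 'n \<Rightarrow> bool" where
  "base_point Q \<longleftrightarrow> Q \<in> X \<and> Q \<in> torus \<and> trop_eq \<alpha> (trop_point val Q)"

lemma tangent_iff: "base_point Q \<Longrightarrow> Q * a \<in> tangent_space X Q \<longleftrightarrow> (\<forall>i\<in>I. ldiff (f i) Q a = 0)"
  unfolding base_point_def using tangent_space_iff[OF ci] fi(1) by blast

lemma tangent_iff_normalised:
  assumes "base_point Q" "\<forall>i\<in>I. b i \<in> Poly_Mapping.keys (f i)"
  shows "Q * a \<in> tangent_space X Q \<longleftrightarrow>
    (\<forall>i\<in>I. (\<Sum>w\<in>Poly_Mapping.keys (normalised_term (f i) (b i)). coefficient b Q i w * ip w a) = 0)"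
proof -
  have "ldiff (f i) Q a = 0 \<longleftrightarrow>
      (\<Sum>w\<in>Poly_Mapping.keys (normalised_term (f i) (b i)). coefficient b Q i w * ip w a) = 0" if i: "i \<in> I" for i
  proof -
    have Q: "Q \<in> X" "Q \<in> torus" using assms(1) by (auto simp: base_point_def)
    have "ldiff (normalised_term (f i) (b i)) Q a = 0 \<longleftrightarrow> ldiff (f i) Q a = 0"
      using leval_normalised_term(2)[OF Q(2) _ X_leval[OF Q i]] assms(2) i by blast
    then show ?thesis by (simp add: ldiff_def evf_def coefficient_def mult.assoc)
  qed
  then show ?thesis unfolding tangent_iff[OF assms(1)] by blast
qed

lemma tangent_self: assumes "base_point Q" shows "Q \<in> tangent_space X Q"
proof -
  have "ldiff (f i) Q 1 = 0" if "i \<in> I" for i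
  proof -
    have "ip w 1 = (0 :: 'k)" if "w \<in> Poly_Mapping.keys (f i)" for w
      using fi(1)[OF \<open>i \<in> I\<close>] that by (intro ip_one) (auto simp: torus_ring_def)
    then show ?thesis by (simp add: ldiff_def evf_def)
  qed
  then have "Q * 1 \<in> tangent_space X Q" unfolding tangent_iff[OF assms] by blast
  then show ?thesis by simp
qed

text \<open>In logarithmic coordinates at \<open>Q\<close> the tangent space is the common kernel of
  the forms \<open>L\<close>, which \<open>kernel_dimension\<close> describes.\<close>

lemma tangent_space_span:
  assumes Q: "base_point Q" and a: "Q * a \<in> tangent_space X Q" "a $ k \<noteq> a $ l"
  shows "tangent_space X Q = vec.span {Q, Q * a}"
proof -
  obtain i0 b V D C where conf: "vertex_configuration val I i0 (\<lambda>i. Poly_Mapping.keys (normalised_term (f i) (b i))) V D C"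
    and b: "\<forall>i\<in>I. b i \<in> Poly_Mapping.keys (f i)"
    and adm: "\<forall>Q\<in>X \<inter> torus. trop_eq \<alpha> (trop_point val Q) \<longrightarrow>
        vertex_configuration.admissible val I i0 (\<lambda>i. Poly_Mapping.keys (normalised_term (f i) (b i))) V (coefficient b Q)"
    using configuration by blast
  interpret conf: vertex_configuration val I i0 "\<lambda>i. Poly_Mapping.keys (normalised_term (f i) (b i))" V D C
    by (rule conf)
  have tL: "Q * v \<in> tangent_space X Q \<longleftrightarrow> (\<forall>i\<in>I. conf.L (coefficient b Q) i v = 0)" for v
    unfolding tangent_iff_normalised[OF Q b] conf.L_def ..
  have Qt: "Q \<in> torus" using Q by (simp add: base_point_def)
  have adm': "conf.admissible (coefficient b Q)" using adm Q by (auto simp: base_point_def)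
  show ?thesis
  proof (intro set_eqI iffI)
    fix y assume y: "y \<in> tangent_space X Q"
    define v where "v = (\<chi> j. y $ j / Q $ j)"
    have yv: "y = Q * v" using Qt by (simp add: v_def vec_eq_iff torus_def)
    have La: "conf.L (coefficient b Q) i a = 0" if "i \<in> I" for i using a(1) that unfolding tL by blast
    have Lv: "conf.L (coefficient b Q) i v = 0" if "i \<in> I" for i
      using y that unfolding yv tL by blast
    obtain c e where ce: "v = c *s a + e *s 1"
      by (rule conf.kernel_dimension[OF adm' La a(2) Lv])
    have "y = e *s Q + c *s (Q * a)" unfolding yv ce by (simp add: vec_eq_iff algebra_simps)
    then show "y \<in> vec.span {Q, Q * a}" unfolding vec_span_pair by blast
  next
    fix y assume "y \<in> vec.span {Q, Q * a}"
    then obtain c e where "y = c *s Q + e *s (Q * a)" unfolding vec_span_pair by blast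
    then have y: "y = Q * (c *s 1 + e *s a)" by (simp add: vec_eq_iff algebra_simps)
    have "conf.L (coefficient b Q) i (c *s 1 + e *s a) = 0" if "i \<in> I" for i
    proof -
      have "conf.L (coefficient b Q) i (c *s 1 + e *s a)
          = c * conf.L (coefficient b Q) i 1 + e * conf.L (coefficient b Q) i a"
        by (simp add: conf.L_def ip_add ip_scale algebra_simps sum.distrib sum_distrib_left)
      then show ?thesis using conf.L_one[OF that] a(1) that unfolding tL by simp
    qed
    then show "y \<in> tangent_space X Q" unfolding y tL by blast
  qed
qed

text \<open>Relative coordinates are undone by \<open>Q' = Q * x\<close>, which multiplies
  \<open>coefficient b Q i w\<close> by \<open>lmono x w\<close>. As \<open>x\<close> is close to
  \<open>1\<close>, the new point still lies over \<open>\<alpha>\<close>.\<close>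

lemma deformed_base_point:
  assumes Q: "base_point Q" and a: "Q * a \<in> tangent_space X Q" "\<And>j. vge 0 (a $ j)"
    "val (a $ k' - a $ l') = 0" and t: "val t = ereal s" "s > 0"
  shows "\<exists>Q' a'. base_point Q' \<and> Q' * a' \<in> tangent_space X Q' \<and>
     (\<forall>k l. k \<noteq> l \<longrightarrow> val (a' $ k - a' $ l) = min (val (a $ k - a $ l)) (ereal s))"
proof -
  obtain i0 b V D C where conf: "vertex_configuration val I i0 (\<lambda>i. Poly_Mapping.keys (normalised_term (f i) (b i))) V D C"
    and b: "\<forall>i\<in>I. b i \<in> Poly_Mapping.keys (f i)"
    and adm: "\<forall>Q\<in>X \<inter> torus. trop_eq \<alpha> (trop_point val Q) \<longrightarrow>
        vertex_configuration.admissible val I i0 (\<lambda>i. Poly_Mapping.keys (normalised_term (f i) (b i))) V (coefficient b Q)"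
    using configuration by blast
  interpret conf: vertex_configuration val I i0 "\<lambda>i. Poly_Mapping.keys (normalised_term (f i) (b i))" V D C
    by (rule conf)
  have Qt: "Q \<in> X" "Q \<in> torus" "trop_eq \<alpha> (trop_point val Q)" using Q by (auto simp: base_point_def)
  have adm': "conf.admissible (coefficient b Q)" using adm Qt by blast
  have La: "conf.L (coefficient b Q) i a = 0" if "i \<in> I" for i
    using a(1) that unfolding tangent_iff_normalised[OF Q b] conf.L_def by blast
  have "\<exists>x a'. (\<forall>j. vge s (x $ j - 1)) \<and>
    (\<forall>i\<in>I. (\<Sum>w\<in>Poly_Mapping.keys (normalised_term (f i) (b i)). coefficient b Q i w * lmono x w) = 0 \<and>
      (\<Sum>w\<in>Poly_Mapping.keys (normalised_term (f i) (b i)). coefficient b Q i w * lmono x w * ip w a') = 0) \<and>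
    (\<forall>k l. k \<noteq> l \<longrightarrow> val (a' $ k - a' $ l) = min (val (a $ k - a $ l)) (ereal s))"
    by (rule conf.deformation[OF adm' a(2) La a(3) t])
  then obtain x a' where xa: "(\<forall>j. vge s (x $ j - 1)) \<and>
    (\<forall>i\<in>I. (\<Sum>w\<in>Poly_Mapping.keys (normalised_term (f i) (b i)). coefficient b Q i w * lmono x w) = 0 \<and>
      (\<Sum>w\<in>Poly_Mapping.keys (normalised_term (f i) (b i)). coefficient b Q i w * lmono x w * ip w a') = 0) \<and>
    (\<forall>k l. k \<noteq> l \<longrightarrow> val (a' $ k - a' $ l) = min (val (a $ k - a $ l)) (ereal s))"
    by (elim exE) (rule that)
  have x: "vge s (x $ j - 1)"
    "i \<in> I \<Longrightarrow> (\<Sum>w\<in>Poly_Mapping.keys (normalised_term (f i) (b i)). coefficient b Q i w * lmono x w) = 0"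
    "i \<in> I \<Longrightarrow> (\<Sum>w\<in>Poly_Mapping.keys (normalised_term (f i) (b i)). coefficient b Q i w * lmono x w * ip w a') = 0"
    for i j using xa by simp_all
  have a': "\<forall>k l. k \<noteq> l \<longrightarrow> val (a' $ k - a' $ l) = min (val (a $ k - a $ l)) (ereal s)"
    using xa by (elim conjE)
  have xt: "x \<in> torus" by (rule near_1_torus[OF t(2) x(1)])
  define Q' where "Q' = Q * x"
  have Q't: "Q' \<in> torus" using Qt(2) xt by (simp add: Q'_def torus_def)
  have coeff: "coefficient b Q' i w = coefficient b Q i w * lmono x w" for i w
    by (simp add: coefficient_def Q'_def lmono_mult)
  have "leval (f i) Q' = 0" if "i \<in> I" for i
  proof -
    have "leval (normalised_term (f i) (b i)) Q' = 0"
      using x(2)[OF that] by (simp add: leval_evf evf_def coefficient_def[symmetric] coeff)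
    then show ?thesis using leval_normalised_term(1)[OF Q't] b that by blast
  qed
  then have "Q' \<in> X"
    using ci Q't unfolding torus_complete_intersection_def by (auto simp: hypersurface_def)
  moreover have "trop_point val Q' = trop_point val Q"
  proof -
    have "val (x $ j) = 0" for j by (rule val_eq_0_close[OF val_1 x(1) t(2)])
    then show ?thesis by (simp add: trop_point_def Q'_def val_mult vec_eq_iff)
  qed
  ultimately have Q': "base_point Q'" using Q't Qt(3) by (simp add: base_point_def)
  moreover have "Q' * a' \<in> tangent_space X Q'"
    unfolding tangent_iff_normalised[OF Q' b] coeff using x(3) by blast
  ultimately show ?thesis using a' by blast
qed

end

section \<open>Tropical lines through a torus point\<close>

lemma min_attained_twiceI:
  assumes "\<not> (a < b \<and> a < c)" "\<not> (b < a \<and> b < c)" "\<not> (c < a \<and> c < b)"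
  shows "min_attained_twice a b c"
  using assms unfolding min_attained_twice_def by (metis antisym_conv3 less_imp_le linear not_less order_trans)

lemma min_attained_twice_not_less:
  assumes "min_attained_twice a b c"
  shows "\<not> (a < b \<and> a < c)" "\<not> (b < a \<and> b < c)" "\<not> (c < a \<and> c < b)"
  using assms unfolding min_attained_twice_def by auto

lemma min_attained_twice_shift:
  "min_attained_twice (a + ereal r) (b + ereal r) (c + ereal r) \<longleftrightarrow> min_attained_twice a b c"
proof -
  have "x + ereal r \<le> y + ereal r \<longleftrightarrow> x \<le> y" "x + ereal r = y + ereal r \<longleftrightarrow> x = y" for x y
    by (cases x; cases y; simp)+
  then show ?thesis by (simp add: min_attained_twice_def)
qed

lemma (in valued_field) val_zero_sum:
  assumes "x + y + z = 0" shows "min_attained_twice (val x) (val y) (val z)"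
proof -
  have "\<not> (val a < val b \<and> val a < val c)" if "a + b + c = 0" for a b c
  proof
    assume "val a < val b \<and> val a < val c"
    then have "val a < min (val b) (val c)" by simp
    also have "\<dots> \<le> val (b + c)" by (rule val_add)
    also have "b + c = - a" using that by (simp add: eq_neg_iff_add_eq_0 add.commute add.left_commute)
    finally show False by simp
  qed
  from this[of x y z] this[of y x z] this[of z x y] show ?thesis
    using assms by (intro min_attained_twiceI) (auto simp: algebra_simps)
qed

text \<open>The tropical line of an ultrametric \<open>\<delta>\<close> is the rooted tree of \<open>\<delta>\<close>: its points are given by a
  leaf \<open>i\<close> and a height \<open>s\<close>.\<close>

lemma tropical_tree:
  fixes \<delta> :: "'n::finite \<Rightarrow> 'n \<Rightarrow> ereal" and y :: "'n \<Rightarrow> real"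
  assumes sym: "\<And>i j. \<delta> i j = \<delta> j i" and nonneg: "\<And>i j. i \<noteq> j \<Longrightarrow> 0 \<le> \<delta> i j"
    and ultra: "\<And>i j k. min (\<delta> i k) (\<delta> j k) \<le> \<delta> i j"
    and zero: "k0 \<noteq> l0" "\<delta> k0 l0 = 0"
    and line: "\<And>i j k. i \<noteq> j \<Longrightarrow> i \<noteq> k \<Longrightarrow> j \<noteq> k \<Longrightarrow>
      min_attained_twice (\<delta> i j + ereal (y k)) (\<delta> i k + ereal (y j)) (\<delta> j k + ereal (y i))"
  shows "\<exists>i s c. s \<ge> 0 \<and> y i = c + s \<and> (\<forall>j. j \<noteq> i \<longrightarrow> ereal (y j - c) = min (\<delta> i j) (ereal s))"
proof -
  have fin: "finite (range y)" "range y \<noteq> {}" by auto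
  \<comment> \<open>A smallest coordinate gives the level \<open>c\<close> of the root, a largest
    one the leaf \<open>i\<close>, and their difference the height \<open>s\<close>.\<close>
  obtain k where k: "\<And>j. y k \<le> y j" using Min_in[OF fin] Min_le[OF fin(1)] by (metis imageE rangeI)
  obtain i where i: "\<And>j. y j \<le> y i" using Max_in[OF fin] Max_ge[OF fin(1)] by (metis imageE rangeI)
  define c s where "c = y k" and "s = y i - c"
  have s0: "s \<ge> 0" using k[of i] by (simp add: s_def c_def)
  have "ereal (y j - c) = min (\<delta> i j) (ereal s)" if j: "j \<noteq> i" for j
  proof (cases "s = 0")
    case True
    then have "y j = c" using i[of j] k[of j] by (simp add: s_def c_def)
    then show ?thesis using nonneg[of i j] j True by (simp add: min_absorb2 flip: zero_ereal_def)
  next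
    case False
    then have s: "s > 0" using s0 by simp
    then have ki: "k \<noteq> i" by (auto simp: s_def c_def)
    obtain l where l: "l \<noteq> i" "\<delta> i l = 0"
    proof (cases "i = k0 \<or> i = l0")
      case True
      then show ?thesis using zero sym[of k0 l0] that[of l0] that[of k0] by auto
    next
      case False
      have "\<delta> k0 i \<le> 0 \<or> \<delta> l0 i \<le> 0" using ultra[of k0 i l0] zero(2) by (simp add: min_le_iff_disj)
      then have "\<delta> i k0 = 0 \<or> \<delta> i l0 = 0"
        using nonneg[of i k0] nonneg[of i l0] False sym[of i k0] sym[of i l0] by auto
      then show ?thesis using that[of k0] that[of l0] False by auto
    qed
    \<comment> \<open>The smallest coordinate also separates from \<open>i\<close> at the root,
      which reduces each relation for \<open>i\<close>, \<open>j\<close>, \<open>k\<close> to a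
      comparison of \<open>\<delta> i j\<close> with \<open>y j\<close>.\<close>
    have ik: "\<delta> i k = 0"
    proof (cases "l = k")
      case False
      have C: "ereal (y k) < \<delta> l k + ereal (y i)"
        using nonneg[OF False] s by (cases "\<delta> l k") (auto simp: s_def c_def)
      have "\<not> (ereal (y k) < \<delta> i k + ereal (y l) \<and> ereal (y k) < \<delta> l k + ereal (y i))"
        using min_attained_twice_not_less(1)[OF line[of i l k]] l ki False by auto
      then have "\<delta> i k + ereal (y l) \<le> ereal (y k)" using C by simp
      then have "\<delta> i k \<le> 0" using k[of l] by (cases "\<delta> i k") (auto simp: zero_ereal_def)
      then show ?thesis using nonneg[of i k] ki by auto
    qed (use l in simp)
    show ?thesis
    proof (cases "j = k")
      case True
      then show ?thesis using ik s by (simp add: c_def min_absorb1 zero_ereal_def)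
    next
      case False
      have L: "min_attained_twice (\<delta> i j + ereal c) (ereal (y j)) (\<delta> j k + ereal (y i))"
        using line[of i j k] j ki False ik by (simp add: c_def)
      have jk: "0 \<le> \<delta> j k" using nonneg[OF False] .
      show ?thesis
      proof (cases "y j = y i")
        case True
        have "\<not> \<delta> i j < ereal s"
        proof
          assume "\<delta> i j < ereal s"
          then have "\<delta> i j + ereal c < ereal (y j)" using True by (cases "\<delta> i j") (auto simp: s_def)
          moreover have "ereal (y j) \<le> \<delta> j k + ereal (y i)" using jk True by (cases "\<delta> j k") auto
          ultimately show False using min_attained_twice_not_less(1)[OF L] by auto
        qed
        then show ?thesis using True by (simp add: s_def min_absorb2)
      next
        case False
        then have lt: "y j < y i" using i[of j] by simp
        then have "ereal (y j) < \<delta> j k + ereal (y i)" using jk by (cases "\<delta> j k") auto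
        then have "\<delta> i j + ereal c = ereal (y j)"
          using L unfolding min_attained_twice_def by auto
        then have "\<delta> i j = ereal (y j - c)" by (cases "\<delta> i j") auto
        then show ?thesis using lt by (simp add: s_def)
      qed
    qed
  qed
  moreover have "y i = c + s" by (simp add: s_def)
  ultimately show ?thesis using s0 by blast
qed

lemma (in valued_field) tropical_ray:
  fixes a :: "'k ^ 'n" and y d :: "'n \<Rightarrow> real"
  assumes d: "\<And>j. j \<noteq> i \<Longrightarrow> val (a $ i - a $ j) = ereal (d j)"
    and y: "\<And>j. j \<noteq> i \<Longrightarrow> y j = c + d j" "y i = c + s" and s: "\<And>j. j \<noteq> i \<Longrightarrow> d j \<le> s"
    and pqr: "p \<noteq> q" "p \<noteq> r" "q \<noteq> r"
  shows "min_attained_twice (val (a $ p - a $ q) + ereal (y r)) (val (a $ p - a $ r) + ereal (y q))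
      (val (a $ q - a $ r) + ereal (y p))"
proof -
  have d': "val (a $ j - a $ i) = ereal (d j)" if "j \<noteq> i" for j
    using d[OF that] val_diff_commute by metis
  \<comment> \<open>In a triple containing \<open>i\<close>, the two terms with a difference at
    \<open>i\<close> agree; the third, in which \<open>i\<close> supplies the coordinate, is no
    smaller by the ultrametric inequality.\<close>
  have big: "ereal (d j + d k + c) \<le> val (a $ j - a $ k) + ereal (y i)" if "j \<noteq> i" "k \<noteq> i" for j k
  proof -
    have "min (val (a $ j - a $ i)) (val (a $ i - a $ k)) \<le> val (a $ j - a $ k)"
      using val_add[of "a $ j - a $ i" "a $ i - a $ k"] by simp
    then have "ereal (min (d j) (d k)) \<le> val (a $ j - a $ k)" using d d' that by simp
    then show ?thesis using s[OF that(1)] s[OF that(2)] y(2)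
      by (cases "val (a $ j - a $ k)") (auto simp: min_def split: if_splits)
  qed
  consider "p = i" | "q = i" | "r = i" | "p \<noteq> i" "q \<noteq> i" "r \<noteq> i" by blast
  then show ?thesis
  proof cases
    case 1
    then show ?thesis using pqr d y(1) big[of q r] by (auto simp: min_attained_twice_def algebra_simps)
  next
    case 2
    then show ?thesis using pqr d d' y(1) big[of p r] by (auto simp: min_attained_twice_def algebra_simps)
  next
    case 3
    then show ?thesis using pqr d' y(1) big[of p q] by (auto simp: min_attained_twice_def algebra_simps)
  next
    case 4
    \<comment> \<open>The three-term Pluecker relation for \<open>p\<close>, \<open>q\<close>,
      \<open>r\<close>, \<open>i\<close>.\<close>
    have "min_attained_twice (val ((a $ p - a $ q) * (a $ i - a $ r))) (val (- ((a $ p - a $ r) * (a $ i - a $ q))))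
        (val ((a $ q - a $ r) * (a $ i - a $ p)))"
      by (rule val_zero_sum) (simp add: algebra_simps)
    then have "min_attained_twice (val (a $ p - a $ q) + ereal (d r)) (val (a $ p - a $ r) + ereal (d q))
        (val (a $ q - a $ r) + ereal (d p))"
      by (simp add: val_mult d 4)
    then have "min_attained_twice (val (a $ p - a $ q) + ereal (d r) + ereal c)
        (val (a $ p - a $ r) + ereal (d q) + ereal c) (val (a $ q - a $ r) + ereal (d p) + ereal c)"
      by (simp only: min_attained_twice_shift)
    moreover have "v + ereal e + ereal c = v + ereal (c + e)" for v :: ereal and e
      by (cases v) auto
    ultimately show ?thesis by (simp add: y(1) 4)
  qed
qed

section \<open>Tropical tangents of the curve and their rays\<close>

context curve_vertex
begin

text \<open>\<open>a\<close> is normalised so that the least valuation of a coordinate difference is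
  \<open>0\<close>, and \<open>\<kappa>\<close> is the free additive constant; by
  \<open>normalised_pluecker_iff\<close> the normalisation of \<open>\<beta>\<close> amounts to
  \<open>\<kappa> = 0\<close>.\<close>

definition tangent_data :: "'k ^ 'n \<Rightarrow> 'k ^ 'n \<Rightarrow> real \<Rightarrow> ('n \<Rightarrow> 'n \<Rightarrow> ereal) \<Rightarrow> bool" where
  "tangent_data Q a \<kappa> \<beta> \<longleftrightarrow> base_point Q \<and> Q * a \<in> tangent_space X Q \<and> (\<forall>j. vge 0 (a $ j)) \<and>
     (\<exists>k l. k \<noteq> l \<and> val (a $ k - a $ l) = 0) \<and>
     (\<forall>i j. i \<noteq> j \<longrightarrow> \<beta> i j = ereal (\<alpha> $ i + \<alpha> $ j + \<kappa>) + val (a $ i - a $ j))"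

lemma val_base_point:
  assumes "base_point Q" shows "\<exists>c. \<forall>j. val (Q $ j) = ereal (\<alpha> $ j + c)"
proof -
  obtain c where c: "\<alpha> = trop_point val Q + c *\<^sub>R 1" using assms by (auto simp: base_point_def trop_eq_def)
  have "Q \<in> torus" using assms by (simp add: base_point_def)
  then have "val (Q $ j) = ereal (\<alpha> $ j + (- c))" for j using val_trop_point[of Q j] by (simp add: c)
  then show ?thesis by blast
qed

text \<open>\<open>Q\<close> lies in its own tangent space, so it can replace one of the spanning
  vectors \<open>u\<close> and \<open>v\<close>, and the exchange multiplies all Pluecker
  coordinates by one scalar. The case distinction decides which vector is kept as
  \<open>Q * a\<close>.\<close>

lemma pluecker_direction:
  assumes Q: "base_point Q" and p: "pluecker_coords (tangent_space X Q) p"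
  shows "\<exists>a z. z \<noteq> 0 \<and> Q * a \<in> tangent_space X Q \<and> (\<exists>k l. a $ k \<noteq> a $ l) \<and>
     (\<forall>i j. p i j = z * (Q $ i * Q $ j * (a $ j - a $ i)))"
proof -
  obtain u v where uv: "u \<noteq> v" "vec.independent {u, v}" "vec.span {u, v} = tangent_space X Q"
    "\<forall>i j. p i j = u $ i * v $ j - u $ j * v $ i" using p unfolding pluecker_coords_def by blast
  have ind: "v \<noteq> 0" "\<And>c. u \<noteq> c *s v" using uv(2) unfolding vec_independent_pair[OF uv(1)] by auto
  have Q0: "Q $ j \<noteq> 0" for j using Q by (auto simp: base_point_def torus_def)
  obtain x y where xy: "Q = x *s u + y *s v"
    using tangent_self[OF Q] unfolding uv(3)[symmetric] vec_span_pair by blast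
  have uT: "u \<in> tangent_space X Q" "v \<in> tangent_space X Q"
    unfolding uv(3)[symmetric] by (auto intro: vec.span_base)
  show ?thesis
  proof (cases "x = 0")
    case False
    define a where "a = (\<chi> j. v $ j / Q $ j)"
    have Qa: "Q * a = v" using Q0 by (simp add: a_def vec_eq_iff)
    have "\<exists>k l. a $ k \<noteq> a $ l"
    proof (rule ccontr)
      assume "\<not> ?thesis"
      then obtain c where "\<And>j. a $ j = c" by metis
      then have vc: "v = c *s Q" using Qa by (simp add: vec_eq_iff mult.commute)
      then have c: "c \<noteq> 0" using ind(1) by auto
      have "x * u $ j = (1 / c - y) * v $ j" for j
      proof -
        have "v $ j = c * Q $ j" using vc by simp
        then have "Q $ j = v $ j / c" using c by (simp add: field_simps)
        moreover have "Q $ j = x * u $ j + y * v $ j" using xy by simp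
        ultimately show ?thesis by (simp add: algebra_simps)
      qed
      then have "u $ j = ((1 / c - y) / x) * v $ j" for j using False by (simp add: field_simps)
      then have "u = ((1 / c - y) / x) *s v" by (simp add: vec_eq_iff)
      then show False using ind(2) by blast
    qed
    moreover have "p i j = inverse x * (Q $ i * Q $ j * (a $ j - a $ i))" for i j
    proof -
      have "Q $ i * Q $ j * (a $ j - a $ i) = Q $ i * v $ j - Q $ j * v $ i"
        using Q0[of i] Q0[of j] by (simp add: a_def field_simps)
      also have "\<dots> = x * p i j" unfolding uv(4)[rule_format] by (simp add: xy algebra_simps)
      finally show ?thesis using False by simp
    qed
    ultimately show ?thesis using False uT(2) Qa by (intro exI[of _ a] exI[of _ "inverse x"]) simp
  next
    case True
    then have Qy: "Q = y *s v" using xy by simp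
    have y0: "y \<noteq> 0" using Q0 Qy by auto
    define a where "a = (\<chi> j. u $ j / Q $ j)"
    have Qa: "Q * a = u" using Q0 by (simp add: a_def vec_eq_iff)
    have "\<exists>k l. a $ k \<noteq> a $ l"
    proof (rule ccontr)
      assume "\<not> ?thesis"
      then obtain c where "\<And>j. a $ j = c" by metis
      then have "u = c *s Q" using Qa by (simp add: vec_eq_iff mult.commute)
      also have "\<dots> = (c * y) *s v" by (simp add: Qy)
      finally show False using ind(2) by blast
    qed
    moreover have "p i j = (- inverse y) * (Q $ i * Q $ j * (a $ j - a $ i))" for i j
    proof -
      have "Q $ i * Q $ j * (a $ j - a $ i) = Q $ i * u $ j - Q $ j * u $ i"
        using Q0[of i] Q0[of j] by (simp add: a_def field_simps)
      also have "\<dots> = - y * p i j" unfolding uv(4)[rule_format] by (simp add: Qy algebra_simps)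
      finally show ?thesis using y0 by simp
    qed
    ultimately show ?thesis using y0 uT(1) Qa by (intro exI[of _ a] exI[of _ "- inverse y"]) simp
  qed
qed

lemma tropical_tangent_data:
  assumes "\<beta> \<in> tropical_tangents val X \<alpha>" shows "\<exists>Q a \<kappa>. tangent_data Q a \<kappa> \<beta>"
proof -
  obtain Q p c0 where Qp: "smooth_point X Q" "Q \<in> torus" "trop_eq (trop_point val Q) \<alpha>"
    "pluecker_coords (tangent_space X Q) p" "\<And>i j. i \<noteq> j \<Longrightarrow> \<beta> i j = val (p i j) + ereal c0"
    using assms unfolding tropical_tangents_def by blast
  have Q: "base_point Q" using Qp trop_eq_sym by (auto simp: base_point_def smooth_point_def)
  obtain a z where az: "z \<noteq> 0" "Q * a \<in> tangent_space X Q" "\<exists>k l. a $ k \<noteq> a $ l"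
    "\<And>i j. p i j = z * (Q $ i * Q $ j * (a $ j - a $ i))"
    using pluecker_direction[OF Q Qp(4)] by blast
  obtain c1 where c1: "\<And>j. val (Q $ j) = ereal (\<alpha> $ j + c1)" using val_base_point[OF Q] by blast
  obtain z' where z': "val z = ereal z'" using val_finite[OF az(1)] .
  obtain k0 l0 where kl0: "a $ k0 \<noteq> a $ l0" using az(3) by blast
  obtain c e k l where n: "c \<noteq> 0" "k \<noteq> l" "\<And>j. vge 0 ((c *s (a - e *s 1)) $ j)"
    "val ((c *s (a - e *s 1)) $ k - (c *s (a - e *s 1)) $ l) = 0"
    using normalise_direction[OF kl0] by metis
  define a' where "a' = c *s (a - e *s 1)"
  obtain c' where c': "val c = ereal c'" using val_finite[OF n(1)] .
  have diff: "val (a' $ i - a' $ j) = ereal c' + val (a $ i - a $ j)" for i j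
  proof -
    have "a' $ i - a' $ j = c * (a $ i - a $ j)" by (simp add: a'_def algebra_simps)
    then show ?thesis by (simp add: val_mult c')
  qed
  have "Q * a' \<in> tangent_space X Q"
  proof -
    have "Q * a' = (- c * e) *s Q + c *s (Q * a)" by (simp add: a'_def vec_eq_iff algebra_simps)
    then show ?thesis unfolding tangent_space_span[OF Q az(2) kl0] vec_span_pair by blast
  qed
  moreover have "\<beta> i j = ereal (\<alpha> $ i + \<alpha> $ j + (z' + 2 * c1 + c0 - c')) + val (a' $ i - a' $ j)" if "i \<noteq> j" for i j
  proof -
    have "\<beta> i j = ereal z' + (ereal (\<alpha> $ i + c1) + ereal (\<alpha> $ j + c1) + val (a $ i - a $ j)) + ereal c0"
      using Qp(5)[OF that] by (simp add: az(4) val_mult z' c1 val_diff_commute[of "a $ j" "a $ i"])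
    then show ?thesis unfolding diff by (cases "val (a $ i - a $ j)") (auto simp: algebra_simps)
  qed
  ultimately have "tangent_data Q a' (z' + 2 * c1 + c0 - c') \<beta>"
    using Q n(2,3,4) unfolding tangent_data_def a'_def[symmetric] by blast
  then show ?thesis by blast
qed

text \<open>Smoothness comes for free: \<open>a\<close> is not constant, so
  \<open>tangent_space_span\<close> gives a tangent space of dimension two.\<close>

lemma tangent_data_tropical_tangent:
  assumes "tangent_data Q a \<kappa> \<beta>" shows "\<beta> \<in> tropical_tangents val X \<alpha>"
proof -
  have Q: "base_point Q" and a: "Q * a \<in> tangent_space X Q"
    and \<beta>: "\<And>i j. i \<noteq> j \<Longrightarrow> \<beta> i j = ereal (\<alpha> $ i + \<alpha> $ j + \<kappa>) + val (a $ i - a $ j)"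
    using assms unfolding tangent_data_def by blast+
  obtain k l where "val (a $ k - a $ l) = 0" using assms unfolding tangent_data_def by blast
  then have kl: "a $ k \<noteq> a $ l" by auto
  have Q0: "Q $ j \<noteq> 0" for j using Q by (auto simp: base_point_def torus_def)
  note sp = tangent_space_span[OF Q a kl]
  have ne: "Q \<noteq> Q * a"
  proof
    assume "Q = Q * a"
    then have "Q $ j = Q $ j * a $ j" for j by (metis vector_mult_component)
    then have "a $ j = 1" for j using Q0[of j] by (metis mult_cancel_left2)
    then show False using kl by simp
  qed
  have ind: "vec.independent {Q, Q * a}"
    unfolding vec_independent_pair[OF ne]
  proof (intro conjI allI notI)
    assume "Q * a = 0"
    then have "a $ j = 0" for j using Q0[of j] by (auto simp: vec_eq_iff)
    then show False using kl by simp
  next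
    fix c assume "Q = c *s (Q * a)"
    then have "Q $ j = c * (Q $ j * a $ j)" for j by (metis vector_mult_component vector_smult_component)
    then have 1: "c * a $ j = 1" for j using Q0[of j] by (metis mult.left_commute mult_cancel_left2)
    then have "c \<noteq> 0" by auto
    then show False using 1[of k] 1[of l] kl by (metis mult_left_cancel)
  qed
  have "vec.dim (tangent_space X Q) = 2"
    unfolding sp vec.dim_span_eq_card_independent[OF ind] using ne by simp
  then have smooth: "smooth_point X Q" using Q by (simp add: smooth_point_def base_point_def)
  define p where "p i j = Q $ i * (Q * a) $ j - Q $ j * (Q * a) $ i" for i j
  have pl: "pluecker_coords (tangent_space X Q) p"
    unfolding pluecker_coords_def p_def using ne ind sp by blast
  obtain c1 where c1: "\<And>j. val (Q $ j) = ereal (\<alpha> $ j + c1)" using val_base_point[OF Q] by blast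
  have "\<beta> i j = val (p i j) + ereal (\<kappa> - 2 * c1)" if "i \<noteq> j" for i j
  proof -
    have "p i j = Q $ i * Q $ j * (a $ j - a $ i)" by (simp add: p_def algebra_simps)
    then have "val (p i j) = ereal (\<alpha> $ i + c1) + ereal (\<alpha> $ j + c1) + val (a $ i - a $ j)"
      by (simp add: val_mult c1 val_diff_commute[of "a $ j" "a $ i"])
    then show ?thesis unfolding \<beta>[OF that] by (cases "val (a $ i - a $ j)") auto
  qed
  then show ?thesis
    using smooth pl Q trop_eq_sym unfolding tropical_tangents_def base_point_def by blast
qed

text \<open>All three terms contain the summand
  \<open>\<alpha> $ i + \<alpha> $ j + \<alpha> $ k + \<kappa>\<close>, which cancels.\<close>

lemma tropical_line_iff:
  assumes "tangent_data Q a \<kappa> \<beta>"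
  shows "x \<in> tropical_line \<beta> \<longleftrightarrow> (\<forall>i j k. i \<noteq> j \<and> i \<noteq> k \<and> j \<noteq> k \<longrightarrow>
    min_attained_twice (val (a $ i - a $ j) + ereal ((x - \<alpha>) $ k)) (val (a $ i - a $ k) + ereal ((x - \<alpha>) $ j))
      (val (a $ j - a $ k) + ereal ((x - \<alpha>) $ i)))"
proof -
  have \<beta>: "\<beta> i j = ereal (\<alpha> $ i + \<alpha> $ j + \<kappa>) + val (a $ i - a $ j)" if "i \<noteq> j" for i j
    using assms that unfolding tangent_data_def by blast
  have t: "\<beta> i j + ereal (x $ k) = val (a $ i - a $ j) + ereal ((x - \<alpha>) $ k) + ereal (\<alpha> $ i + \<alpha> $ j + \<alpha> $ k + \<kappa>)"
    if "i \<noteq> j" for i j k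
    unfolding \<beta>[OF that] by (cases "val (a $ i - a $ j)") auto
  have "min_attained_twice (\<beta> i j + ereal (x $ k)) (\<beta> i k + ereal (x $ j)) (\<beta> j k + ereal (x $ i)) \<longleftrightarrow>
    min_attained_twice (val (a $ i - a $ j) + ereal ((x - \<alpha>) $ k)) (val (a $ i - a $ k) + ereal ((x - \<alpha>) $ j))
      (val (a $ j - a $ k) + ereal ((x - \<alpha>) $ i))" if "i \<noteq> j" "i \<noteq> k" "j \<noteq> k" for i j k
  proof -
    have e: "\<alpha> $ i + \<alpha> $ k + \<alpha> $ j + \<kappa> = \<alpha> $ i + \<alpha> $ j + \<alpha> $ k + \<kappa>"
      "\<alpha> $ j + \<alpha> $ k + \<alpha> $ i + \<kappa> = \<alpha> $ i + \<alpha> $ j + \<alpha> $ k + \<kappa>" by auto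
    show ?thesis unfolding t[OF that(1)] t[OF that(2)] t[OF that(3)] e min_attained_twice_shift ..
  qed
  then show ?thesis unfolding tropical_line_def mem_Collect_eq by blast
qed

lemma normalised_pluecker_iff:
  assumes "tangent_data Q a \<kappa> \<beta>" shows "normalised_pluecker \<alpha> \<beta> \<longleftrightarrow> \<kappa> = 0"
proof -
  have a: "vge 0 (a $ j)" for j using assms by (simp add: tangent_data_def)
  have \<beta>: "\<beta> i j = ereal (\<alpha> $ i + \<alpha> $ j + \<kappa>) + val (a $ i - a $ j)" if "i \<noteq> j" for i j
    using assms that unfolding tangent_data_def by blast
  obtain k l where kl: "k \<noteq> l" "val (a $ k - a $ l) = 0" using assms unfolding tangent_data_def by blast
  have nn: "0 \<le> val (a $ i - a $ j)" for i j using vge_diff[OF a a] by (simp add: vge_def zero_ereal_def)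
  show ?thesis
  proof
    assume N: "normalised_pluecker \<alpha> \<beta>"
    have "ereal (\<alpha> $ k + \<alpha> $ l) \<le> \<beta> k l" using N kl(1) by (simp add: normalised_pluecker_def)
    then have "\<kappa> \<ge> 0" using \<beta>[OF kl(1)] kl(2) by simp
    moreover obtain i j where ij: "i \<noteq> j" "\<beta> i j = ereal (\<alpha> $ i + \<alpha> $ j)"
      using N by (auto simp: normalised_pluecker_def)
    have "\<kappa> \<le> 0" using \<beta>[OF ij(1)] ij(2) nn[of i j] by (cases "val (a $ i - a $ j)") auto
    ultimately show "\<kappa> = 0" by simp
  next
    assume \<kappa>: "\<kappa> = 0"
    have "ereal (\<alpha> $ i + \<alpha> $ j) \<le> \<beta> i j" if "i \<noteq> j" for i j
      unfolding \<beta>[OF that] using nn[of i j] \<kappa> by (cases "val (a $ i - a $ j)") auto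
    moreover have "\<beta> k l = ereal (\<alpha> $ k + \<alpha> $ l)" unfolding \<beta>[OF kl(1)] kl(2) \<kappa> by simp
    ultimately show "normalised_pluecker \<alpha> \<beta>" unfolding normalised_pluecker_def using kl(1) by blast
  qed
qed

lemma excess_tangent_data:
  assumes "tangent_data Q a 0 \<beta>" "i \<noteq> j" shows "excess \<alpha> \<beta> i j = val (a $ i - a $ j)"
proof -
  have "\<beta> i j = ereal (\<alpha> $ i + \<alpha> $ j + 0) + val (a $ i - a $ j)"
    using assms unfolding tangent_data_def by blast
  then show ?thesis unfolding excess_def by (cases "val (a $ i - a $ j)") auto
qed

lemma ray_component:
  "(v + (\<Sum>j\<in>- {i}. d j *\<^sub>R axis j 1) + r *\<^sub>R axis i 1 + t *\<^sub>R axis i 1) $ k =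
     (if k = i then v $ i + r + t else v $ k + d k)" for v :: "real ^ 'n"
proof -
  have "(\<Sum>j\<in>- {i}. d j * (axis j 1 :: real ^ 'n) $ k) = (\<Sum>j\<in>- {i}. if j = k then d j else 0)"
    by (intro sum.cong) (auto simp: axis_def)
  also have "\<dots> = (if k = i then 0 else d k)" by simp
  finally show ?thesis by (auto simp: axis_def)
qed

lemma tangent_ray_subset:
  assumes "tangent_data Q a 0 \<beta>" shows "tangent_ray \<alpha> (excess \<alpha> \<beta>) i \<subseteq> tropical_line \<beta>"
proof
  fix x assume "x \<in> tangent_ray \<alpha> (excess \<alpha> \<beta>) i"
  then obtain d t where d: "\<And>j. j \<noteq> i \<Longrightarrow> excess \<alpha> \<beta> i j = ereal (d j)" and t: "t \<ge> 0"
    and x: "trop_eq x (\<alpha> + (\<Sum>j\<in>- {i}. d j *\<^sub>R axis j 1) + Max (d ` (- {i})) *\<^sub>R axis i 1 + t *\<^sub>R axis i 1)"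
    unfolding tangent_ray_def by blast
  obtain c where c: "x = (\<alpha> + (\<Sum>j\<in>- {i}. d j *\<^sub>R axis j 1) + Max (d ` (- {i})) *\<^sub>R axis i 1 + t *\<^sub>R axis i 1) + c *\<^sub>R 1"
    using x by (auto simp: trop_eq_def)
  have xk: "x $ k = (if k = i then \<alpha> $ i + Max (d ` (- {i})) + t else \<alpha> $ k + d k) + c" for k
    unfolding c by (subst vector_add_component, subst ray_component) simp
  have "min_attained_twice (val (a $ p - a $ q) + ereal ((x - \<alpha>) $ r)) (val (a $ p - a $ r) + ereal ((x - \<alpha>) $ q))
      (val (a $ q - a $ r) + ereal ((x - \<alpha>) $ p))" if "p \<noteq> q" "p \<noteq> r" "q \<noteq> r" for p q r
  proof (rule tropical_ray[of i a d _ c "Max (d ` (- {i})) + t", OF _ _ _ _ that])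
    show "val (a $ i - a $ j) = ereal (d j)" if "j \<noteq> i" for j
      using d[OF that] excess_tangent_data[OF assms, of i j] that by simp
    show "(x - \<alpha>) $ j = c + d j" if "j \<noteq> i" for j using that by (simp add: xk)
    show "(x - \<alpha>) $ i = c + (Max (d ` (- {i})) + t)" by (simp add: xk)
    show "d j \<le> Max (d ` (- {i})) + t" if "j \<noteq> i" for j
    proof -
      have "d j \<in> d ` (- {i})" using that by simp
      then have "d j \<le> Max (d ` (- {i}))" by (intro Max_ge) auto
      then show ?thesis using t by simp
    qed
  qed
  then show "x \<in> tropical_line \<beta>" unfolding tropical_line_iff[OF assms] by blast
qed

abbreviation rays :: "(real ^ 'n) set" where
  "rays \<equiv> \<Union>\<beta>\<in>{\<beta> \<in> tropical_tangents val X \<alpha>. normalised_pluecker \<alpha> \<beta>}. \<Union>i. tangent_ray \<alpha> (excess \<alpha> \<beta>) i"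

lemma in_rays:
  assumes Q: "base_point Q" "Q * a \<in> tangent_space X Q" "\<And>j. vge 0 (a $ j)" "k \<noteq> l" "val (a $ k - a $ l) = 0"
    and d: "\<And>j. j \<noteq> i \<Longrightarrow> val (a $ i - a $ j) = ereal (d j)"
    and x: "\<And>j. j \<noteq> i \<Longrightarrow> x $ j = \<alpha> $ j + d j + c" "x $ i = \<alpha> $ i + s + c" "Max (d ` (- {i})) \<le> s"
  shows "x \<in> rays"
proof -
  define \<beta> where "\<beta> i j = ereal (\<alpha> $ i + \<alpha> $ j + 0) + val (a $ i - a $ j)" for i j
  have td: "tangent_data Q a 0 \<beta>" unfolding tangent_data_def \<beta>_def using Q by blast
  have "x = (\<alpha> + (\<Sum>j\<in>- {i}. d j *\<^sub>R axis j 1) + Max (d ` (- {i})) *\<^sub>R axis i 1 + (s - Max (d ` (- {i}))) *\<^sub>R axis i 1) + c *\<^sub>R 1"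
    unfolding vec_eq_iff
  proof
    fix k
    show "x $ k = (\<alpha> + (\<Sum>j\<in>- {i}. d j *\<^sub>R axis j 1) + Max (d ` (- {i})) *\<^sub>R axis i 1
        + (s - Max (d ` (- {i}))) *\<^sub>R axis i 1 + c *\<^sub>R 1) $ k"
      by (subst vector_add_component, subst ray_component) (use x in auto)
  qed
  then have "trop_eq x (\<alpha> + (\<Sum>j\<in>- {i}. d j *\<^sub>R axis j 1) + Max (d ` (- {i})) *\<^sub>R axis i 1 + (s - Max (d ` (- {i}))) *\<^sub>R axis i 1)"
    unfolding trop_eq_def by blast
  moreover have "0 \<le> s - Max (d ` (- {i}))" using x(3) by simp
  moreover have "\<forall>j. j \<noteq> i \<longrightarrow> excess \<alpha> \<beta> i j = ereal (d j)"
    using excess_tangent_data[OF td] d by simp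
  ultimately have "x \<in> tangent_ray \<alpha> (excess \<alpha> \<beta>) i" unfolding tangent_ray_def by blast
  moreover have "\<beta> \<in> {\<beta> \<in> tropical_tangents val X \<alpha>. normalised_pluecker \<alpha> \<beta>}"
    using tangent_data_tropical_tangent[OF td] normalised_pluecker_iff[OF td] by simp
  ultimately show ?thesis by blast
qed

text \<open>A point at leaf \<open>i\<close> and height \<open>s\<close> is on the ray of
  \<open>i\<close> if no \<open>val (a $ i - a $ j)\<close> exceeds \<open>s\<close>. Otherwise a
  deformation at a height \<open>s'\<close> just above \<open>s\<close> cuts all these valuations
  off at \<open>s'\<close>. The point of leaf \<open>i\<close> and height \<open>s'\<close> is then
  on a ray, and its coordinates differ from those of \<open>x\<close> by at most
  \<open>s' - s\<close>.\<close>

lemma tropical_line_subset: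
  assumes td: "tangent_data Q a \<kappa> \<beta>" and x: "x \<in> tropical_line \<beta>"
  shows "x \<in> closure rays"
proof -
  have Q: "base_point Q" "Q * a \<in> tangent_space X Q" and a: "vge 0 (a $ j)" for j
    using td unfolding tangent_data_def by blast+
  obtain k l where kl: "k \<noteq> l" "val (a $ k - a $ l) = 0" using td unfolding tangent_data_def by blast
  have nn: "0 \<le> val (a $ i - a $ j)" for i j using vge_diff[OF a a] by (simp add: vge_def zero_ereal_def)
  have "\<exists>i s c. s \<ge> 0 \<and> (x - \<alpha>) $ i = c + s \<and>
      (\<forall>j. j \<noteq> i \<longrightarrow> ereal ((x - \<alpha>) $ j - c) = min (val (a $ i - a $ j)) (ereal s))"
  proof (rule tropical_tree)
    show "val (a $ i - a $ j) = val (a $ j - a $ i)" for i j by (rule val_diff_commute)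
    show "min (val (a $ i - a $ k)) (val (a $ j - a $ k)) \<le> val (a $ i - a $ j)" for i j k
      using val_add[of "a $ i - a $ k" "a $ k - a $ j"] val_diff_commute[of "a $ j" "a $ k"] by simp
    show "min_attained_twice (val (a $ i - a $ j) + ereal ((x - \<alpha>) $ k)) (val (a $ i - a $ k) + ereal ((x - \<alpha>) $ j))
      (val (a $ j - a $ k) + ereal ((x - \<alpha>) $ i))" if "i \<noteq> j" "i \<noteq> k" "j \<noteq> k" for i j k
      using x that unfolding tropical_line_iff[OF td] by blast
  qed (use nn kl in auto)
  then obtain i s c where s: "s \<ge> 0" and xi: "(x - \<alpha>) $ i = c + s"
    and xj: "\<And>j. j \<noteq> i \<Longrightarrow> ereal ((x - \<alpha>) $ j - c) = min (val (a $ i - a $ j)) (ereal s)" by blast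
  have ne: "- {i} \<noteq> {}"
  proof -
    have "k \<in> - {i} \<or> l \<in> - {i}" using kl(1) by auto
    then show ?thesis by blast
  qed
  show ?thesis
  proof (cases "\<forall>j. j \<noteq> i \<longrightarrow> val (a $ i - a $ j) \<le> ereal s")
    case True
    define d where "d j = (x - \<alpha>) $ j - c" for j
    have d: "val (a $ i - a $ j) = ereal (d j)" "d j \<le> s" if "j \<noteq> i" for j
    proof -
      have le: "val (a $ i - a $ j) \<le> ereal s" using True that by blast
      show eq: "val (a $ i - a $ j) = ereal (d j)" using xj[OF that] min_absorb1[OF le] by (simp add: d_def)
      show "d j \<le> s" using le unfolding eq by simp
    qed
    have "Max (d ` (- {i})) \<le> s" using d(2) ne by (subst Max_le_iff) auto
    then have "x \<in> rays"
      using xi by (intro in_rays[where i = i and d = d and c = c and s = s, OF Q a kl d(1)]) (auto simp: d_def algebra_simps)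
    then show ?thesis by (rule subsetD[OF closure_subset])
  next
    case False
    then obtain j0 where j0: "j0 \<noteq> i" "ereal s < val (a $ i - a $ j0)" by (auto simp: not_le)
    show ?thesis
      unfolding closure_approachable
    proof (intro allI impI)
      fix \<epsilon> :: real assume \<epsilon>: "\<epsilon> > 0"
      obtain m where m: "s < m" "ereal m \<le> val (a $ i - a $ j0)" "m \<le> s + \<epsilon> / (2 * real CARD('n))"
      proof -
        obtain m0 where m0: "ereal s < ereal m0" "ereal m0 < val (a $ i - a $ j0)"
          using ereal_dense2[OF j0(2)] by blast
        define m where "m = min m0 (s + \<epsilon> / (2 * real CARD('n)))"
        have "s < m" using m0(1) \<epsilon> by (simp add: m_def)
        moreover have "ereal m \<le> val (a $ i - a $ j0)"
          using order_trans[of "ereal m" "ereal m0"] m0(2) by (auto simp: m_def intro: less_imp_le)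
        moreover have "m \<le> s + \<epsilon> / (2 * real CARD('n))" by (simp add: m_def)
        ultimately show ?thesis by (rule that)
      qed
      \<comment> \<open>\<open>s'\<close> has to belong to the value group; lying strictly above
        \<open>s\<close>, it is positive even for \<open>s = 0\<close>.\<close>
      obtain t s' where t: "val t = ereal s'" "\<bar>s' - (s + m) / 2\<bar> < (m - s) / 2"
        using value_group_dense[of "(m - s) / 2" "(s + m) / 2"] m(1) by auto
      have s': "s < s'" "s' < m" using t(2) by (auto simp: abs_less_iff field_simps)
      have s'0: "s' > 0" using s s' by simp
      obtain Q' a' where Q': "base_point Q'" "Q' * a' \<in> tangent_space X Q'"
        and a': "\<And>k l. k \<noteq> l \<Longrightarrow> val (a' $ k - a' $ l) = min (val (a $ k - a $ l)) (ereal s')"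
        using deformed_base_point[OF Q a kl(2) t(1) s'0] by blast
      \<comment> \<open>\<open>deformed_base_point\<close> controls only the differences of
        \<open>a'\<close>; subtracting one coordinate makes every entry such a difference and hence
        integral.\<close>
      define a'' where "a'' = a' - (a' $ i) *s 1"
      have a''d: "a'' $ p - a'' $ q = a' $ p - a' $ q" for p q by (simp add: a''_def)
      have kl': "val (a' $ k - a' $ l) = 0" using a'[OF kl(1)] kl(2) s'0 by (simp add: min_absorb1)
      have "a' $ k \<noteq> a' $ l" using kl' by auto
      note sp = tangent_space_span[OF Q' this]
      have "Q' * a'' = (- (a' $ i)) *s Q' + 1 *s (Q' * a')" by (simp add: a''_def vec_eq_iff algebra_simps)
      then have Ta'': "Q' * a'' \<in> tangent_space X Q'" unfolding sp vec_span_pair by blast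
      have a''0: "vge 0 (a'' $ j)" for j
      proof (cases "j = i")
        case False
        have "val (a'' $ j) = min (val (a $ j - a $ i)) (ereal s')"
          using a'[OF False] by (simp add: a''_def)
        then show ?thesis using nn[of j i] s'0 by (simp add: vge_def zero_ereal_def)
      qed (simp add: a''_def)
      define d where "d j = real_of_ereal (min (val (a $ i - a $ j)) (ereal s'))" for j
      have d: "val (a'' $ i - a'' $ j) = ereal (d j)" "min (val (a $ i - a $ j)) (ereal s') = ereal (d j)"
        if "j \<noteq> i" for j
      proof -
        show e: "min (val (a $ i - a $ j)) (ereal s') = ereal (d j)"
          unfolding d_def using nn[of i j] s'0 by (cases "val (a $ i - a $ j)") (auto simp: min_def)
        show "val (a'' $ i - a'' $ j) = ereal (d j)" unfolding a''d using a'[of i j] that e by simp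
      qed
      have dle: "d j \<le> s'" if "j \<noteq> i" for j using d(2)[OF that] by (metis ereal_less_eq(3) min.cobounded2)
      define x' where "x' = (\<chi> j. if j = i then \<alpha> $ i + s' + c else \<alpha> $ j + d j + c)"
      have "Max (d ` (- {i})) \<le> s'" using dle ne by (subst Max_le_iff) auto
      then have "x' \<in> rays"
        using kl' by (intro in_rays[where i = i and d = d and c = c and s = s', OF Q'(1) Ta'' a''0 kl(1) _ d(1)]) (auto simp: x'_def a''d)
      moreover have "dist x' x < \<epsilon>"
      proof -
        have "\<bar>(x' - x) $ j\<bar> \<le> s' - s" for j
        proof (cases "j = i")
          case True
          then show ?thesis using xi s' by (simp add: x'_def)
        next
          case False
          have "\<bar>d j - ((x - \<alpha>) $ j - c)\<bar> \<le> s' - s"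
            using xj[OF False] d(2)[OF False] s' by (cases "val (a $ i - a $ j)") (auto simp: min_def split: if_splits)
          then show ?thesis using False by (simp add: x'_def)
        qed
        then have "norm (x' - x) \<le> real CARD('n) * (s' - s)"
          using order_trans[OF norm_le_l1_cart sum_bounded_above[of UNIV "\<lambda>j. \<bar>(x' - x) $ j\<bar>" "s' - s"]] by simp
        also have "\<dots> \<le> real CARD('n) * (\<epsilon> / (2 * real CARD('n)))"
          using s' m(3) by (intro mult_left_mono) auto
        also have "\<dots> < \<epsilon>" using \<epsilon> by (simp add: field_simps)
        finally show ?thesis by (simp add: dist_norm)
      qed
      ultimately show "\<exists>y\<in>rays. dist y x < \<epsilon>" by blast
    qed
  qed
qed

theorem contribution_eq_rays: "contribution val X \<alpha> = closure rays"
proof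
  show "contribution val X \<alpha> \<subseteq> closure rays"
    unfolding contribution_def
  proof (rule closure_minimal)
    show "(\<Union>\<beta>\<in>tropical_tangents val X \<alpha>. tropical_line \<beta>) \<subseteq> closure rays"
      using tropical_tangent_data tropical_line_subset by blast
  qed simp
  have "rays \<subseteq> (\<Union>\<beta>\<in>tropical_tangents val X \<alpha>. tropical_line \<beta>)"
  proof
    fix x assume "x \<in> rays"
    then obtain \<beta> i where \<beta>: "\<beta> \<in> tropical_tangents val X \<alpha>" "normalised_pluecker \<alpha> \<beta>"
      "x \<in> tangent_ray \<alpha> (excess \<alpha> \<beta>) i" by blast
    obtain Q a \<kappa> where "tangent_data Q a \<kappa> \<beta>" using tropical_tangent_data[OF \<beta>(1)] by blast
    moreover from this have "\<kappa> = 0" using normalised_pluecker_iff \<beta>(2) by blast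
    ultimately have "x \<in> tropical_line \<beta>" using tangent_ray_subset \<beta>(3) by blast
    then show "x \<in> (\<Union>\<beta>\<in>tropical_tangents val X \<alpha>. tropical_line \<beta>)" using \<beta>(1) by blast
  qed
  then show "closure rays \<subseteq> contribution val X \<alpha>" unfolding contribution_def by (rule closure_mono)
qed

end

theorem proposition5p3p4:
  fixes val :: "'k::{alg_closed_field, field_char_0} \<Rightarrow> ereal"
    and n :: nat
    and X :: "('k ^ 'n::finite) set"
    and f :: "nat \<Rightarrow> ('k, 'n) laurent"
    and \<alpha> :: "real ^ 'n"
  assumes "valuation val"
    and "\<exists>x. x \<noteq> 0 \<and> val x \<noteq> 0"
    and "\<forall>m::int. m \<noteq> 0 \<longrightarrow> val (of_int m) = 0"
    and "CARD('n) = n + 1"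
    and "curve X"
    and "\<forall>i\<in>{1..<n}. f i \<in> torus_ring \<and> f i \<noteq> 0"
    and "torus_complete_intersection n f X"
    and "tropical_complete_intersection val n f"
    and "\<forall>i\<in>{1..<n}. three_terms_in_codim_one val (f i)"
    and "very_general_valuations val n f X"
    and "vertex val n f \<alpha>"
    and "tame val X \<alpha>"
  shows "contribution val X \<alpha> =
    closure (\<Union>\<beta>\<in>{\<beta> \<in> tropical_tangents val X \<alpha>. normalised_pluecker \<alpha> \<beta>}.
               \<Union>i. tangent_ray \<alpha> (excess \<alpha> \<beta>) i)"
proof (cases "tropical_tangents val X \<alpha> = {}")
  \<comment> \<open>Without a smooth lift of \<open>\<alpha>\<close> both sides are the closure of
    the empty set.\<close>
  case True
  then show ?thesis by (simp add: contribution_def)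
next
  case False
  then obtain \<beta> where "\<beta> \<in> tropical_tangents val X \<alpha>" by blast
  then obtain P where P: "smooth_point X P" "P \<in> torus" "trop_eq (trop_point val P) \<alpha>"
    unfolding tropical_tangents_def by blast
  \<comment> \<open>A tangent space of dimension two needs at least two coordinates.\<close>
  have "vec.dim (tangent_space X P) \<le> CARD('n)"
    by (rule dim_subset_UNIV_cart_gen)
  then have n: "n \<ge> 1" using P(1) assms(4) by (simp add: smooth_point_def)
  interpret curve_vertex val n X f \<alpha> P
  proof unfold_locales
    show "P \<in> X" using P(1) by (simp add: smooth_point_def)
    show "trop_eq \<alpha> (trop_point val P)" using P(3) by (rule trop_eq_sym)
  qed (use assms P n in auto)
  show ?thesis by (rule contribution_eq_rays)
qed

end
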